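(* Let $f_b=0$, $\alpha=0$ and $\phi_b>0$. Suppose that $f_\infty\in L^1(\mathbb{R}^3)$ satisfies $f_\infty\ge 0$, $\int_{\mathbb{R}^3} f_\infty(\xi)\,d\xi=1$, and $f_\infty(\xi)=0$ for $\xi_1>0$. Let $V$ and $B$ be the function and the set associated with $f_\infty$ in the context, and let (VP) be the boundary value problem in the context. (i) Assume that $\int_{\mathbb{R}^3}\xi_1^{-2}f_\infty(\xi)\,d\xi<1$. Then the set $B$ is not empty. Furthermore, if and only if $\phi_b<\sup B$ holds, the problem (VP) has a unique solution $(f,\phi)$. There also hold that $$f(x,\xi)=f_\infty\bigl(-\sqrt{\xi_1^2-2\phi(x)},\xi'\bigr)\,\chi(\xi_1^2-2\phi(x))\,\chi(-\xi_1), \qquad (\ast)$$ $$|\partial_x^l\phi(x)|\le Ce^{-cx}\quad\text{for } l=0,1,2,$$ where $c$ and $C$ are positive constants independent of $x$. In addition, if $f_\infty\in C^2(\mathbb{R}^3)$, then the solution satisfies $(f,\phi)\in C^1(\overline{\mathbb{R}_+}\times\mathbb{R}^3)\times C^2(\overline{\mathbb{R}_+})$ and is a classical solution. (ii) Assume that $\int_{\mathbb{R}^3}\xi_1^{-2}f_\infty(\xi)\,d\xi=1$ and $B\neq\emptyset$. If and only if $\phi_b<\sup B$ holds, the problem (VP) has a unique solution $(f,\phi)$. Further, $(\ast)$ holds. If $f_\infty\in C^2(\mathbb{R}^3)$, then the solution satisfies $(f,\phi)\in C^1(\overline{\mathbb{R}_+}\times\mathbb{R}^3)\times C^2(\overline{\mathbb{R}_+})$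 and is a classical solution. (iii) Assume that $\int_{\mathbb{R}^3}\xi_1^{-2}f_\infty(\xi)\,d\xi=1$ and $B=\emptyset$. Then the problem (VP) admits no solution. (iv) Assume that $\int_{\mathbb{R}^3}\xi_1^{-2}f_\infty(\xi)\,d\xi>1$ (this includes the case where the integral is $+\infty$). Then the problem (VP) admits no solution.
   Context: Notation: $\mathbb{R}_+=\{x>0\}$, $\overline{\mathbb{R}_+}=[0,\infty)$; $\xi=(\xi_1,\xi_2,\xi_3)=(\xi_1,\xi')\in\mathbb{R}^3$; $\mathbb{R}^3_+=\{\xi\in\mathbb{R}^3:\xi_1>0\}$. $\chi(s)$ is the one-dimensional indicator function of $\{s>0\}$; an expression multiplied by a vanishing $\chi$-factor is $0$. Equalities between $L^1$ functions are understood almost everywhere in $\xi$. The function $n_e\in C^2(\mathbb{R})$ is given with $n_e(0)=1$, $n_e'(0)=-1$. The problem (VP), with data $\alpha\in[0,1]$, $\phi_b\in\mathbb{R}$ and nonnegative functions $f_b$ on $\mathbb{R}^3_+$ and $f_\infty$ on $\mathbb{R}^3$, is to find $f=f(x,\xi)$, $\phi=\phi(x)$ with $$\xi_1\partial_xf+\partial_x\phi\,\partial_{\xi_1}f=0,\qquad \partial_{xx}\phi=\int_{\mathbb{R}^3}f\,d\xi-n_e(\phi),\qquad x>0,\ \xi\in\mathbb{R}^3,$$ $$f(0,\xi)=f_b(\xi)+\alpha f(0,-\xi_1,\xi')\ (\xi_1>0),\quad \phi(0)=\phi_b,\quad \lim_{x\to\infty}f(x,\xi)=f_\infty(\xi),\quad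 \lim_{x\to\infty}\phi(x)=0.$$ $(f,\phi)$ is called a solution of (VP) if: (1) $f\in L^1_{loc}(\overline{\mathbb{R}_+}\times\mathbb{R}^3)\cap C(\overline{\mathbb{R}_+};L^1(\mathbb{R}^3))$ and $\phi\in C^1(\overline{\mathbb{R}_+})\cap C^2(\mathbb{R}_+)$; (2) $f\ge0$, and either $\partial_x\phi(x)>0$ for all $x\in\overline{\mathbb{R}_+}$ or $\partial_x\phi(x)<0$ for all $x\in\overline{\mathbb{R}_+}$; (3) $(f,\xi_1\partial_x\psi+\partial_x\phi\,\partial_{\xi_1}\psi)_{L^2(\mathbb{R}_+\times\mathbb{R}^3)}+(f_b,\xi_1\psi(0,\cdot))_{L^2(\mathbb{R}^3_+)}=0$ for all $\psi\in\mathcal{X}$, where $\mathcal{X}=\{\psi\in C_0^1(\overline{\mathbb{R}_+}\times\mathbb{R}^3): \alpha\psi(0,\xi_1,\xi')=\psi(0,-\xi_1,\xi')\text{ for }(\xi_1,\xi')\in\mathbb{R}^3_+\}$ ($C^1$ functions with compact support in $\overline{\mathbb{R}_+}\times\mathbb{R}^3$), and $\lim_{x\to\infty}\|f(x,\cdot)-f_\infty\|_{L^1(\mathbb{R}^3)}=0$; (4) $\phi$ solves $\partial_{xx}\phi=\int_{\mathbb{R}^3}f\,d\xi-n_e(\phi)$ for $x>0$ with $\phi(0)=\phi_b$ and $\lim_{x\to\infty}\phi(x)=0$ in the classical sense. For $f_\infty$ as in the claim and $\phi\ge0$, $$\rho_i(\phi):=\int_{\mathbb{R}^3}f_\infty(\xi)\frac{-\xi_1}{\sqrt{\xi_1^2+2\phi}}\,d\xi,\qquad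 V(\phi):=\int_0^\phi\bigl(\rho_i(\varphi)-n_e(\varphi)\bigr)\,d\varphi,$$ $$B:=\{\varphi>0:\ V(\phi)>0\ \text{for all }\phi\in(0,\varphi]\}$$ ($\sup B=+\infty$ is allowed). *)

theory Defs
  imports "HOL-Analysis.Analysis"
begin

text \<open>A velocity is \<open>\<xi> = (\<xi>\<^sub>1, \<xi>') = (\<xi>\<^sub>1, \<xi>\<^sub>2, \<xi>\<^sub>3)\<close>, so \<open>\<xi>\<^sub>1 = fst \<xi>\<close> and \<open>\<xi>' = snd \<xi>\<close>; the norm and the
  Lebesgue measure on this product are those of Euclidean 3-space. Functions of \<open>x \<ge> 0\<close> are
  represented by functions on all of \<^typ>\<open>real\<close> whose values at \<open>x < 0\<close> are never used.
  An element of \<open>L\<^sup>1\<close> is represented by a Lebesgue measurable function, identified up to null sets.\<close>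

type_synonym vel = "real \<times> real \<times> real"

section \<open>Differentiability classes\<close>

text \<open>Derivatives are taken within \<open>S\<close>, hence one-sided at the boundary of a half-space. The definitions
  are used only for open sets and closed half-spaces, where the derivative is unique.\<close>

definition C1_on :: "'a::real_normed_vector set \<Rightarrow> ('a \<Rightarrow> 'b::real_normed_vector) \<Rightarrow> bool" where
  "C1_on S f \<longleftrightarrow> (\<exists>f'. (\<forall>z\<in>S. (f has_derivative blinfun_apply (f' z)) (at z within S)) \<and>
     continuous_on S f')"

definition C2_on :: "'a::real_normed_vector set \<Rightarrow> ('a \<Rightarrow> 'b::real_normed_vector) \<Rightarrow> bool" where
  "C2_on S f \<longleftrightarrow> (\<exists>f'. (\<forall>z\<in>S. (f has_derivative blinfun_apply (f' z)) (at z within S)) \<and>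
     C1_on S f')"

text \<open>Derivative of a function on \<open>[0, \<infinity>)\<close>, one-sided at \<open>0\<close>.\<close>

definition Dx :: "(real \<Rightarrow> real) \<Rightarrow> real \<Rightarrow> real" where
  "Dx \<phi> x = vector_derivative \<phi> (at x within {0..})"

definition partial_x :: "(real \<Rightarrow> vel \<Rightarrow> real) \<Rightarrow> real \<Rightarrow> vel \<Rightarrow> real" where
  "partial_x g x \<xi> = deriv (\<lambda>y. g y \<xi>) x"

definition partial_xi1 :: "(real \<Rightarrow> vel \<Rightarrow> real) \<Rightarrow> real \<Rightarrow> vel \<Rightarrow> real" where
  "partial_xi1 g x \<xi> = deriv (\<lambda>s. g x (s, snd \<xi>)) (fst \<xi>)"

section \<open>The boundary value problem\<close>

text \<open>\<open>L\<^sup>1\<^sub>l\<^sub>o\<^sub>c([0,\<infinity>) \<times> \<real>\<^sup>3)\<close> and \<open>C([0,\<infinity>); L\<^sup>1(\<real>\<^sup>3))\<close>.\<close>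

definition L1_loc :: "(real \<Rightarrow> vel \<Rightarrow> real) \<Rightarrow> bool" where
  "L1_loc f \<longleftrightarrow> (\<forall>K. compact K \<and> K \<subseteq> {0..} \<times> UNIV \<longrightarrow>
     set_integrable lebesgue K (\<lambda>(x, \<xi>). f x \<xi>))"

definition C_L1 :: "(real \<Rightarrow> vel \<Rightarrow> real) \<Rightarrow> bool" where
  "C_L1 f \<longleftrightarrow> (\<forall>x\<ge>0. integrable lebesgue (f x)) \<and>
     (\<forall>x\<ge>0. ((\<lambda>y. LINT \<xi>|lebesgue. \<bar>f y \<xi> - f x \<xi>\<bar>) \<longlongrightarrow> 0) (at x within {0..}))"

definition test_functions :: "real \<Rightarrow> (real \<Rightarrow> vel \<Rightarrow> real) set" where
  "test_functions \<alpha> = {\<psi>. C1_on ({0..} \<times> UNIV) (\<lambda>(x, \<xi>). \<psi> x \<xi>) \<and>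
     compact (closure {(x, \<xi>). 0 \<le> x \<and> \<psi> x \<xi> \<noteq> 0}) \<and>
     (\<forall>\<xi>\<^sub>1>0. \<forall>\<xi>'. \<alpha> * \<psi> 0 (\<xi>\<^sub>1, \<xi>') = \<psi> 0 (- \<xi>\<^sub>1, \<xi>'))}"

definition weak_Vlasov ::
  "real \<Rightarrow> (vel \<Rightarrow> real) \<Rightarrow> (real \<Rightarrow> vel \<Rightarrow> real) \<Rightarrow> (real \<Rightarrow> real) \<Rightarrow> bool" where
  "weak_Vlasov \<alpha> f\<^sub>b f \<phi> \<longleftrightarrow> (\<forall>\<psi>\<in>test_functions \<alpha>.
     (LINT (x, \<xi>) : {0<..} \<times> UNIV | lebesgue.
        f x \<xi> * (fst \<xi> * partial_x \<psi> x \<xi> + Dx \<phi> x * partial_xi1 \<psi> x \<xi>)) +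
     (LINT \<xi> : {\<xi>. fst \<xi> > 0} | lebesgue. f\<^sub>b \<xi> * (fst \<xi> * \<psi> 0 \<xi>)) = 0)"

text \<open>The four groups of conditions are: regularity, signs, the Vlasov equation with its boundary
  data, and the Poisson equation with its boundary data.\<close>

definition VP_solution ::
  "(real \<Rightarrow> real) \<Rightarrow> real \<Rightarrow> (vel \<Rightarrow> real) \<Rightarrow> real \<Rightarrow> (vel \<Rightarrow> real) \<Rightarrow>
   (real \<Rightarrow> vel \<Rightarrow> real) \<Rightarrow> (real \<Rightarrow> real) \<Rightarrow> bool" where
  "VP_solution n\<^sub>e \<alpha> f\<^sub>b \<phi>\<^sub>b f_inf f \<phi> \<longleftrightarrow>
     (L1_loc f \<and> C_L1 f \<and> C1_on {0..} \<phi> \<and> C2_on {0<..} \<phi>) \<and>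
     ((\<forall>x\<ge>0. AE \<xi> in lebesgue. 0 \<le> f x \<xi>) \<and>
      ((\<forall>x\<ge>0. Dx \<phi> x > 0) \<or> (\<forall>x\<ge>0. Dx \<phi> x < 0))) \<and>
     (weak_Vlasov \<alpha> f\<^sub>b f \<phi> \<and>
      ((\<lambda>x. LINT \<xi>|lebesgue. \<bar>f x \<xi> - f_inf \<xi>\<bar>) \<longlongrightarrow> 0) at_top) \<and>
     ((\<forall>x>0. Dx (Dx \<phi>) x = (LINT \<xi>|lebesgue. f x \<xi>) - n\<^sub>e (\<phi> x)) \<and>
      \<phi> 0 = \<phi>\<^sub>b \<and> (\<phi> \<longlongrightarrow> 0) at_top)"

definition VP_unique_solution ::
  "(real \<Rightarrow> real) \<Rightarrow> real \<Rightarrow> (vel \<Rightarrow> real) \<Rightarrow> real \<Rightarrow> (vel \<Rightarrow> real) \<Rightarrow> bool" where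
  "VP_unique_solution n\<^sub>e \<alpha> f\<^sub>b \<phi>\<^sub>b f_inf \<longleftrightarrow>
     (\<exists>f \<phi>. VP_solution n\<^sub>e \<alpha> f\<^sub>b \<phi>\<^sub>b f_inf f \<phi> \<and>
       (\<forall>g \<eta>. VP_solution n\<^sub>e \<alpha> f\<^sub>b \<phi>\<^sub>b f_inf g \<eta> \<longrightarrow>
          (\<forall>x\<ge>0. (AE \<xi> in lebesgue. g x \<xi> = f x \<xi>) \<and> \<eta> x = \<phi> x)))"

definition VP_classical_solution ::
  "(real \<Rightarrow> real) \<Rightarrow> real \<Rightarrow> (vel \<Rightarrow> real) \<Rightarrow> real \<Rightarrow> (vel \<Rightarrow> real) \<Rightarrow>
   (real \<Rightarrow> vel \<Rightarrow> real) \<Rightarrow> (real \<Rightarrow> real) \<Rightarrow> bool" where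
  "VP_classical_solution n\<^sub>e \<alpha> f\<^sub>b \<phi>\<^sub>b f_inf f \<phi> \<longleftrightarrow>
     C1_on ({0..} \<times> UNIV) (\<lambda>(x, \<xi>). f x \<xi>) \<and> C2_on {0..} \<phi> \<and>
     (\<forall>x>0. \<forall>\<xi>. fst \<xi> * partial_x f x \<xi> + Dx \<phi> x * partial_xi1 f x \<xi> = 0) \<and>
     (\<forall>x>0. integrable lebesgue (f x) \<and>
        Dx (Dx \<phi>) x = (LINT \<xi>|lebesgue. f x \<xi>) - n\<^sub>e (\<phi> x)) \<and>
     (\<forall>\<xi>\<^sub>1>0. \<forall>\<xi>'. f 0 (\<xi>\<^sub>1, \<xi>') = f\<^sub>b (\<xi>\<^sub>1, \<xi>') + \<alpha> * f 0 (- \<xi>\<^sub>1, \<xi>')) \<and>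
     \<phi> 0 = \<phi>\<^sub>b \<and>
     (\<forall>\<xi>. ((\<lambda>x. f x \<xi>) \<longlongrightarrow> f_inf \<xi>) at_top) \<and>
     (\<phi> \<longlongrightarrow> 0) at_top"

section \<open>The Sagdeev potential and the Bohm criterion\<close>

definition rho_i :: "(vel \<Rightarrow> real) \<Rightarrow> real \<Rightarrow> real" where
  "rho_i f_inf s = (LINT \<xi>|lebesgue. f_inf \<xi> * (- fst \<xi> / sqrt ((fst \<xi>)\<^sup>2 + 2 * s)))"

text \<open>Only meaningful for \<open>s \<ge> 0\<close>.\<close>

definition Vpot :: "(real \<Rightarrow> real) \<Rightarrow> (vel \<Rightarrow> real) \<Rightarrow> real \<Rightarrow> real" where
  "Vpot n\<^sub>e f_inf s = integral {0..s} (\<lambda>t. rho_i f_inf t - n\<^sub>e t)"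

definition Bset :: "(real \<Rightarrow> real) \<Rightarrow> (vel \<Rightarrow> real) \<Rightarrow> real set" where
  "Bset n\<^sub>e f_inf = {b. b > 0 \<and> (\<forall>s\<in>{0<..b}. Vpot n\<^sub>e f_inf s > 0)}"

definition supB :: "(real \<Rightarrow> real) \<Rightarrow> (vel \<Rightarrow> real) \<Rightarrow> ereal" where
  "supB n\<^sub>e f_inf = (SUP b\<in>Bset n\<^sub>e f_inf. ereal b)"

text \<open>The integral of \<open>\<xi>\<^sub>1\<^sup>-\<^sup>2 f_inf\<close>, possibly \<open>\<infinity>\<close>; the null set \<open>\<xi>\<^sub>1 = 0\<close>, where HOL division
  gives \<open>0\<close>, is irrelevant.\<close>

definition Bohm_integral :: "(vel \<Rightarrow> real) \<Rightarrow> ennreal" where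
  "Bohm_integral f_inf = (\<integral>\<^sup>+ \<xi>. ennreal (f_inf \<xi> / (fst \<xi>)\<^sup>2) \<partial>lebesgue)"

definition transported :: "(vel \<Rightarrow> real) \<Rightarrow> (real \<Rightarrow> real) \<Rightarrow> real \<Rightarrow> vel \<Rightarrow> real" where
  "transported f_inf \<phi> x \<xi> =
     f_inf (- sqrt ((fst \<xi>)\<^sup>2 - 2 * \<phi> x), snd \<xi>) *
     indicat_real {0<..} ((fst \<xi>)\<^sup>2 - 2 * \<phi> x) * indicat_real {0<..} (- fst \<xi>)"

end

theory Submission
  imports Defs
begin

text \<open>An ion that has velocity \<open>\<eta>\<close> at infinity, \<open>\<eta>\<^sub>1 < 0\<close>, arrives at a point of potential \<open>a > 0\<close> with
  \<open>\<xi>\<^sub>1 = - sqrt (\<eta>\<^sub>1\<^sup>2 + 2 a)\<close> (the map \<open>fall\<close>), so the density at that point is the density at infinity carried along by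
  this map (\<open>accelerated\<close>); its total mass is \<open>\<rho>\<^sub>i(a)\<close>. Once every solution is known to have this form, Poisson's
  equation becomes the autonomous equation \<open>\<phi>'' = V'(\<phi>)\<close>. Its energy \<open>\<phi>'\<^sup>2 / 2 - V(\<phi>)\<close> is constant and vanishes at infinity,
  hence \<open>\<phi>' = - sqrt (2 V(\<phi>))\<close> with \<open>V > 0\<close> on \<open>(0, \<phi>\<^sub>b]\<close>, that is, \<open>\<phi>\<^sub>b \<in> B\<close>. Conversely, if \<open>\<phi>\<^sub>b \<in> B\<close>, separation of
  variables gives exactly one such \<open>\<phi>\<close>; it needs infinite length to fall to \<open>0\<close> because \<open>V(s) = O(s\<^sup>2)\<close>. As \<open>B\<close> is an
  interval that does not contain its supremum, \<open>\<phi>\<^sub>b \<in> B\<close> means \<open>\<phi>\<^sub>b < sup B\<close>.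

  The four cases are distinguished by \<open>V\<close> near \<open>0\<close>. There \<open>n\<^sub>e(s) = 1 - s + o(s)\<close>, and \<open>(1 - \<rho>\<^sub>i(s)) / s\<close> is at most the Bohm
  integral \<open>\<beta>\<close> and, by Fatou's lemma, eventually above every number below \<open>\<beta>\<close>. For \<open>\<beta> < 1\<close> this makes \<open>V \<ge> c s\<^sup>2\<close>, so \<open>B\<close> is not
  empty and the decay is exponential; for \<open>\<beta> > 1\<close> it makes \<open>V < 0\<close>, so \<open>B\<close> is empty.

  The kinetic part rests on test functions \<open>\<theta>(x) \<kappa>(\<xi>\<^sub>1) w(\<xi>\<^sub>1\<^sup>2 / 2 - \<phi>(x), \<xi>')\<close>. The energy is an invariant of the flow, so the Vlasov
  operator acts on \<open>\<theta>\<close> and \<open>\<kappa>\<close> only (\<open>weak_product\<close>). With \<open>\<theta>\<close> decreasing and \<open>\<kappa>\<close> a step supported in \<open>\<xi>\<^sub>1 > 0\<close>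
  the test function decreases along the flow, and since \<open>f \<ge> 0\<close> the weak equation forces \<open>f = 0\<close> for \<open>\<xi>\<^sub>1 > 0\<close> (\<open>f_zero_outgoing\<close>). With \<open>\<kappa> = 1\<close> and
  \<open>\<theta>\<close> arbitrary up to \<open>\<theta>(0) = 0\<close>, the flux of \<open>w\<close> is seen to be independent of \<open>x\<close> and therefore equal to its value at infinity (\<open>flux_constant\<close>).
  These fluxes for all \<open>w\<close> determine \<open>f\<close> on \<open>\<xi>\<^sub>1 < 0\<close> (\<open>f_eq_accelerated\<close>), also where the energy is negative, where they vanish.
  Conversely the transported density is a weak solution because in the variables \<open>(x, \<eta>)\<close> the Vlasov operator is a
  derivative along trajectories (\<open>transported_weak\<close>).

  If \<open>f_inf\<close> is \<open>C\<^sup>2\<close>, it vanishes to second order at \<open>\<xi>\<^sub>1 = 0\<close>, so it is a \<open>C\<^sup>1\<close> function of \<open>\<xi>\<^sub>1\<^sup>2\<close> (\<open>C1_in_squared_speed\<close>) and the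
  square root in the formula for \<open>f\<close> does no harm.\<close>

section \<open>Calculus of continuously differentiable functions\<close>

lemma C1_onI:
  "(\<And>z. z \<in> S \<Longrightarrow> (f has_derivative blinfun_apply (f' z)) (at z within S)) \<Longrightarrow> continuous_on S f' \<Longrightarrow> C1_on S f"
  unfolding C1_on_def by (rule exI[of _ f']) simp

lemma C1_onE:
  assumes "C1_on S f"
  obtains f' where "\<And>z. z \<in> S \<Longrightarrow> (f has_derivative blinfun_apply (f' z)) (at z within S)"
    and "continuous_on S f'"
  using assms unfolding C1_on_def by blast

lemma C1_on_compose:
  assumes f: "C1_on S f" and g: "C1_on T g" and "f ` S \<subseteq> T"
  shows "C1_on S (\<lambda>x. g (f x))"
proof -
  from f obtain f' where f': "\<And>z. z \<in> S \<Longrightarrow> (f has_derivative blinfun_apply (f' z)) (at z within S)"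
    and cf': "continuous_on S f'" unfolding C1_on_def by blast
  from g obtain g' where g': "\<And>z. z \<in> T \<Longrightarrow> (g has_derivative blinfun_apply (g' z)) (at z within T)"
    and cg': "continuous_on T g'" unfolding C1_on_def by blast
  have cf: "continuous_on S f"
    using f' has_derivative_continuous continuous_on_eq_continuous_within by blast
  have "((\<lambda>x. g (f x)) has_derivative blinfun_apply (g' (f z) o\<^sub>L f' z)) (at z within S)" if "z \<in> S" for z
  proof -
    have "(g has_derivative blinfun_apply (g' (f z))) (at (f z) within f ` S)"
      using g' assms(3) that by (meson has_derivative_subset image_eqI subsetD)
    from has_derivative_in_compose[OF f'[OF that] this] show ?thesis
      by (simp add: blinfun_compose.rep_eq o_def)
  qed
  moreover have "continuous_on S (\<lambda>z. g' (f z) o\<^sub>L f' z)"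
    using continuous_on_compose2[OF cg' cf] assms(3) cf'
    by (intro bounded_bilinear.continuous_on[OF bounded_bilinear_blinfun_compose]) auto
  ultimately show ?thesis by (rule C1_onI)
qed

lemma C1_on_cong:
  assumes f: "C1_on S f" and eq: "\<And>x. x \<in> S \<Longrightarrow> f x = g x"
  shows "C1_on S g"
proof -
  obtain f' where f': "\<And>z. z \<in> S \<Longrightarrow> (f has_derivative blinfun_apply (f' z)) (at z within S)"
    and cf': "continuous_on S f'" using f unfolding C1_on_def by blast
  have "(g has_derivative blinfun_apply (f' z)) (at z within S)" if "z \<in> S" for z
    by (rule has_derivative_transform[OF that _ f'[OF that]]) (simp add: eq)
  then show ?thesis using cf' by (rule C1_onI)
qed

lemma C1_on_imp_continuous: "C1_on S f \<Longrightarrow> continuous_on S f"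
  by (erule C1_onE) (metis continuous_on_eq_continuous_within has_derivative_continuous)

lemma C1_on_bounded_linear: "bounded_linear f \<Longrightarrow> C1_on S f"
  unfolding C1_on_def
  by (rule exI[of _ "\<lambda>_. Blinfun f"])
     (auto simp: bounded_linear_Blinfun_apply bounded_linear_imp_has_derivative)

lemma C1_on_const: "C1_on S (\<lambda>_. c)"
  by (rule C1_onI[where f' = "\<lambda>_. 0"]) (simp_all add: zero_blinfun.rep_eq)

lemma C1_on_real:
  fixes g :: "real \<Rightarrow> real"
  assumes "\<And>t. t \<in> T \<Longrightarrow> (g has_real_derivative g' t) (at t within T)" and "continuous_on T g'"
  shows "C1_on T g"
  unfolding C1_on_def
proof (intro exI conjI ballI)
  show "(g has_derivative blinfun_apply (blinfun_mult_right (g' z))) (at z within T)" if "z \<in> T" for z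
    using assms(1)[OF that] by (simp add: has_field_derivative_def)
  show "continuous_on T (\<lambda>z. blinfun_mult_right (g' z))"
    by (intro bounded_linear.continuous_on[OF bounded_linear_blinfun_mult_right] assms)
qed

lemma C1_on_mult:
  fixes f g :: "'a::real_normed_vector \<Rightarrow> real"
  assumes f: "C1_on S f" and g: "C1_on S g"
  shows "C1_on S (\<lambda>x. f x * g x)"
proof -
  from f obtain f' where f': "\<And>z. z \<in> S \<Longrightarrow> (f has_derivative blinfun_apply (f' z)) (at z within S)"
    and cf': "continuous_on S f'" unfolding C1_on_def by blast
  from g obtain g' where g': "\<And>z. z \<in> S \<Longrightarrow> (g has_derivative blinfun_apply (g' z)) (at z within S)"
    and cg': "continuous_on S g'" unfolding C1_on_def by blast
  have "((\<lambda>x. f x * g x) has_derivative blinfun_apply (f z *\<^sub>R g' z + g z *\<^sub>R f' z)) (at z within S)"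
    if "z \<in> S" for z
    using has_derivative_mult[OF f'[OF that] g'[OF that]]
    by (rule has_derivative_eq_rhs) (auto simp: blinfun.bilinear_simps algebra_simps)
  moreover have "continuous_on S (\<lambda>z. f z *\<^sub>R g' z + g z *\<^sub>R f' z)"
    by (intro continuous_intros C1_on_imp_continuous f g cf' cg')
  ultimately show ?thesis by (rule C1_onI)
qed

lemma C1_on_add:
  fixes f g :: "'a::real_normed_vector \<Rightarrow> 'b::real_normed_vector"
  assumes f: "C1_on S f" and g: "C1_on S g"
  shows "C1_on S (\<lambda>x. f x + g x)"
proof -
  from f obtain f' where f': "\<And>z. z \<in> S \<Longrightarrow> (f has_derivative blinfun_apply (f' z)) (at z within S)"
    and cf': "continuous_on S f'" unfolding C1_on_def by blast
  from g obtain g' where g': "\<And>z. z \<in> S \<Longrightarrow> (g has_derivative blinfun_apply (g' z)) (at z within S)"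
    and cg': "continuous_on S g'" unfolding C1_on_def by blast
  have "((\<lambda>x. f x + g x) has_derivative blinfun_apply (f' z + g' z)) (at z within S)"
    if "z \<in> S" for z
    using has_derivative_add[OF f'[OF that] g'[OF that]]
    by (rule has_derivative_eq_rhs) (auto simp: blinfun.bilinear_simps algebra_simps)
  moreover have "continuous_on S (\<lambda>z. f' z + g' z)"
    by (intro continuous_intros C1_on_imp_continuous f g cf' cg')
  ultimately show ?thesis by (rule C1_onI)
qed

lemma C1_on_linear_compose:
  assumes "bounded_linear h" and "C1_on S f"
  shows "C1_on S (\<lambda>x. h (f x))"
  by (rule C1_on_compose[OF assms(2) C1_on_bounded_linear[OF assms(1), of UNIV]]) simp

lemma C1_on_diff:
  fixes f g :: "'a::real_normed_vector \<Rightarrow> 'b::real_normed_vector"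
  assumes "C1_on S f" and "C1_on S g"
  shows "C1_on S (\<lambda>x. f x - g x)"
  using C1_on_add[OF assms(1) C1_on_linear_compose[OF bounded_linear_minus[OF bounded_linear_ident] assms(2)]]
  by simp

text \<open>No point of the closed half-line is isolated in it, so the one-sided derivative is unique.\<close>

lemma at_within_half_line_neq_bot: "at (x::real) within {0..} \<noteq> bot" if "0 \<le> x"
proof (cases "x = 0")
  case True then show ?thesis by (simp add: at_within_Ici_at_right)
next
  case False
  then have "at x within {0..} = at x" using that by (intro at_within_interior) (auto simp: interior_real_atLeast)
  then show ?thesis by simp
qed

lemma Dx_eqI: "0 \<le> x \<Longrightarrow> (\<phi> has_real_derivative d) (at x within {0..}) \<Longrightarrow> Dx \<phi> x = d"
  unfolding Dx_def
  by (rule vector_derivative_within[OF at_within_half_line_neq_bot])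
     (auto simp: has_real_derivative_iff_has_vector_derivative)

lemma at_within_half_line: "0 < x \<Longrightarrow> at (x::real) within {0..} = at x"
  by (intro at_within_interior) (auto simp: interior_real_atLeast)

text \<open>The derivative whose existence \<open>C1_on\<close> asserts is the one that \<open>Dx\<close> selects.\<close>

lemma C1_on_half_line:
  assumes "C1_on {0..} \<phi>"
  shows "\<And>x. 0 \<le> x \<Longrightarrow> (\<phi> has_real_derivative Dx \<phi> x) (at x within {0..})"
    and "continuous_on {0..} (Dx \<phi>)"
proof -
  from assms obtain f' where f': "\<And>z. z \<ge> 0 \<Longrightarrow> (\<phi> has_derivative blinfun_apply (f' z)) (at z within {0..})"
    and cf': "continuous_on {0..} f'" unfolding C1_on_def by auto
  have 1: "(\<phi> has_real_derivative blinfun_apply (f' x) 1) (at x within {0..})" if "0 \<le> x" for x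
  proof -
    have "blinfun_apply (f' x) = (*) (blinfun_apply (f' x) 1)"
    proof
      fix t
      have "blinfun_apply (f' x) (t *\<^sub>R 1) = t *\<^sub>R blinfun_apply (f' x) 1" by (rule blinfun.scaleR_right)
      then show "blinfun_apply (f' x) t = blinfun_apply (f' x) 1 * t" by simp
    qed
    then show ?thesis using f'[OF that] by (simp add: has_field_derivative_def)
  qed
  then have 2: "Dx \<phi> x = blinfun_apply (f' x) 1" if "0 \<le> x" for x
    using Dx_eqI that by blast
  show "(\<phi> has_real_derivative Dx \<phi> x) (at x within {0..})" if "0 \<le> x" for x
    using 1 2 that by simp
  have "continuous_on {0..} (\<lambda>x. blinfun_apply (f' x) 1)" by (intro continuous_intros cf')
  then show "continuous_on {0..} (Dx \<phi>)"
    by (rule continuous_on_eq) (use 2 in auto)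
qed

lemma C2_on_open_half_line:
  assumes "C2_on {0<..} \<phi>" and "0 < x"
  shows "(Dx \<phi> has_real_derivative Dx (Dx \<phi>) x) (at x)"
proof -
  from assms(1) obtain f' where f': "\<And>z. z > 0 \<Longrightarrow> (\<phi> has_derivative blinfun_apply (f' z)) (at z within {0<..})"
    and cf': "C1_on {0<..} f'" unfolding C2_on_def by auto
  have 2: "Dx \<phi> y = blinfun_apply (f' y) 1" if "0 < y" for y
  proof -
    have "blinfun_apply (f' y) = (*) (blinfun_apply (f' y) 1)"
    proof
      fix t
      have "blinfun_apply (f' y) (t *\<^sub>R 1) = t *\<^sub>R blinfun_apply (f' y) 1" by (rule blinfun.scaleR_right)
      then show "blinfun_apply (f' y) t = blinfun_apply (f' y) 1 * t" by simp
    qed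
    then have "(\<phi> has_real_derivative blinfun_apply (f' y) 1) (at y)"
      using f'[OF that] that by (simp add: has_field_derivative_def at_within_open[of y "{0<..}"])
    then show ?thesis using Dx_eqI[of y] that at_within_half_line[OF that] by simp
  qed
  obtain f'' where f'': "\<And>z. z > 0 \<Longrightarrow> (f' has_derivative blinfun_apply (f'' z)) (at z within {0<..})"
    using cf' unfolding C1_on_def by auto
  have "(f' has_derivative blinfun_apply (f'' x)) (at x)"
    using f''[OF assms(2)] assms(2) by (simp add: at_within_open[of x "{0<..}"])
  then have "((\<lambda>y. blinfun_apply (f' y) 1) has_derivative (\<lambda>t. blinfun_apply (blinfun_apply (f'' x) t) 1)) (at x)"
    by (rule bounded_linear.has_derivative[OF blinfun.bounded_linear_left])
  then have "(\<lambda>y. blinfun_apply (f' y) 1) differentiable (at x)"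
    unfolding differentiable_def by blast
  then obtain d where d: "((\<lambda>y. blinfun_apply (f' y) 1) has_real_derivative d) (at x)"
    using real_differentiable_def by auto
  have "(Dx \<phi> has_real_derivative d) (at x)"
    by (rule has_field_derivative_transform_within_open[OF d, of "{0<..}"]) (use assms 2 in auto)
  moreover have "Dx (Dx \<phi>) x = d"
    using Dx_eqI[of x] assms(2) at_within_half_line[OF assms(2)] calculation by simp
  ultimately show ?thesis by simp
qed

text \<open>A real function with a continuous second derivative is \<open>C\<^sup>2\<close>.\<close>

lemma C2_on_real:
  fixes g :: "real \<Rightarrow> real"
  assumes "\<And>t. t \<in> T \<Longrightarrow> (g has_real_derivative g' t) (at t within T)"
    and "\<And>t. t \<in> T \<Longrightarrow> (g' has_real_derivative g'' t) (at t within T)" and "continuous_on T g''"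
  shows "C2_on T g"
  unfolding C2_on_def
proof (intro exI conjI ballI)
  show "(g has_derivative blinfun_apply (blinfun_mult_right (g' z))) (at z within T)" if "z \<in> T" for z
    using assms(1)[OF that] by (simp add: has_field_derivative_def)
  show "C1_on T (\<lambda>z. blinfun_mult_right (g' z))"
    by (rule C1_on_linear_compose[OF bounded_linear_blinfun_mult_right C1_on_real[OF assms(2,3)]])
qed

lemma MVT_open:
  fixes f :: "real \<Rightarrow> real"
  assumes "a < b" and "continuous_on {a..b} f"
    and d: "\<And>x. a < x \<Longrightarrow> x < b \<Longrightarrow> (f has_real_derivative f' x) (at x)"
  shows "\<exists>z>a. z < b \<and> f b - f a = (b - a) * f' z"
proof -
  obtain l z where "a < z" "z < b" "(f has_real_derivative l) (at z)" "f b - f a = (b - a) * l"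
    using MVT[OF assms(1,2)] d real_differentiable_def by blast
  then show ?thesis using DERIV_unique[OF d] by blast
qed

lemma measurable_fst_borel [measurable]: "fst \<in> borel_measurable borel"
  and measurable_snd_borel [measurable]: "snd \<in> borel_measurable borel"
  by (rule borel_measurable_continuous_onI, intro continuous_intros)+

section \<open>A differentiable step and the du Bois-Reymond argument\<close>

text \<open>Of this step only the following matters: it is \<open>C\<^sup>1\<close>, nondecreasing and at most \<open>1\<close>, it is positive
  exactly for \<open>t > 0\<close>, and replacing \<open>t\<close> by \<open>n t\<close> turns it into the indicator of \<open>t > 0\<close> as \<open>n \<rightarrow> \<infinity>\<close>.\<close>

definition soft_step :: "real \<Rightarrow> real" where
  "soft_step t = (max 0 t)\<^sup>2 / (1 + t\<^sup>2)"

definition soft_step' :: "real \<Rightarrow> real" where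
  "soft_step' t = 2 * max 0 t / (1 + t\<^sup>2)\<^sup>2"

lemma soft_step_nonneg: "0 \<le> soft_step t"
  and soft_step_le_1: "soft_step t \<le> 1"
  and soft_step_pos: "0 < t \<Longrightarrow> 0 < soft_step t"
  and soft_step_zero: "t \<le> 0 \<Longrightarrow> soft_step t = 0"
proof -
  have p: "0 < 1 + t\<^sup>2" by (simp add: add_pos_nonneg)
  then show "0 \<le> soft_step t" by (simp add: soft_step_def)
  have "(max 0 t)\<^sup>2 \<le> 1 + t\<^sup>2" by (auto simp: max_def)
  then show "soft_step t \<le> 1" using p by (simp add: soft_step_def)
  show "0 < soft_step t" if "0 < t" using p that by (auto simp: soft_step_def max_def)
  show "soft_step t = 0" if "t \<le> 0" using that by (simp add: soft_step_def)
qed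

lemma soft_step'_nonneg: "0 \<le> soft_step' t"
  and soft_step'_pos: "0 < t \<Longrightarrow> 0 < soft_step' t"
  and soft_step'_zero: "t \<le> 0 \<Longrightarrow> soft_step' t = 0"
proof -
  have p: "0 < 1 + t\<^sup>2" by (simp add: add_pos_nonneg)
  show "0 \<le> soft_step' t" by (simp add: soft_step'_def)
  show "0 < soft_step' t" if "0 < t" using p that by (auto simp: soft_step'_def max_def)
  show "soft_step' t = 0" if "t \<le> 0" using that by (simp add: soft_step'_def)
qed

lemma has_derivative_max_sq: "((\<lambda>t::real. (max 0 t)\<^sup>2) has_real_derivative 2 * max 0 t) (at t)"
proof -
  consider "t < 0" | "t > 0" | "t = 0" by linarith
  then show ?thesis
  proof cases
    case 1
    have "((\<lambda>t::real. 0) has_real_derivative 0) (at t)" by simp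
    then have "((\<lambda>t::real. (max 0 t)\<^sup>2) has_real_derivative 0) (at t)"
      by (rule has_field_derivative_transform_within_open[of _ _ _ "{..<0}"]) (use 1 in auto)
    then show ?thesis using 1 by simp
  next
    case 2
    have "((\<lambda>t::real. t\<^sup>2) has_real_derivative 2 * t) (at t)" by (auto intro!: derivative_eq_intros)
    then have "((\<lambda>t::real. (max 0 t)\<^sup>2) has_real_derivative 2 * t) (at t)"
      by (rule has_field_derivative_transform_within_open[of _ _ _ "{0<..}"]) (use 2 in auto)
    then show ?thesis using 2 by simp
  next
    case 3
    have "(\<lambda>h::real. max 0 h) \<midarrow>0\<rightarrow> max 0 0" by (intro tendsto_intros)
    then have "(\<lambda>h::real. max 0 h) \<midarrow>0\<rightarrow> 0" by simp
    then have "(\<lambda>h::real. (max 0 h)\<^sup>2 / h) \<midarrow>0\<rightarrow> 0"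
      by (rule Lim_transform_eventually) (auto simp: eventually_at_filter max_def power2_eq_square)
    then show ?thesis using 3 by (simp add: DERIV_def)
  qed
qed

lemma soft_step_DERIV: "(soft_step has_real_derivative soft_step' t) (at t)"
proof -
  have p: "1 + t\<^sup>2 \<noteq> 0" by (metis add_pos_nonneg less_numeral_extra(1,3) zero_le_power2)
  have "((\<lambda>t. (max 0 t)\<^sup>2 / (1 + t\<^sup>2)) has_real_derivative
     (2 * max 0 t * (1 + t\<^sup>2) - (max 0 t)\<^sup>2 * (2 * t)) / ((1 + t\<^sup>2) * (1 + t\<^sup>2))) (at t)"
    by (rule DERIV_divide[OF has_derivative_max_sq]) (use p in \<open>auto intro!: derivative_eq_intros\<close>)
  moreover have "(2 * max 0 t * (1 + t\<^sup>2) - (max 0 t)\<^sup>2 * (2 * t)) = 2 * max 0 t"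
    by (auto simp: max_def power2_eq_square algebra_simps)
  ultimately show ?thesis unfolding soft_step_def[abs_def] soft_step'_def by (simp add: power2_eq_square)
qed

lemma continuous_on_soft_step': "continuous_on S soft_step'"
proof -
  have "(1 + t\<^sup>2)\<^sup>2 \<noteq> (0::real)" for t
    by (metis add_pos_nonneg less_numeral_extra(1,3) zero_le_power2 zero_less_power)
  then show ?thesis unfolding soft_step'_def[abs_def] by (intro continuous_intros ballI) auto
qed

lemma continuous_on_soft_step: "continuous_on S soft_step"
  by (meson DERIV_isCont continuous_at_imp_continuous_on soft_step_DERIV)

lemma soft_step_tendsto: "(\<lambda>n. soft_step (real n * t)) \<longlonglongrightarrow> indicat_real {0<..} t"
proof (cases "t > 0")
  case True
  have "LIM n sequentially. t * real n :> at_top"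
    by (rule filterlim_tendsto_pos_mult_at_top[OF tendsto_const True filterlim_real_sequentially])
  then have "LIM n sequentially. (real n * t)\<^sup>2 :> at_top"
    by (intro filterlim_pow_at_top) (auto simp: mult.commute)
  then have "LIM n sequentially. 1 + (real n * t)\<^sup>2 :> at_top"
    by (rule filterlim_tendsto_add_at_top[OF tendsto_const])
  then have "(\<lambda>n. 1 - 1 / (1 + (real n * t)\<^sup>2)) \<longlonglongrightarrow> 1 - 0"
    by (intro tendsto_diff tendsto_const tendsto_divide_0[OF tendsto_const] filterlim_at_top_imp_at_infinity)
  then have "(\<lambda>n. 1 - 1 / (1 + (real n * t)\<^sup>2)) \<longlonglongrightarrow> 1" by simp
  moreover have "1 - 1 / (1 + (real n * t)\<^sup>2) = soft_step (real n * t)" for n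
  proof -
    have "1 + (real n * t)\<^sup>2 \<noteq> 0" by (metis add_pos_nonneg less_numeral_extra(1,3) zero_le_power2)
    then show ?thesis using True by (simp add: soft_step_def field_simps max_def)
  qed
  ultimately show ?thesis using True by simp
next
  case False
  then have "soft_step (real n * t) = 0" for n
    by (intro soft_step_zero) (simp add: mult_nonneg_nonpos)
  then show ?thesis using False by simp
qed

text \<open>The test function \<open>\<rho> = (x - a) (b - x) (G - c)\<close>, with the weighted mean \<open>c\<close> of \<open>G\<close> that makes its integral
  vanish, gives \<open>\<integral> (x - a) (b - x) (G - c)\<^sup>2 = 0\<close>.\<close>

lemma du_Bois_Reymond:
  fixes G :: "real \<Rightarrow> real"
  assumes "a < b" and G: "continuous_on {a..b} G"
    and orth: "\<And>\<rho>. continuous_on UNIV \<rho> \<Longrightarrow> (\<And>x. x \<notin> {a<..<b} \<Longrightarrow> \<rho> x = 0) \<Longrightarrow> integral {a..b} \<rho> = 0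
      \<Longrightarrow> integral {a..b} (\<lambda>x. \<rho> x * G x) = 0"
  shows "\<exists>c. \<forall>x\<in>{a..b}. G x = c"
proof -
  define k where "k x = max 0 ((x - a) * (b - x))" for x
  \<comment> \<open>Clamping the argument extends \<open>G\<close> continuously beyond \<open>[a, b]\<close>.\<close>
  define cl where "cl x = max a (min b x)" for x
  have ck: "continuous_on UNIV k" unfolding k_def by (intro continuous_intros)
  have ccl: "continuous_on UNIV cl" unfolding cl_def by (intro continuous_intros)
  have clin: "cl x \<in> {a..b}" for x using assms(1) by (auto simp: cl_def)
  have clid: "cl x = x" if "x \<in> {a..b}" for x using that by (auto simp: cl_def)
  have cG: "continuous_on UNIV (\<lambda>x. G (cl x))"
    by (rule continuous_on_compose2[OF G ccl]) (use clin in auto)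
  have kpos: "k x > 0" if "a < x" "x < b" for x using that by (simp add: k_def)
  have k0: "k x = 0" if "x \<notin> {a<..<b}" for x
  proof -
    have "(x - a) * (b - x) \<le> 0" using that assms(1) by (auto simp: mult_le_0_iff)
    then show ?thesis by (simp add: k_def)
  qed
  have kint: "integral {a..b} k > 0"
  proof -
    have "integral {a..b} k \<noteq> 0"
    proof
      assume "integral {a..b} k = 0"
      then have "\<forall>x\<in>{a..b}. k x = 0"
        by (subst (asm) integral_eq_0_iff[OF continuous_on_subset[OF ck] assms(1)]) (auto simp: k_def)
      moreover have "(a + b) / 2 \<in> {a..b}" using assms(1) by simp
      moreover have "k ((a + b) / 2) > 0" using assms(1) by (intro kpos) auto
      ultimately show False by force
    qed
    moreover have "integral {a..b} k \<ge> 0"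
      by (rule integral_nonneg) (auto simp: k_def intro!: integrable_continuous_real continuous_intros)
    ultimately show ?thesis by simp
  qed
  define c where "c = integral {a..b} (\<lambda>x. k x * G (cl x)) / integral {a..b} k"
  define \<rho> where "\<rho> x = k x * (G (cl x) - c)" for x
  have c\<rho>: "continuous_on UNIV \<rho>" unfolding \<rho>_def by (intro continuous_intros ck cG)
  have ints: "(\<lambda>x. k x * G (cl x)) integrable_on {a..b}" "(\<lambda>x. k x * c) integrable_on {a..b}"
    "(\<lambda>x. \<rho> x * G x) integrable_on {a..b}" "(\<lambda>x. \<rho> x * c) integrable_on {a..b}"
    by (intro integrable_continuous_real continuous_intros continuous_on_subset[OF ck] continuous_on_subset[OF cG]
        continuous_on_subset[OF c\<rho>] G; simp)+
  have z: "integral {a..b} \<rho> = 0"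
    using kint ints unfolding \<rho>_def by (simp add: right_diff_distrib integral_diff c_def)
  have "integral {a..b} (\<lambda>x. \<rho> x * G x) = 0"
    by (rule orth[OF c\<rho> _ z]) (simp add: \<rho>_def k0)
  then have "integral {a..b} (\<lambda>x. \<rho> x * G x - \<rho> x * c) = 0"
    using ints z by (simp add: integral_diff)
  then have "integral {a..b} (\<lambda>x. k x * (G (cl x) - c)\<^sup>2) = 0"
    by (rule trans[rotated]) (auto intro!: integral_cong simp: \<rho>_def clid power2_eq_square algebra_simps)
  then have zz: "\<forall>x\<in>{a..b}. k x * (G (cl x) - c)\<^sup>2 = 0"
    by (subst (asm) integral_eq_0_iff[OF _ assms(1)])
       (auto intro!: continuous_intros continuous_on_subset[OF ck] continuous_on_subset[OF cG] simp: k_def)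
  have in1: "G x = c" if "x \<in> {a<..<b}" for x
    using zz[rule_format, of x] kpos[of x] clid[of x] that by auto
  have "G x = c" if "x \<in> closure {a<..<b}" for x
    by (rule continuous_constant_on_closure[OF _ in1 that]) (use G assms(1) in auto)
  then show ?thesis using assms(1) by (auto simp: closure_greaterThanLessThan)
qed

section \<open>Bounded weights and convergence in mean\<close>

lemma abs_mult_le_if: "\<bar>w\<bar> \<le> C \<Longrightarrow> \<bar>a * w\<bar> \<le> \<bar>C * a\<bar>" for a w C :: real
  using mult_left_mono[of "\<bar>w\<bar>" "\<bar>C\<bar>" "\<bar>a\<bar>"] by (simp add: abs_mult mult.commute)

text \<open>In \<open>f\<^sub>n W\<^sub>n - g V = (f\<^sub>n - g) W\<^sub>n + g (W\<^sub>n - V)\<close> the first term is at most \<open>C \<bar>f\<^sub>n - g\<bar>\<close> and the second is dominated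
  by \<open>2 C \<bar>g\<bar>\<close>.\<close>

lemma tendsto_integral_mult_weight:
  fixes f :: "nat \<Rightarrow> 'a \<Rightarrow> real" and W :: "nat \<Rightarrow> 'a \<Rightarrow> real"
  assumes f: "\<And>n. integrable M (f n)" and g: "integrable M g"
    and fg: "(\<lambda>n. LINT \<xi>|M. \<bar>f n \<xi> - g \<xi>\<bar>) \<longlonglongrightarrow> 0"
    and W: "\<And>n. W n \<in> borel_measurable M" and V: "V \<in> borel_measurable M"
    and WV: "AE \<xi> in M. (\<lambda>n. W n \<xi>) \<longlonglongrightarrow> V \<xi>"
    and bd: "\<And>n. AE \<xi> in M. \<bar>W n \<xi>\<bar> \<le> C"
  shows "(\<lambda>n. LINT \<xi>|M. f n \<xi> * W n \<xi>) \<longlonglongrightarrow> (LINT \<xi>|M. g \<xi> * V \<xi>)"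
proof -
  note [measurable] = W V borel_measurable_integrable[OF f] borel_measurable_integrable[OF g]
  have i1: "integrable M (\<lambda>\<xi>. g \<xi> * W n \<xi>)" for n
  proof (rule Bochner_Integration.integrable_bound[of _ "\<lambda>\<xi>. C * g \<xi>"])
    show "AE \<xi> in M. norm (g \<xi> * W n \<xi>) \<le> norm (C * g \<xi>)"
      using bd[of n] by eventually_elim (simp add: abs_mult_le_if del: abs_mult)
  qed (use g in auto)
  have i2: "integrable M (\<lambda>\<xi>. f m \<xi> * W n \<xi>)" for n m
  proof (rule Bochner_Integration.integrable_bound[of _ "\<lambda>\<xi>. C * f m \<xi>"])
    show "AE \<xi> in M. norm (f m \<xi> * W n \<xi>) \<le> norm (C * f m \<xi>)"
      using bd[of n] by eventually_elim (simp add: abs_mult_le_if del: abs_mult)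
  qed (use f in auto)
  have A: "(\<lambda>n. LINT \<xi>|M. g \<xi> * W n \<xi>) \<longlonglongrightarrow> (LINT \<xi>|M. g \<xi> * V \<xi>)"
  proof (rule integral_dominated_convergence[where w = "\<lambda>\<xi>. \<bar>C * g \<xi>\<bar>"])
    show "AE \<xi> in M. (\<lambda>n. g \<xi> * W n \<xi>) \<longlonglongrightarrow> g \<xi> * V \<xi>"
      using WV by eventually_elim (intro tendsto_intros)
    show "AE \<xi> in M. norm (g \<xi> * W n \<xi>) \<le> \<bar>C * g \<xi>\<bar>" for n
      using bd[of n] by eventually_elim (simp add: abs_mult_le_if del: abs_mult)
  qed (use g in auto)
  have B: "(\<lambda>n. LINT \<xi>|M. (f n \<xi> - g \<xi>) * W n \<xi>) \<longlonglongrightarrow> 0"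
  proof (rule Lim_null_comparison)
    show "\<forall>\<^sub>F n in sequentially. norm (LINT \<xi>|M. (f n \<xi> - g \<xi>) * W n \<xi>) \<le> C * (LINT \<xi>|M. \<bar>f n \<xi> - g \<xi>\<bar>)"
    proof (intro always_eventually allI)
      fix n
      have "norm (LINT \<xi>|M. (f n \<xi> - g \<xi>) * W n \<xi>) \<le> (LINT \<xi>|M. norm ((f n \<xi> - g \<xi>) * W n \<xi>))"
        by (rule integral_norm_bound)
      also have "\<dots> \<le> (LINT \<xi>|M. C * \<bar>f n \<xi> - g \<xi>\<bar>)"
      proof (rule integral_mono_AE)
        show "integrable M (\<lambda>\<xi>. norm ((f n \<xi> - g \<xi>) * W n \<xi>))"
          using Bochner_Integration.integrable_diff[OF i2[of n n] i1[of n]]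
          by (simp only: left_diff_distrib[symmetric] integrable_norm)
        show "AE \<xi> in M. norm ((f n \<xi> - g \<xi>) * W n \<xi>) \<le> C * \<bar>f n \<xi> - g \<xi>\<bar>"
          using bd[of n] by eventually_elim (simp add: abs_mult mult.commute[of C] mult_left_mono)
      qed (use f g in auto)
      finally show "norm (LINT \<xi>|M. (f n \<xi> - g \<xi>) * W n \<xi>) \<le> C * (LINT \<xi>|M. \<bar>f n \<xi> - g \<xi>\<bar>)" by simp
    qed
    show "(\<lambda>n. C * (LINT \<xi>|M. \<bar>f n \<xi> - g \<xi>\<bar>)) \<longlonglongrightarrow> 0"
      using tendsto_mult_left[OF fg, of C] by simp
  qed
  have "(LINT \<xi>|M. f n \<xi> * W n \<xi>) = (LINT \<xi>|M. (f n \<xi> - g \<xi>) * W n \<xi>) + (LINT \<xi>|M. g \<xi> * W n \<xi>)" for n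
    using i1[of n] i2[of n n] by (simp add: left_diff_distrib)
  then show ?thesis using tendsto_add[OF B A] by simp
qed

section \<open>The ion density and the Sagdeev potential\<close>

text \<open>For an ion with velocity \<open>\<eta> < 0\<close> at infinity, the ratio of its speed there to its speed at potential
  \<open>a\<close>; it is the weight in \<open>rho_i\<close> and the Jacobian of \<open>\<eta> \<mapsto> - sqrt (\<eta>\<^sup>2 + 2 a)\<close>.\<close>

definition speed_ratio :: "real \<Rightarrow> real \<Rightarrow> real" where
  "speed_ratio a \<eta> = - \<eta> / sqrt (\<eta>\<^sup>2 + 2 * a)"

lemma measurable_speed_ratio [measurable]: "speed_ratio a \<in> borel_measurable borel"
  unfolding speed_ratio_def[abs_def] by measurable

lemma speed_ratio_bound: "0 \<le> s \<Longrightarrow> \<bar>speed_ratio s \<eta>\<bar> \<le> 1"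
proof -
  assume "0 \<le> s"
  then have "\<bar>\<eta>\<bar> \<le> sqrt (\<eta>\<^sup>2 + 2 * s)" by (simp add: real_le_rsqrt)
  then show ?thesis by (auto simp: abs_divide divide_le_eq_1 speed_ratio_def)
qed

text \<open>The representative \<open>F\<close> of the density at infinity satisfies the sign and support conditions at every
  point. The support condition includes the null set \<open>\<xi>\<^sub>1 = 0\<close>, so that all ions have \<open>\<xi>\<^sub>1 < 0\<close>.\<close>

locale far_field =
  fixes n\<^sub>e :: "real \<Rightarrow> real" and F :: "vel \<Rightarrow> real"
  assumes n\<^sub>e_C2: "C2_on UNIV n\<^sub>e" and n\<^sub>e_0: "n\<^sub>e 0 = 1" and deriv_n\<^sub>e_0: "deriv n\<^sub>e 0 = -1"
    and F_borel [measurable]: "F \<in> borel_measurable borel"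
    and F_nonneg: "0 \<le> F \<xi>"
    and F_zero: "0 \<le> fst \<xi> \<Longrightarrow> F \<xi> = 0"
    and F_integrable: "integrable lborel F"
    and F_integral: "(LINT \<xi>|lborel. F \<xi>) = 1"
begin

abbreviation "net_density s \<equiv> rho_i F s - n\<^sub>e s"

abbreviation "V \<equiv> Vpot n\<^sub>e F"

lemma rho_i_lborel: "rho_i F s = (LINT \<xi>|lborel. F \<xi> * speed_ratio s (fst \<xi>))"
  unfolding rho_i_def speed_ratio_def[symmetric] by (rule integral_completion) measurable

lemma integrable_F_mult:
  assumes "W \<in> borel_measurable borel" and "\<And>\<xi>. \<bar>W \<xi>\<bar> \<le> C"
  shows "integrable lborel (\<lambda>\<xi>. F \<xi> * W \<xi>)"
proof (rule Bochner_Integration.integrable_bound[of _ "\<lambda>\<xi>. C * F \<xi>"])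
  show "AE \<xi> in lborel. norm (F \<xi> * W \<xi>) \<le> norm (C * F \<xi>)"
    unfolding real_norm_def by (intro AE_I2 abs_mult_le_if assms(2))
qed (use assms F_integrable in auto)

lemma integrable_rho: "0 \<le> s \<Longrightarrow> integrable lborel (\<lambda>\<xi>. F \<xi> * speed_ratio s (fst \<xi>))"
  by (rule integrable_F_mult[where C = 1]) (use speed_ratio_bound in auto)

lemma continuous_on_rho_i: "continuous_on {0..} (rho_i F)"
  unfolding continuous_on_sequentially
proof (intro allI ballI impI, elim conjE)
  fix x :: "nat \<Rightarrow> real" and a assume x: "\<forall>n. x n \<in> {0..}" and a: "a \<in> {0..}" and lim: "x \<longlonglongrightarrow> a"
  have "(\<lambda>n. LINT \<xi>|lborel. F \<xi> * speed_ratio (x n) (fst \<xi>))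
     \<longlonglongrightarrow> (LINT \<xi>|lborel. F \<xi> * speed_ratio a (fst \<xi>))"
  proof (rule integral_dominated_convergence[where w = F])
    show "AE \<xi> in lborel. (\<lambda>n. F \<xi> * speed_ratio (x n) (fst \<xi>))
        \<longlonglongrightarrow> F \<xi> * speed_ratio a (fst \<xi>)"
    proof (rule AE_I2)
      fix \<xi> :: vel
      show "(\<lambda>n. F \<xi> * speed_ratio (x n) (fst \<xi>))
        \<longlonglongrightarrow> F \<xi> * speed_ratio a (fst \<xi>)"
      proof (cases "0 \<le> fst \<xi>")
        case False
        then have "0 < (fst \<xi>)\<^sup>2 + 2 * a" using a by (auto intro!: add_pos_nonneg)
        then show ?thesis unfolding speed_ratio_def by (intro tendsto_intros lim) auto
      qed (simp add: F_zero)
    qed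
    show "AE \<xi> in lborel. norm (F \<xi> * speed_ratio (x n) (fst \<xi>)) \<le> F \<xi>" for n
    proof (rule AE_I2)
      fix \<xi> :: vel
      have "F \<xi> * \<bar>speed_ratio (x n) (fst \<xi>)\<bar> \<le> F \<xi> * 1"
        by (intro mult_left_mono speed_ratio_bound F_nonneg) (use x in auto)
      then show "norm (F \<xi> * speed_ratio (x n) (fst \<xi>)) \<le> F \<xi>"
        using F_nonneg[of \<xi>] by (simp add: abs_mult)
    qed
  qed (use F_integrable in auto)
  then show "(rho_i F \<circ> x) \<longlonglongrightarrow> rho_i F a" by (simp add: rho_i_lborel o_def)
qed

lemma one_minus_rho_i:
  assumes "0 \<le> s"
  shows "1 - rho_i F s = (LINT \<xi>|lborel. F \<xi> * (1 - speed_ratio s (fst \<xi>)))"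
  using Bochner_Integration.integral_diff[OF F_integrable integrable_rho[OF assms]] F_integral
  by (simp add: right_diff_distrib rho_i_lborel)

lemma rho_i_le_1: "0 \<le> s \<Longrightarrow> rho_i F s \<le> 1"
proof -
  assume s: "0 \<le> s"
  have "0 \<le> (LINT \<xi>|lborel. F \<xi> * (1 - speed_ratio s (fst \<xi>)))"
  proof (intro Bochner_Integration.integral_nonneg mult_nonneg_nonneg F_nonneg)
    show "0 \<le> 1 - speed_ratio s (fst \<xi>)" for \<xi> :: vel using speed_ratio_bound[OF s, of "fst \<xi>"] by simp
  qed
  then show ?thesis using one_minus_rho_i[OF s] by simp
qed

text \<open>The defect \<open>1 - \<rho>\<^sub>i\<close> is written without cancellation, so that its size relative to \<open>s\<close> can be read off.\<close>

lemma speed_ratio_defect: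
  assumes "\<eta> < 0" and "0 \<le> s"
  shows "1 - speed_ratio s \<eta> = s * (2 / (sqrt (\<eta>\<^sup>2 + 2 * s) * (sqrt (\<eta>\<^sup>2 + 2 * s) - \<eta>)))"
proof -
  define r where "r = sqrt (\<eta>\<^sup>2 + 2 * s)"
  have r: "r > 0" "r\<^sup>2 = \<eta>\<^sup>2 + 2 * s" using assms by (auto simp: r_def add_pos_nonneg)
  then have "r - \<eta> \<noteq> 0" using assms by simp
  moreover have "2 * s = (r + \<eta>) * (r - \<eta>)" using r(2) by (simp add: power2_eq_square algebra_simps)
  ultimately have "1 - (- \<eta> / r) = s * (2 / (r * (r - \<eta>)))" using r by (simp add: divide_simps)
  then show ?thesis by (simp add: r_def speed_ratio_def)
qed

lemma speed_ratio_defect_le: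
  assumes "\<eta> < 0" and "0 \<le> s"
  shows "2 / (sqrt (\<eta>\<^sup>2 + 2 * s) * (sqrt (\<eta>\<^sup>2 + 2 * s) - \<eta>)) \<le> 1 / \<eta>\<^sup>2"
proof -
  have r: "- \<eta> \<le> sqrt (\<eta>\<^sup>2 + 2 * s)" using assms by (simp add: real_le_rsqrt)
  have "(- \<eta>) * (2 * - \<eta>) \<le> sqrt (\<eta>\<^sup>2 + 2 * s) * (sqrt (\<eta>\<^sup>2 + 2 * s) - \<eta>)"
    using r assms by (intro mult_mono) auto
  then have "2 / (sqrt (\<eta>\<^sup>2 + 2 * s) * (sqrt (\<eta>\<^sup>2 + 2 * s) - \<eta>)) \<le> 2 / ((- \<eta>) * (2 * - \<eta>))"
  proof (rule divide_left_mono)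
    have "0 < \<eta>\<^sup>2 + 2 * s" using assms by (simp add: add_pos_nonneg)
    then have "0 < sqrt (\<eta>\<^sup>2 + 2 * s)" by (rule real_sqrt_gt_zero)
    moreover from this have "0 < sqrt (\<eta>\<^sup>2 + 2 * s) - \<eta>" using assms by linarith
    ultimately show "0 < sqrt (\<eta>\<^sup>2 + 2 * s) * (sqrt (\<eta>\<^sup>2 + 2 * s) - \<eta>) * (- \<eta> * (2 * - \<eta>))"
      using assms by (intro mult_pos_pos) auto
  qed auto
  then show ?thesis by (simp add: power2_eq_square)
qed

lemma Bohm_integral_lborel: "Bohm_integral F = (\<integral>\<^sup>+ \<xi>. ennreal (F \<xi> / (fst \<xi>)\<^sup>2) \<partial>lborel)"
  unfolding Bohm_integral_def by (rule nn_integral_completion)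

lemma rho_i_Bohm_finite:
  assumes "Bohm_integral F = ennreal \<beta>" and "0 \<le> \<beta>" and s: "0 \<le> s"
  shows "1 - rho_i F s \<le> \<beta> * s"
proof -
  have i: "integrable lborel (\<lambda>\<xi>. F \<xi> / (fst \<xi>)\<^sup>2)"
    using assms(1) F_nonneg by (intro integrableI_nonneg) (auto simp: Bohm_integral_lborel)
  have "ennreal (LINT \<xi>|lborel. F \<xi> / (fst \<xi>)\<^sup>2) = ennreal \<beta>"
    using nn_integral_eq_integral[OF i] assms(1) F_nonneg by (simp add: Bohm_integral_lborel)
  then have v: "(LINT \<xi>|lborel. F \<xi> / (fst \<xi>)\<^sup>2) = \<beta>"
    using assms(2) F_nonneg by (simp add: integral_nonneg)
  have "1 - rho_i F s \<le> (LINT \<xi>|lborel. s * (F \<xi> / (fst \<xi>)\<^sup>2))"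
    unfolding one_minus_rho_i[OF s]
  proof (rule integral_mono)
    show "integrable lborel (\<lambda>\<xi>. F \<xi> * (1 - speed_ratio s (fst \<xi>)))"
      using Bochner_Integration.integrable_diff[OF F_integrable integrable_rho[OF s]]
      by (simp add: right_diff_distrib)
    show "integrable lborel (\<lambda>\<xi>. s * (F \<xi> / (fst \<xi>)\<^sup>2))" using i by (rule integrable_mult_right)
    fix \<xi> :: vel
    show "F \<xi> * (1 - speed_ratio s (fst \<xi>)) \<le> s * (F \<xi> / (fst \<xi>)\<^sup>2)"
    proof (cases "0 \<le> fst \<xi>")
      case False
      then have "1 - speed_ratio s (fst \<xi>) \<le> s * (1 / (fst \<xi>)\<^sup>2)"
        unfolding speed_ratio_defect[of "fst \<xi>" s, OF _ s, simplified not_le[symmetric], OF False]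
        by (intro mult_left_mono speed_ratio_defect_le s) auto
      then have "F \<xi> * (1 - speed_ratio s (fst \<xi>)) \<le> F \<xi> * (s * (1 / (fst \<xi>)\<^sup>2))"
        by (rule mult_left_mono) (rule F_nonneg)
      then show ?thesis by (simp add: algebra_simps)
    qed (simp add: F_zero)
  qed
  also have "\<dots> = s * (LINT \<xi>|lborel. F \<xi> / (fst \<xi>)\<^sup>2)"
    by (rule Bochner_Integration.integral_mult_right) (use i in simp)
  finally show ?thesis by (simp add: v mult.commute)
qed

text \<open>If \<open>(1 - \<rho>\<^sub>i(s)) / s\<close> stayed below \<open>c\<close> along a sequence \<open>s \<rightarrow> 0\<close>, Fatou's lemma would bound the integral of
  the pointwise limit \<open>F / \<xi>\<^sub>1\<^sup>2\<close> by \<open>c\<close>.\<close>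

lemma rho_i_Bohm_large:
  assumes "Bohm_integral F > ennreal c" and c: "0 \<le> c"
  shows "\<exists>d>0. \<forall>s. 0 < s \<and> s < d \<longrightarrow> c * s \<le> 1 - rho_i F s"
proof (rule ccontr)
  assume "\<not> ?thesis"
  then have "\<exists>s. 0 < s \<and> s < inverse (real (Suc n)) \<and> 1 - rho_i F s < c * s" for n
    by (metis inverse_positive_iff_positive not_le of_nat_0_less_iff zero_less_Suc)
  then obtain s where s: "\<And>n. 0 < s n" "\<And>n. s n < inverse (real (Suc n))" "\<And>n. 1 - rho_i F (s n) < c * s n"
    by metis
  have s0: "s \<longlonglongrightarrow> 0"
    by (rule real_tendsto_sandwich[OF _ _ tendsto_const LIMSEQ_inverse_real_of_nat])
       (use s in \<open>auto intro!: always_eventually less_imp_le\<close>)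
  define D where "D n \<xi> = F \<xi> * (2 / (sqrt ((fst \<xi>)\<^sup>2 + 2 * s n) * (sqrt ((fst \<xi>)\<^sup>2 + 2 * s n) - fst \<xi>)))" for n and \<xi> :: vel
  have [measurable]: "D n \<in> borel_measurable borel" for n unfolding D_def by measurable
  have D0: "0 \<le> D n \<xi>" for n \<xi>
  proof (cases "0 \<le> fst \<xi>")
    case False
    moreover have "0 \<le> (fst \<xi>)\<^sup>2 + 2 * s n" using s(1)[of n] by simp
    then have "0 \<le> sqrt ((fst \<xi>)\<^sup>2 + 2 * s n)" by (rule real_sqrt_ge_zero)
    moreover from this have "0 \<le> sqrt ((fst \<xi>)\<^sup>2 + 2 * s n) - fst \<xi>" using False by linarith
    ultimately show ?thesis unfolding D_def
      by (intro mult_nonneg_nonneg F_nonneg divide_nonneg_nonneg) auto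
  qed (simp add: D_def F_zero)
  have Dlim: "(\<lambda>n. D n \<xi>) \<longlonglongrightarrow> F \<xi> / (fst \<xi>)\<^sup>2" for \<xi>
  proof (cases "0 \<le> fst \<xi>")
    case False
    have *: "(\<lambda>n. sqrt ((fst \<xi>)\<^sup>2 + 2 * s n)) \<longlonglongrightarrow> - fst \<xi>"
      using tendsto_real_sqrt[OF tendsto_add[OF tendsto_const[of "(fst \<xi>)\<^sup>2"] tendsto_mult[OF tendsto_const[of 2] s0]]]
        False by simp
    have "(\<lambda>n. D n \<xi>) \<longlonglongrightarrow> F \<xi> * (2 / (- fst \<xi> * (- fst \<xi> - fst \<xi>)))"
      unfolding D_def by (intro tendsto_intros *) (use False in auto)
    then show ?thesis using False by (simp add: power2_eq_square divide_simps)
  qed (simp add: D_def F_zero)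
  have Dn: "(\<integral>\<^sup>+ \<xi>. ennreal (D n \<xi>) \<partial>lborel) \<le> ennreal c" for n
  proof -
    have eq: "F \<xi> * (1 - speed_ratio (s n) (fst \<xi>)) = s n * D n \<xi>" for \<xi>
    proof (cases "0 \<le> fst \<xi>")
      case False
      then show ?thesis using speed_ratio_defect[of "fst \<xi>" "s n"] s(1)[of n] by (simp add: D_def)
    qed (simp add: D_def F_zero)
    have i: "integrable lborel (\<lambda>\<xi>. s n * D n \<xi>)"
      unfolding eq[symmetric]
      using Bochner_Integration.integrable_diff[OF F_integrable integrable_rho[of "s n"]] s(1)[of n]
      by (simp add: right_diff_distrib)
    then have i': "integrable lborel (D n)" using s(1)[of n] by simp
    have "1 - rho_i F (s n) = s n * (LINT \<xi>|lborel. D n \<xi>)"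
      using one_minus_rho_i[of "s n"] s(1)[of n] by (simp only: eq) simp
    then have "(LINT \<xi>|lborel. D n \<xi>) \<le> c" using s(3)[of n] s(1)[of n]
      by (simp add: mult.commute less_imp_le)
    then show ?thesis using nn_integral_eq_integral[OF i'] D0 by (simp add: ennreal_leI)
  qed
  have "Bohm_integral F = (\<integral>\<^sup>+ \<xi>. liminf (\<lambda>n. ennreal (D n \<xi>)) \<partial>lborel)"
    unfolding Bohm_integral_lborel
    by (intro nn_integral_cong) (metis Dlim lim_imp_Liminf sequentially_bot tendsto_ennrealI)
  also have "\<dots> \<le> liminf (\<lambda>n. \<integral>\<^sup>+ \<xi>. ennreal (D n \<xi>) \<partial>lborel)"
    by (rule nn_integral_liminf) simp
  also have "\<dots> \<le> liminf (\<lambda>n. ennreal c)"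
    by (rule Liminf_mono) (use Dn in auto)
  also have "\<dots> = ennreal c" by (simp add: Liminf_const)
  finally show False using assms(1) by simp
qed

lemma C1_n\<^sub>e: "C1_on UNIV n\<^sub>e"
  using n\<^sub>e_C2 C1_on_imp_continuous unfolding C2_on_def C1_on_def[of UNIV n\<^sub>e] by blast

lemma continuous_on_n\<^sub>e: "continuous_on S n\<^sub>e"
  using C1_on_imp_continuous[OF C1_n\<^sub>e] continuous_on_subset by blast

lemma n\<^sub>e_near_0:
  assumes "0 < \<epsilon>"
  shows "\<exists>d>0. \<forall>s. 0 < s \<and> s < d \<longrightarrow> \<bar>n\<^sub>e s - (1 - s)\<bar> \<le> \<epsilon> * s"
proof -
  have "n\<^sub>e differentiable (at 0)"
    using C1_n\<^sub>e unfolding C1_on_def differentiable_def by auto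
  then have "(n\<^sub>e has_real_derivative -1) (at 0)"
    using deriv_n\<^sub>e_0 by (metis DERIV_deriv_iff_real_differentiable)
  then have "(\<lambda>h. (n\<^sub>e h - 1) / h) \<midarrow>0\<rightarrow> -1" by (simp add: DERIV_def n\<^sub>e_0)
  then obtain d where d: "d > 0" "\<And>h. h \<noteq> 0 \<Longrightarrow> \<bar>h\<bar> < d \<Longrightarrow> \<bar>(n\<^sub>e h - 1) / h + 1\<bar> < \<epsilon>"
    using LIM_D[of "\<lambda>h. (n\<^sub>e h - 1) / h" "-1" 0 \<epsilon>] assms by auto
  have "\<bar>n\<^sub>e s - (1 - s)\<bar> \<le> \<epsilon> * s" if "0 < s" "s < d" for s
  proof -
    have "n\<^sub>e s - (1 - s) = ((n\<^sub>e s - 1) / s + 1) * s" using that by (simp add: field_simps)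
    moreover have "\<bar>((n\<^sub>e s - 1) / s + 1) * s\<bar> \<le> \<epsilon> * s"
      using d(2)[of s] that by (simp add: abs_mult)
    ultimately show ?thesis by simp
  qed
  then show ?thesis using d(1) by blast
qed

lemma n\<^sub>e_Lipschitz_at_0: "\<exists>C>0. \<forall>s\<in>{0..b}. \<bar>n\<^sub>e s - 1\<bar> \<le> C * s"
proof -
  obtain f' where f': "\<And>z. (n\<^sub>e has_derivative blinfun_apply (f' z)) (at z)" and cf: "continuous_on UNIV f'"
    using C1_n\<^sub>e unfolding C1_on_def by auto
  have "bounded (f' ` {0..b})"
    by (intro compact_imp_bounded compact_continuous_image continuous_on_subset[OF cf]) auto
  then obtain C where C: "C > 0" "\<And>z. z \<in> {0..b} \<Longrightarrow> norm (f' z) \<le> C"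
    unfolding bounded_pos by auto
  have "\<bar>n\<^sub>e s - 1\<bar> \<le> C * s" if s: "s \<in> {0..b}" for s
  proof -
    have "norm (n\<^sub>e s - n\<^sub>e 0) \<le> C * norm (s - 0)"
      by (rule differentiable_bound[where S = "{0..b}" and f' = "\<lambda>z. blinfun_apply (f' z)"])
         (use f' C s in \<open>auto intro: has_derivative_at_withinI simp: norm_blinfun.rep_eq[symmetric]\<close>)
    then show ?thesis using s by (simp add: n\<^sub>e_0)
  qed
  then show ?thesis using C(1) by blast
qed

lemma continuous_on_net_density: "continuous_on {0..} (\<lambda>s. net_density s)"
  by (intro continuous_intros continuous_on_rho_i continuous_on_n\<^sub>e)

lemma V_has_derivative:
  assumes "0 \<le> s"
  shows "(V has_real_derivative net_density s) (at s within {0..})"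
proof -
  have "(V has_real_derivative net_density s) (at s within {0..s+1})"
    unfolding Vpot_def[abs_def]
    by (rule integral_has_real_derivative[OF continuous_on_subset[OF continuous_on_net_density]]) (use assms in auto)
  moreover have "at s within {0..s+1} = at s within {0..}"
    by (rule at_within_nhd[where S = "{..<s+1}"]) auto
  ultimately show ?thesis by simp
qed

lemma V_DERIV: "0 < s \<Longrightarrow> (V has_real_derivative net_density s) (at s)"
  using V_has_derivative[of s] at_within_half_line[of s] by simp

lemma V_0: "V 0 = 0"
  by (simp add: Vpot_def)

lemma continuous_on_V: "continuous_on {0..} V"
  by (rule DERIV_continuous_on[OF V_has_derivative]) simp

lemma V_mvt:
  assumes "0 < s"
  shows "\<exists>t. 0 < t \<and> t < s \<and> V s = s * net_density t"
proof -
  have "\<exists>t>0. t < s \<and> V s - V 0 = (s - 0) * net_density t"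
    by (rule MVT_open[OF assms]) (use V_DERIV in \<open>auto intro: continuous_on_subset[OF continuous_on_V]\<close>)
  then show ?thesis by (simp add: V_0)
qed

text \<open>The slope of \<open>V\<close> is \<open>\<rho>\<^sub>i - n\<^sub>e \<le> 1 - n\<^sub>e = O(s)\<close>. This bound is the reason why the potential does not reach
  \<open>0\<close> at a finite distance.\<close>

lemma V_le_quadratic: "\<exists>C>0. \<forall>s\<in>{0..b}. V s \<le> C * s\<^sup>2"
proof -
  obtain C where C: "C > 0" "\<And>s. s \<in> {0..b} \<Longrightarrow> \<bar>n\<^sub>e s - 1\<bar> \<le> C * s" using n\<^sub>e_Lipschitz_at_0 by blast
  have "V s \<le> C * s\<^sup>2" if "s \<in> {0..b}" for s
  proof (cases "s = 0")
    case False
    then have "0 < s" using that by simp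
    then obtain t where t: "0 < t" "t < s" "V s = s * net_density t" using V_mvt by blast
    have "net_density t \<le> C * t" using C(2)[of t] t that rho_i_le_1[of t] by auto
    also have "\<dots> \<le> C * s" using t C by simp
    finally have "V s \<le> s * (C * s)" unfolding t(3) using t by (intro mult_left_mono) auto
    then show ?thesis by (simp add: power2_eq_square algebra_simps)
  qed (simp add: V_0)
  then show ?thesis using C(1) by blast
qed

text \<open>The slope of \<open>V\<close> is at least \<open>(1 - \<beta>) s - o(s)\<close> for the Bohm integral \<open>\<beta>\<close>; half of \<open>1 - \<beta>\<close> absorbs the error.\<close>

lemma V_ge_quadratic_near_0:
  assumes "Bohm_integral F < 1"
  shows "\<exists>c>0. \<exists>d>0. \<forall>s\<in>{0..d}. c * s\<^sup>2 \<le> V s"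
proof -
  obtain \<beta> where \<beta>: "Bohm_integral F = ennreal \<beta>" "0 \<le> \<beta>"
    using assms by (cases "Bohm_integral F") auto
  then have \<beta>1: "\<beta> < 1" using assms by (simp add: ennreal_less_iff flip: ennreal_1)
  define \<kappa> where "\<kappa> = (1 - \<beta>) / 2"
  have \<kappa>: "\<kappa> > 0" using \<beta>1 by (simp add: \<kappa>_def)
  obtain d where d: "d > 0" "\<And>s. 0 < s \<Longrightarrow> s < d \<Longrightarrow> \<bar>n\<^sub>e s - (1 - s)\<bar> \<le> \<kappa> * s"
    using n\<^sub>e_near_0[OF \<kappa>] by blast
  have slope: "\<kappa> * s \<le> net_density s" if "0 < s" "s < d" for s
  proof -
    have "1 - rho_i F s \<le> \<beta> * s" using rho_i_Bohm_finite[OF \<beta>] that by simp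
    moreover have "n\<^sub>e s \<le> 1 - s + \<kappa> * s" using d(2)[OF that] by simp
    ultimately have "net_density s \<ge> (1 - \<beta> - \<kappa>) * s" by (simp add: algebra_simps)
    moreover have "1 - \<beta> - \<kappa> = \<kappa>" unfolding \<kappa>_def by (simp add: field_simps)
    ultimately show ?thesis by simp
  qed
  have "\<kappa> / 2 * s\<^sup>2 \<le> V s" if "s \<in> {0..d/2}" for s
  proof -
    have "V 0 - \<kappa> / 2 * 0\<^sup>2 \<le> V s - \<kappa> / 2 * s\<^sup>2"
    proof (rule DERIV_nonneg_imp_increasing_open[of 0 s "\<lambda>s. V s - \<kappa> / 2 * s\<^sup>2"])
      show "0 \<le> s" using that by simp
      show "continuous_on {0..s} (\<lambda>s. V s - \<kappa> / 2 * s\<^sup>2)"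
        by (intro continuous_intros continuous_on_subset[OF continuous_on_V]) auto
      fix t assume t: "0 < t" "t < s"
      have "((\<lambda>s. V s - \<kappa> / 2 * s\<^sup>2) has_real_derivative net_density t - \<kappa> * t) (at t)"
        by (auto intro!: derivative_eq_intros V_DERIV t)
      moreover have "0 \<le> net_density t - \<kappa> * t" using slope[of t] t that by simp
      ultimately show "\<exists>y. ((\<lambda>s. V s - \<kappa> / 2 * s\<^sup>2) has_real_derivative y) (at t) \<and> 0 \<le> y" by blast
    qed
    then show ?thesis by (simp add: V_0)
  qed
  then show ?thesis using \<kappa> d(1) by (intro exI[of _ "\<kappa>/2"] conjI exI[of _ "d/2"]) auto
qed

text \<open>For \<open>1 < c < \<beta>\<close> the slope of \<open>V\<close> is at most \<open>- (c - 1) s + o(s)\<close>.\<close>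

lemma V_neg_near_0:
  assumes "Bohm_integral F > 1"
  shows "\<exists>d>0. \<forall>s. 0 < s \<and> s < d \<longrightarrow> V s < 0"
proof -
  obtain c' where c': "1 < c'" "c' < Bohm_integral F" using dense[OF assms] by blast
  have "c' < top" using c'(2) by (rule order.strict_trans2[OF _ top_greatest])
  then obtain c where c: "c' = ennreal c" "0 \<le> c" by (cases c') auto
  then have c1: "1 < c" using c' by (simp add: ennreal_less_iff flip: ennreal_1)
  obtain d1 where d1: "d1 > 0" "\<And>s. 0 < s \<Longrightarrow> s < d1 \<Longrightarrow> c * s \<le> 1 - rho_i F s"
    using rho_i_Bohm_large[of c] c c' by blast
  define \<kappa> where "\<kappa> = (c - 1) / 2"
  have \<kappa>: "\<kappa> > 0" using c1 by (simp add: \<kappa>_def)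
  obtain d where d: "d > 0" "\<And>s. 0 < s \<Longrightarrow> s < d \<Longrightarrow> \<bar>n\<^sub>e s - (1 - s)\<bar> \<le> \<kappa> * s"
    using n\<^sub>e_near_0[OF \<kappa>] by blast
  have "V s < 0" if s: "0 < s" "s < min d d1" for s
  proof -
    obtain t where t: "0 < t" "t < s" "V s = s * net_density t" using V_mvt[of s] s by auto
    have "c * t \<le> 1 - rho_i F t" using d1(2)[of t] t s by simp
    moreover have "1 - t - \<kappa> * t \<le> n\<^sub>e t" using d(2)[of t] t s by simp
    ultimately have "net_density t \<le> (1 + \<kappa> - c) * t" by (simp add: algebra_simps)
    moreover have "1 + \<kappa> - c = - \<kappa>" unfolding \<kappa>_def by (simp add: field_simps)
    moreover have "- \<kappa> * t < 0" using \<kappa> t by simp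
    ultimately have "net_density t < 0" by simp
    then show ?thesis unfolding t(3) using s by (simp add: mult_pos_neg)
  qed
  then show ?thesis using d(1) d1(1) by (intro exI[of _ "min d d1"]) auto
qed

lemma Bset_empty_if_Bohm_large:
  assumes "Bohm_integral F > 1"
  shows "Bset n\<^sub>e F = {}"
proof (rule ccontr)
  assume "Bset n\<^sub>e F \<noteq> {}"
  then obtain b where b: "b > 0" "\<And>s. s \<in> {0<..b} \<Longrightarrow> V s > 0" unfolding Bset_def by blast
  obtain d where d: "d > 0" "\<And>s. 0 < s \<Longrightarrow> s < d \<Longrightarrow> V s < 0" using V_neg_near_0[OF assms] by blast
  define s where "s = min b (d/2)"
  have "s \<in> {0<..b}" "0 < s" "s < d" using b(1) d(1) by (auto simp: s_def)
  then show False using b(2)[of s] d(2)[of s] by simp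
qed

lemma Bset_nonempty_if_Bohm_small:
  assumes "Bohm_integral F < 1"
  shows "Bset n\<^sub>e F \<noteq> {}"
proof -
  obtain c d where cd: "c > 0" "d > 0" "\<And>s. s \<in> {0..d} \<Longrightarrow> c * s\<^sup>2 \<le> V s"
    using V_ge_quadratic_near_0[OF assms] by blast
  have "V s > 0" if "s \<in> {0<..d}" for s
  proof -
    have "0 < c * s\<^sup>2" using cd that by simp
    then show ?thesis using cd(3)[of s] that by simp
  qed
  then have "d \<in> Bset n\<^sub>e F" unfolding Bset_def using cd(2) by simp
  then show ?thesis by blast
qed

text \<open>By continuity \<open>V\<close> stays positive slightly beyond \<open>b\<close>.\<close>

lemma Bset_extend:
  assumes "b \<in> Bset n\<^sub>e F"
  shows "\<exists>b'>b. b' \<in> Bset n\<^sub>e F"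
proof -
  have b: "b > 0" "\<And>s. s \<in> {0<..b} \<Longrightarrow> V s > 0" using assms by (auto simp: Bset_def)
  have Vb: "V b > 0" using b by simp
  have "V \<midarrow>b\<rightarrow> V b" using V_DERIV[OF b(1)] DERIV_isCont unfolding isCont_def by blast
  then obtain d where d: "d > 0" "\<And>x. x \<noteq> b \<Longrightarrow> \<bar>x - b\<bar> < d \<Longrightarrow> \<bar>V x - V b\<bar> < V b"
    using LIM_D[OF _ Vb] by (metis real_norm_def)
  have "V s > 0" if "s \<in> {0<..b + d/2}" for s
  proof (cases "s \<le> b")
    case True then show ?thesis using b(2)[of s] that by simp
  next
    case False
    then have "\<bar>V s - V b\<bar> < V b" using that d(1) by (intro d(2)) auto
    then show ?thesis by simp
  qed
  then have "b + d/2 \<in> Bset n\<^sub>e F" using b(1) d(1) by (simp add: Bset_def)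
  then show ?thesis using d(1) by (intro exI[of _ "b + d/2"]) auto
qed

lemma Bset_iff_less_supB:
  assumes "b > 0"
  shows "b \<in> Bset n\<^sub>e F \<longleftrightarrow> ereal b < supB n\<^sub>e F"
proof
  assume "b \<in> Bset n\<^sub>e F"
  then obtain b' where "b' > b" "b' \<in> Bset n\<^sub>e F" using Bset_extend by blast
  then show "ereal b < supB n\<^sub>e F" unfolding supB_def less_SUP_iff by auto
next
  assume "ereal b < supB n\<^sub>e F"
  then obtain b' where "b' \<in> Bset n\<^sub>e F" "b < b'" unfolding supB_def less_SUP_iff by auto
  then show "b \<in> Bset n\<^sub>e F" unfolding Bset_def using assms by auto
qed

lemma V_ge_quadratic:
  assumes "Bohm_integral F < 1" and "b \<in> Bset n\<^sub>e F"
  shows "\<exists>c>0. \<forall>s\<in>{0..b}. c * s\<^sup>2 \<le> V s"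
proof -
  have b: "b > 0" "\<And>s. s \<in> {0<..b} \<Longrightarrow> V s > 0" using assms(2) by (auto simp: Bset_def)
  obtain c d where cd: "c > 0" "d > 0" "\<And>s. s \<in> {0..d} \<Longrightarrow> c * s\<^sup>2 \<le> V s"
    using V_ge_quadratic_near_0[OF assms(1)] by blast
  define e where "e = min d b"
  have e: "0 < e" "e \<le> b" "e \<le> d" using cd b by (auto simp: e_def)
  have "continuous_on {e..b} V" by (rule continuous_on_subset[OF continuous_on_V]) (use e in auto)
  then obtain m where m: "m \<in> {e..b}" "\<And>s. s \<in> {e..b} \<Longrightarrow> V m \<le> V s"
    using continuous_attains_inf[of "{e..b}" V] e by auto
  have Vm: "V m > 0" using b(2)[of m] m e by auto
  define k where "k = min c (V m / b\<^sup>2)"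
  have k: "k > 0" using cd Vm b by (simp add: k_def)
  have "k * s\<^sup>2 \<le> V s" if "s \<in> {0..b}" for s
  proof (cases "s \<le> e")
    case True
    have "k * s\<^sup>2 \<le> c * s\<^sup>2" by (intro mult_right_mono) (auto simp: k_def)
    also have "\<dots> \<le> V s" using cd(3)[of s] True that e by auto
    finally show ?thesis .
  next
    case False
    have "k * s\<^sup>2 \<le> V m / b\<^sup>2 * b\<^sup>2" using k that Vm by (intro mult_mono power_mono) (auto simp: k_def)
    also have "\<dots> = V m" using b by simp
    also have "\<dots> \<le> V s" using m(2)[of s] False that by auto
    finally show ?thesis .
  qed
  then show ?thesis using k by blast
qed

lemma net_density_linear_bound:
  assumes "Bohm_integral F < 1"
  shows "\<exists>C>0. \<forall>s\<in>{0..b}. \<bar>net_density s\<bar> \<le> C * s"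
proof -
  obtain \<beta> where \<beta>: "Bohm_integral F = ennreal \<beta>" "0 \<le> \<beta>"
    using assms by (cases "Bohm_integral F") auto
  obtain C where C: "C > 0" "\<And>s. s \<in> {0..b} \<Longrightarrow> \<bar>n\<^sub>e s - 1\<bar> \<le> C * s" using n\<^sub>e_Lipschitz_at_0 by blast
  have "\<bar>net_density s\<bar> \<le> (C + \<beta>) * s" if "s \<in> {0..b}" for s
    using C(2)[OF that] rho_i_Bohm_finite[OF \<beta>, of s] rho_i_le_1[of s] that by (auto simp: algebra_simps)
  then show ?thesis using C(1) \<beta>(2) by (intro exI[of _ "C + \<beta>"]) auto
qed

end

section \<open>The autonomous equation for the electrostatic potential\<close>

lemma strictly_decreasing_half_line:
  fixes \<phi> :: "real \<Rightarrow> real"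
  assumes d: "\<And>x. 0 \<le> x \<Longrightarrow> (\<phi> has_real_derivative p x) (at x within {0..})"
    and neg: "\<And>x. 0 \<le> x \<Longrightarrow> p x < 0" and "0 \<le> x" "x < y"
  shows "\<phi> y < \<phi> x"
proof (rule DERIV_neg_imp_decreasing_open[OF \<open>x < y\<close>])
  fix t assume t: "x < t" "t < y"
  then have "(\<phi> has_real_derivative p t) (at t)"
    using d[of t] at_within_half_line[of t] \<open>0 \<le> x\<close> by simp
  then show "\<exists>z. (\<phi> has_real_derivative z) (at t) \<and> z < 0" using neg[of t] t \<open>0 \<le> x\<close> by force
next
  have "continuous_on {0..} \<phi>" by (rule DERIV_continuous_on[OF d]) simp
  then show "continuous_on {x..y} \<phi>" by (rule continuous_on_subset) (use \<open>0 \<le> x\<close> in auto)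
qed

lemma decreasing_to_0_pos:
  fixes \<phi> :: "real \<Rightarrow> real"
  assumes dec: "\<And>x y. 0 \<le> x \<Longrightarrow> x < y \<Longrightarrow> \<phi> y < \<phi> x" and lim: "(\<phi> \<longlongrightarrow> 0) at_top" and "0 \<le> x"
  shows "0 < \<phi> x"
proof -
  have "0 \<le> \<phi> (x + 1)"
  proof (rule tendsto_upperbound[OF lim])
    show "\<forall>\<^sub>F y in at_top. \<phi> y \<le> \<phi> (x + 1)"
      using eventually_gt_at_top[of "x + 1"] by eventually_elim (use dec[of "x+1"] \<open>0 \<le> x\<close> in \<open>auto intro: less_imp_le\<close>)
  qed simp
  then show ?thesis using dec[of x "x+1"] \<open>0 \<le> x\<close> by simp
qed

text \<open>The energy \<open>p\<^sup>2 / 2 - V(\<phi>)\<close> is constant, and its value is the limit of \<open>p\<^sup>2 / 2\<close>. If that were positive, \<open>\<phi>\<close> would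
  fall at least linearly and become negative.\<close>

lemma first_integral:
  fixes \<phi> p v V :: "real \<Rightarrow> real"
  assumes d\<phi>: "\<And>x. 0 \<le> x \<Longrightarrow> (\<phi> has_real_derivative p x) (at x within {0..})"
    and cp: "continuous_on {0..} p" and neg: "\<And>x. 0 \<le> x \<Longrightarrow> p x < 0"
    and dp: "\<And>x. 0 < x \<Longrightarrow> (p has_real_derivative v (\<phi> x)) (at x)"
    and lim: "(\<phi> \<longlongrightarrow> 0) at_top"
    and dV: "\<And>s. 0 < s \<Longrightarrow> (V has_real_derivative v s) (at s)"
    and cV: "continuous_on {0..} V" and V0: "V 0 = 0" and "0 \<le> x"
  shows "0 < V (\<phi> x)" and "p x = - sqrt (2 * V (\<phi> x))"
proof -
  have dec: "\<phi> y < \<phi> x" if "0 \<le> x" "x < y" for x y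
    using strictly_decreasing_half_line[OF d\<phi> neg that] by simp
  have pos: "0 < \<phi> x" if "0 \<le> x" for x using decreasing_to_0_pos[OF dec lim that] by simp
  have c\<phi>: "continuous_on {0..} \<phi>" by (rule DERIV_continuous_on[OF d\<phi>]) simp
  define K where "K x = (p x)\<^sup>2 / 2 - V (\<phi> x)" for x
  have cK: "continuous_on {0..} K"
    unfolding K_def by (intro continuous_intros cp continuous_on_compose2[OF cV c\<phi>])
      (use pos in \<open>auto intro: less_imp_le\<close>)
  have K: "K x = K 0" if "0 \<le> x" for x
  proof (cases "x = 0")
    case False
    show ?thesis
    proof (rule DERIV_isconst_end[of 0 x K])
      show "0 < x" using that False by simp
      show "continuous_on {0..x} K" by (rule continuous_on_subset[OF cK]) auto
      fix t :: real assume t: "0 < t" "t < x"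
      have 1: "(\<phi> has_real_derivative p t) (at t)" using d\<phi>[of t] at_within_half_line[of t] t by simp
      have 2: "((\<lambda>t. V (\<phi> t)) has_real_derivative v (\<phi> t) * p t) (at t)"
        by (rule DERIV_chain2[OF dV[OF pos] 1]) (use t in simp)
      show "(K has_real_derivative 0) (at t)"
        unfolding K_def by (rule derivative_eq_intros dp[OF t(1)] 2 refl | simp add: t)+
    qed
  qed simp
  have Vlim: "((\<lambda>x. V (\<phi> x)) \<longlongrightarrow> 0) at_top"
  proof -
    have "((\<lambda>x. V (\<phi> x)) \<longlongrightarrow> V 0) at_top"
      by (rule continuous_on_tendsto_compose[OF cV lim])
         (auto simp: eventually_at_top_linorder intro!: exI[of _ 0] less_imp_le[OF pos])
    then show ?thesis by (simp add: V0)
  qed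
  have "((\<lambda>x. K x + V (\<phi> x)) \<longlongrightarrow> K 0) at_top"
  proof -
    have "((\<lambda>x. K 0 + V (\<phi> x)) \<longlongrightarrow> K 0 + 0) at_top" by (intro tendsto_intros Vlim)
    moreover have "\<forall>\<^sub>F x in at_top. K 0 + V (\<phi> x) = K x + V (\<phi> x)"
    proof (rule eventually_mono[OF eventually_ge_at_top[of "0::real"]])
      fix x :: real assume "0 \<le> x"
      then show "K 0 + V (\<phi> x) = K x + V (\<phi> x)" by (simp only: K[OF \<open>0 \<le> x\<close>])
    qed
    ultimately show ?thesis using Lim_transform_eventually by force
  qed
  then have p2: "((\<lambda>x. (p x)\<^sup>2 / 2) \<longlongrightarrow> K 0) at_top" by (simp add: K_def)
  have K0: "0 \<le> K 0" by (rule tendsto_lowerbound[OF p2]) auto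
  have "\<not> 0 < K 0"
  proof
    assume kp: "0 < K 0"
    define m where "m = sqrt (K 0)"
    have m: "m > 0" "m\<^sup>2 = K 0" using kp by (auto simp: m_def)
    have "\<forall>\<^sub>F x in at_top. K 0 / 2 < (p x)\<^sup>2 / 2" by (rule order_tendstoD(1)[OF p2]) (use kp in simp)
    then obtain N where N: "\<And>x. x \<ge> N \<Longrightarrow> K 0 < (p x)\<^sup>2" by (auto simp: eventually_at_top_linorder)
    define a where "a = max N 0"
    have pm: "p x < - m" if "x \<ge> a" for x
    proof -
      have "m\<^sup>2 < (- p x)\<^sup>2" using N[of x] that m by (simp add: a_def)
      then have "m < - p x" using neg[of x] that by (intro power2_less_imp_less[of m]) (auto simp: a_def intro: less_imp_le)
      then show ?thesis by simp
    qed
    have a0: "0 \<le> a" by (simp add: a_def)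
    \<comment> \<open>At slope below \<open>- m\<close>, \<open>\<phi>\<close> would be negative at this point.\<close>
    define y where "y = a + \<phi> a / m"
    have ya: "a < y" using pos[OF a0] m by (simp add: y_def)
    obtain z where z: "z > a" "z < y" "\<phi> y - \<phi> a = (y - a) * p z"
    proof -
      have "\<exists>z>a. z < y \<and> \<phi> y - \<phi> a = (y - a) * p z"
      proof (rule MVT_open[OF ya])
        fix t assume "a < t" "t < y"
        then show "(\<phi> has_real_derivative p t) (at t)" using d\<phi>[of t] at_within_half_line[of t] a0 by simp
      next
        show "continuous_on {a..y} \<phi>" by (rule continuous_on_subset[OF c\<phi>]) (use a0 in auto)
      qed
      then show thesis using that by blast
    qed
    have "(y - a) * p z < (y - a) * (- m)" using pm[of z] z ya by (intro mult_strict_left_mono) auto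
    also have "\<dots> = - \<phi> a" using m by (simp add: y_def)
    finally show False using z(3) pos[of y] a0 ya by simp
  qed
  then have "K x = 0" using K[OF \<open>0 \<le> x\<close>] K0 by simp
  then have e: "(p x)\<^sup>2 = 2 * V (\<phi> x)" by (simp add: K_def)
  then show "0 < V (\<phi> x)" using neg[OF \<open>0 \<le> x\<close>] by (smt (verit) zero_less_power2)
  have "sqrt (2 * V (\<phi> x)) = \<bar>p x\<bar>" unfolding e[symmetric] by (rule real_sqrt_abs)
  then show "p x = - sqrt (2 * V (\<phi> x))" using neg[OF \<open>0 \<le> x\<close>] by simp
qed

text \<open>Separation of variables: \<open>G\<close> is the position as a function of the potential.\<close>

locale quadrature =
  fixes V :: "real \<Rightarrow> real" and b b' C :: real
  assumes b: "0 < b" "b < b'" and cV: "continuous_on {0..} V"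
    and Vpos: "\<And>s. 0 < s \<Longrightarrow> s \<le> b' \<Longrightarrow> 0 < V s"
    and C: "0 < C" and VC: "\<And>s. 0 \<le> s \<Longrightarrow> s \<le> b' \<Longrightarrow> V s \<le> C * s\<^sup>2"
begin

definition "q s = 1 / sqrt (2 * V s)"

definition "G y = integral {y..b'} q - integral {b..b'} q"

lemma q_pos: "0 < s \<Longrightarrow> s \<le> b' \<Longrightarrow> 0 < q s"
  using Vpos by (simp add: q_def)

lemma cq: "0 < e \<Longrightarrow> continuous_on {e..b'} q"
proof -
  assume e: "0 < e"
  have "sqrt (2 * V s) \<noteq> 0" if "s \<in> {e..b'}" for s using Vpos[of s] that e by simp
  then show ?thesis
    unfolding q_def by (intro continuous_intros continuous_on_subset[OF cV] ballI) (use e in auto)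
qed

lemma G_DERIV:
  assumes "0 < y" "y < b'"
  shows "(G has_real_derivative - q y) (at y)"
proof -
  have "((\<lambda>x. integral {x..b'} q) has_real_derivative - q y) (at y within {y/2..b'})"
    by (rule integral_has_real_derivative'[OF cq]) (use assms in auto)
  moreover have "at y within {y/2..b'} = at y"
    by (rule at_within_interior) (use assms in auto)
  ultimately show ?thesis
    unfolding G_def by (auto intro!: derivative_eq_intros)
qed

lemma G_b: "G b = 0" by (simp add: G_def)

lemma G_strict:
  assumes "0 < y" "y < z" "z < b'"
  shows "G z < G y"
proof (rule DERIV_neg_imp_decreasing[OF \<open>y < z\<close>])
  fix t assume "y \<le> t" "t \<le> z"
  then show "\<exists>w. (G has_real_derivative w) (at t) \<and> w < 0"
    using G_DERIV[of t] q_pos[of t] assms by force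
qed

lemma G_inj: "0 < y \<Longrightarrow> y < b' \<Longrightarrow> 0 < z \<Longrightarrow> z < b' \<Longrightarrow> G y = G z \<Longrightarrow> y = z"
  using G_strict by (metis less_irrefl linorder_less_linear)

text \<open>A potential vanishing quadratically makes the position diverge logarithmically, so the value \<open>0\<close>
  is not reached at a finite position.\<close>

lemma G_lower:
  assumes "0 < y" "y \<le> b"
  shows "(ln b - ln y) / sqrt (2 * C) \<le> G y"
proof -
  define k where "k = 1 / sqrt (2 * C)"
  have "G b + k * ln b \<le> G y + k * ln y"
  proof (rule DERIV_nonpos_imp_nonincreasing[OF \<open>y \<le> b\<close>, of "\<lambda>t. G t + k * ln t"])
    fix t assume t: "y \<le> t" "t \<le> b"
    then have t0: "0 < t" "t < b'" using assms b by auto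
    have "sqrt (2 * V t) \<le> sqrt (2 * (C * t\<^sup>2))"
      using VC[of t] t0 by (intro real_sqrt_le_mono) auto
    also have "\<dots> = sqrt (2 * C) * t" using t0 by (simp add: real_sqrt_mult)
    finally have "1 / (sqrt (2 * C) * t) \<le> q t"
      unfolding q_def using Vpos[of t] t0 C by (intro divide_left_mono) auto
    then have "- q t + k / t \<le> 0" by (simp add: k_def)
    moreover have "((\<lambda>t. G t + k * ln t) has_real_derivative - q t + k / t) (at t)"
      by (rule derivative_eq_intros G_DERIV t0 refl)+ (use t0 in simp)
    ultimately show "\<exists>w. ((\<lambda>t. G t + k * ln t) has_real_derivative w) (at t) \<and> w \<le> 0" by blast
  qed
  then show ?thesis by (simp add: G_b k_def diff_divide_distrib)
qed

lemma G_surj: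
  assumes "0 \<le> x"
  shows "\<exists>y. 0 < y \<and> y \<le> b \<and> G y = x"
proof -
  \<comment> \<open>At this value the logarithmic lower bound of \<open>G\<close> equals \<open>x\<close>.\<close>
  define y0 where "y0 = b * exp (- (x * sqrt (2 * C)))"
  have y0: "0 < y0" "y0 \<le> b" using b assms C by (auto simp: y0_def)
  have "x \<le> G y0"
    using G_lower[OF y0] b C by (simp add: y0_def ln_mult)
  then have "\<exists>y\<ge>y0. y \<le> b \<and> G y = x"
    by (intro IVT2) (use y0 b G_b assms in \<open>auto intro!: DERIV_isCont G_DERIV\<close>)
  then obtain y where "y0 \<le> y" "y \<le> b" "G y = x" by blast
  then show ?thesis using y0 by (intro exI[of _ y]) simp
qed

definition "\<Phi> x = (THE y. 0 < y \<and> y < b' \<and> G y = x)"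

lemma \<Phi>_G: "0 < y \<Longrightarrow> y < b' \<Longrightarrow> \<Phi> (G y) = y"
  unfolding \<Phi>_def by (rule the_equality) (use G_inj in auto)

lemma \<Phi>_range: "0 \<le> x \<Longrightarrow> 0 < \<Phi> x \<and> \<Phi> x \<le> b \<and> G (\<Phi> x) = x"
  using G_surj[of x] \<Phi>_G b by force

lemma \<Phi>_0: "\<Phi> 0 = b"
  using \<Phi>_G[of b] b G_b by simp

lemma \<Phi>_DERIV:
  assumes "0 \<le> x"
  shows "(\<Phi> has_real_derivative - sqrt (2 * V (\<Phi> x))) (at x)"
proof -
  \<comment> \<open>\<open>G\<close> is negative at \<open>b1\<close>, so \<open>\<Phi>\<close> inverts \<open>G\<close> on a neighbourhood of every \<open>x \<ge> 0\<close>, also of \<open>x = 0\<close>.\<close>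
  define b1 where "b1 = (b + b') / 2"
  have b1: "b < b1" "b1 < b'" using b by (auto simp: b1_def)
  have neg: "G b1 < 0" using G_strict[of b b1] G_b b b1 by simp
  have inv: "G (\<Phi> y) = y" if "G b1 < y" for y
  proof (cases "0 \<le> y")
    case True then show ?thesis using \<Phi>_range by blast
  next
    case False
    have "\<exists>z. b \<le> z \<and> z \<le> b1 \<and> G z = y"
      by (rule IVT2) (use that False b b1 G_b in \<open>auto intro!: DERIV_isCont G_DERIV\<close>)
    then show ?thesis using \<Phi>_G b b1 by force
  qed
  have y: "0 < \<Phi> x" "\<Phi> x < b'" "G (\<Phi> x) = x" using \<Phi>_range[OF assms] b by auto
  define d where "d = min (\<Phi> x) (b' - \<Phi> x) / 2"
  have d: "0 < d" "d < \<Phi> x" "d < b' - \<Phi> x" using y by (auto simp: d_def min_def)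
  have "isCont \<Phi> (G (\<Phi> x))"
    by (rule isCont_inverse_function[OF d(1)])
       (use d in \<open>auto intro!: \<Phi>_G DERIV_isCont G_DERIV simp: abs_le_iff\<close>)
  then have "isCont \<Phi> x" by (simp add: y)
  then have "(\<Phi> has_real_derivative inverse (- q (\<Phi> x))) (at x)"
    by (intro DERIV_inverse_function[where f = G and a = "G b1" and b = "x + 1"] G_DERIV y)
       (use inv neg assms q_pos[of "\<Phi> x"] y in auto)
  then show ?thesis by (simp add: q_def inverse_eq_divide)
qed

lemma \<Phi>_tendsto_0: "(\<Phi> \<longlongrightarrow> 0) at_top"
proof (rule order_tendstoI)
  fix a :: real assume "a < 0"
  show "\<forall>\<^sub>F x in at_top. a < \<Phi> x"
    using eventually_ge_at_top[of "0::real"] by eventually_elim (use \<Phi>_range \<open>a < 0\<close> in force)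
next
  fix a :: real assume "0 < a"
  define e where "e = min a b"
  have e: "0 < e" "e \<le> a" "e < b'" using \<open>0 < a\<close> b by (auto simp: e_def)
  show "\<forall>\<^sub>F x in at_top. \<Phi> x < a"
    using eventually_ge_at_top[of "0::real"] eventually_gt_at_top[of "G e"]
  proof eventually_elim
    case (elim x)
    have "\<Phi> x < e"
    proof (rule ccontr)
      assume "\<not> \<Phi> x < e"
      then have "G (\<Phi> x) \<le> G e" using G_strict[of e "\<Phi> x"] \<Phi>_range[OF elim(1)] e b by (cases "\<Phi> x = e") auto
      then show False using elim \<Phi>_range[OF elim(1)] by simp
    qed
    then show ?case using e by simp
  qed
qed

lemma solution_unique:
  assumes d: "\<And>x. 0 \<le> x \<Longrightarrow> (\<phi> has_real_derivative - sqrt (2 * V (\<phi> x))) (at x within {0..})"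
    and r: "\<And>x. 0 \<le> x \<Longrightarrow> 0 < \<phi> x \<and> \<phi> x \<le> b" and \<phi>0: "\<phi> 0 = b" and "0 \<le> x"
  shows "\<phi> x = \<Phi> x"
proof -
  have "\<exists>c. \<forall>t\<in>{0..}. G (\<phi> t) - t = c"
  proof (rule has_field_derivative_zero_constant)
    fix t :: real assume "t \<in> {0..}"
    then have t: "0 \<le> t" by simp
    have "(G has_real_derivative - q (\<phi> t)) (at (\<phi> t))" using G_DERIV r[OF t] b by simp
    then have "((\<lambda>t. G (\<phi> t)) has_real_derivative - q (\<phi> t) * - sqrt (2 * V (\<phi> t))) (at t within {0..})"
      by (rule DERIV_chain2) (rule d[OF t])
    moreover have "- q (\<phi> t) * - sqrt (2 * V (\<phi> t)) = 1"
      using Vpos[of "\<phi> t"] r[OF t] b by (simp add: q_def)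
    ultimately have "((\<lambda>t. G (\<phi> t)) has_real_derivative 1) (at t within {0..})" by simp
    from DERIV_diff[OF this DERIV_ident] show "((\<lambda>t. G (\<phi> t) - t) has_real_derivative 0) (at t within {0..})"
      by simp
  qed simp
  then have "G (\<phi> x) - x = G (\<phi> 0) - 0" using \<open>0 \<le> x\<close> by (metis atLeast_iff order_refl)
  then have "G (\<phi> x) = x" by (simp add: \<phi>0 G_b)
  then show ?thesis using \<Phi>_G[of "\<phi> x"] r[OF \<open>0 \<le> x\<close>] b by simp
qed

end

text \<open>The lower bound of \<open>V\<close> turns the equation into the differential inequality \<open>\<phi>' \<le> - sqrt (2 c) \<phi>\<close>.\<close>

lemma exponential_decay:
  fixes \<phi> V :: "real \<Rightarrow> real"
  assumes d: "\<And>x. 0 \<le> x \<Longrightarrow> (\<phi> has_real_derivative - sqrt (2 * V (\<phi> x))) (at x within {0..})"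
    and r: "\<And>x. 0 \<le> x \<Longrightarrow> 0 \<le> \<phi> x" and Vc: "\<And>x. 0 \<le> x \<Longrightarrow> c * (\<phi> x)\<^sup>2 \<le> V (\<phi> x)" and "0 \<le> c" "0 \<le> x"
  shows "\<phi> x \<le> \<phi> 0 * exp (- sqrt (2 * c) * x)"
proof -
  define k where "k = sqrt (2 * c)"
  have "\<phi> x * exp (k * x) \<le> \<phi> 0 * exp (k * 0)"
  proof (rule DERIV_nonpos_imp_decreasing_open[OF \<open>0 \<le> x\<close>, of "\<lambda>x. \<phi> x * exp (k * x)"])
    fix t assume t: "0 < t" "t < x"
    have 1: "(\<phi> has_real_derivative - sqrt (2 * V (\<phi> t))) (at t)"
      using d[of t] at_within_half_line[of t] t by simp
    have "((\<lambda>x. \<phi> x * exp (k * x)) has_real_derivative (k * \<phi> t - sqrt (2 * V (\<phi> t))) * exp (k * t)) (at t)"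
      by (rule derivative_eq_intros 1 refl)+ (simp add: algebra_simps)
    moreover have "k * \<phi> t \<le> sqrt (2 * V (\<phi> t))"
    proof -
      have "k * \<phi> t = sqrt (2 * (c * (\<phi> t)\<^sup>2))" using r[of t] t by (simp add: k_def real_sqrt_mult)
      also have "\<dots> \<le> sqrt (2 * V (\<phi> t))" using Vc[of t] t by (intro real_sqrt_le_mono) auto
      finally show ?thesis .
    qed
    ultimately show "\<exists>y. ((\<lambda>x. \<phi> x * exp (k * x)) has_real_derivative y) (at t) \<and> y \<le> 0"
      by (intro exI conjI) (auto simp: mult_le_0_iff)
  next
    have "continuous_on {0..} \<phi>" by (rule DERIV_continuous_on[OF d]) simp
    then show "continuous_on {0..x} (\<lambda>x. \<phi> x * exp (k * x))"
      by (intro continuous_intros) (auto elim: continuous_on_subset)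
  qed
  then show ?thesis by (simp add: k_def exp_minus field_simps)
qed

section \<open>Density of continuous functions in mean\<close>

text \<open>A measurable function is the limit almost everywhere of continuous functions \<open>g n\<close>. Cutting \<open>f\<close> and all \<open>g n\<close>
  at the levels \<open>\<plusminus>c M\<close>, where \<open>c M\<close> is continuous with compact support and tends to infinity with \<open>M\<close>, makes both limits
  dominated: first \<open>M \<rightarrow> \<infinity>\<close>, then \<open>n \<rightarrow> \<infinity>\<close>.\<close>

lemma integrable_approx_continuous:
  fixes f :: "'a::euclidean_space \<Rightarrow> real"
  assumes f: "integrable lborel f" and e: "0 < e"
  shows "\<exists>g. continuous_on UNIV g \<and> integrable lborel g \<and> (LINT x|lborel. \<bar>f x - g x\<bar>) < e"
proof -
  have fm [measurable]: "f \<in> borel_measurable borel" using f by simp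
  have "f \<in> borel_measurable (lebesgue_on UNIV)" 
    unfolding lebesgue_on_UNIV_eq by (rule measurable_completion) simp
  then have "f measurable_on UNIV" by (simp add: measurable_on_iff_borel_measurable)
  then obtain N g where N: "negligible N" and cg: "\<And>n. continuous_on UNIV (g n)"
    and lim: "\<And>x. x \<notin> N \<Longrightarrow> (\<lambda>n. g n x) \<longlonglongrightarrow> f x"
    unfolding measurable_on_def by auto
  have gm [measurable]: "g n \<in> borel_measurable borel" for n by (rule borel_measurable_continuous_onI[OF cg])
  have AEN: "AE x in lborel. x \<notin> N"
    using N by (metis AE_completion_iff AE_not_in negligible_iff_null_sets)
  define c where "c M x = real M * max 0 (min 1 (real M - norm x))" for M and x :: 'a
  have cc: "continuous_on UNIV (c M)" for M unfolding c_def by (intro continuous_intros)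
  have cm [measurable]: "c M \<in> borel_measurable borel" for M by (rule borel_measurable_continuous_onI[OF cc])
  have c0: "0 \<le> c M x" for M x by (simp add: c_def)
  have ci: "integrable lborel (c M)" for M
  proof (rule Bochner_Integration.integrable_bound[of _ "\<lambda>x. real M * indicat_real (cball 0 (real M)) x"])
    show "integrable lborel (\<lambda>x. real M * indicat_real (cball 0 (real M)) (x::'a))"
      using emeasure_lborel_cball_finite[of "0::'a" "real M"] by (intro integrable_mult_right integrable_real_indicator) auto
    show "AE x in lborel. norm (c M x) \<le> norm (real M * indicat_real (cball 0 (real M)) x)"
    proof (rule AE_I2)
      fix x :: 'a
      have "real M * max 0 (min 1 (real M - norm x)) \<le> real M * 1" by (intro mult_left_mono) auto
      then show "norm (c M x) \<le> norm (real M * indicat_real (cball 0 (real M)) x)"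
        by (auto simp: c_def indicator_def)
    qed
  qed simp
  define cut where "cut M t x = max (- c M x) (min (c M x) t)" for M t x
  have cut_c: "\<bar>cut M t x\<bar> \<le> c M x" and cut_t: "\<bar>cut M t x\<bar> \<le> \<bar>t\<bar>" for M t x
    using c0[of M x] by (auto simp: cut_def)
  have [measurable]: "(\<lambda>x. cut M (f x) x) \<in> borel_measurable borel" "(\<lambda>x. cut M (g n x) x) \<in> borel_measurable borel" for M n
    unfolding cut_def by measurable
  have l1: "(\<lambda>M. LINT x|lborel. \<bar>f x - cut M (f x) x\<bar>) \<longlonglongrightarrow> (LINT (x::'a)|lborel. (0::real))"
  proof (rule integral_dominated_convergence[where w = "\<lambda>x. 2 * \<bar>f x\<bar>"])
    show "AE x in lborel. (\<lambda>M. \<bar>f x - cut M (f x) x\<bar>) \<longlonglongrightarrow> 0"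
    proof (rule AE_I2, rule tendsto_eventually)
      fix x :: 'a
      obtain K :: nat where K: "norm x + 1 + \<bar>f x\<bar> \<le> real K" using real_arch_simple by blast
      show "\<forall>\<^sub>F M in sequentially. \<bar>f x - cut M (f x) x\<bar> = 0"
        using eventually_ge_at_top[of K]
      proof eventually_elim
        case (elim M)
        then have "real K \<le> real M" by simp
        then have "min 1 (real M - norm x) = 1" "\<bar>f x\<bar> \<le> real M" using K norm_ge_zero[of x] by linarith+
        then have "\<bar>f x\<bar> \<le> c M x" by (simp add: c_def)
        then show ?case by (auto simp: cut_def)
      qed
    qed
    show "AE x in lborel. norm \<bar>f x - cut M (f x) x\<bar> \<le> 2 * \<bar>f x\<bar>" for M
      by (rule AE_I2) (use cut_t[of M] in \<open>smt (verit) real_norm_def\<close>)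
  qed (use f in auto)
  then have "\<forall>\<^sub>F M in sequentially. (LINT x|lborel. \<bar>f x - cut M (f x) x\<bar>) < e / 2"
    using order_tendstoD(2)[OF l1, of "e/2"] e by simp
  then obtain M where M: "(LINT x|lborel. \<bar>f x - cut M (f x) x\<bar>) < e / 2"
    by (meson eventually_happens trivial_limit_sequentially)
  have l2: "(\<lambda>n. LINT x|lborel. \<bar>cut M (f x) x - cut M (g n x) x\<bar>) \<longlonglongrightarrow> (LINT (x::'a)|lborel. (0::real))"
  proof (rule integral_dominated_convergence[where w = "\<lambda>x. 2 * c M x"])
    show "AE x in lborel. (\<lambda>n. \<bar>cut M (f x) x - cut M (g n x) x\<bar>) \<longlonglongrightarrow> 0"
      using AEN
    proof eventually_elim
      case (elim x)
      have "(\<lambda>n. \<bar>cut M (f x) x - cut M (g n x) x\<bar>) \<longlonglongrightarrow> \<bar>cut M (f x) x - cut M (f x) x\<bar>"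
        unfolding cut_def by (intro tendsto_intros lim elim)
      then show ?case by simp
    qed
    show "AE x in lborel. norm \<bar>cut M (f x) x - cut M (g n x) x\<bar> \<le> 2 * c M x" for n
    proof (rule AE_I2)
      fix x show "norm \<bar>cut M (f x) x - cut M (g n x) x\<bar> \<le> 2 * c M x"
        using cut_c[of M "f x" x] cut_c[of M "g n x" x] by simp
    qed
  qed (use ci in auto)
  then have "\<forall>\<^sub>F n in sequentially. (LINT x|lborel. \<bar>cut M (f x) x - cut M (g n x) x\<bar>) < e / 2"
    using order_tendstoD(2)[OF l2, of "e/2"] e by simp
  then obtain n where n: "(LINT x|lborel. \<bar>cut M (f x) x - cut M (g n x) x\<bar>) < e / 2"
    by (meson eventually_happens trivial_limit_sequentially)
  have i1: "integrable lborel (\<lambda>x. cut M (f x) x)"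
    by (rule Bochner_Integration.integrable_bound[OF f]) (use cut_t in auto)
  have i2: "integrable lborel (\<lambda>x. cut M (g n x) x)"
  proof (rule Bochner_Integration.integrable_bound[OF ci[of M]])
    show "AE x in lborel. norm (cut M (g n x) x) \<le> norm (c M x)"
      using cut_c[of M] c0[of M] by (intro AE_I2) simp
  qed simp
  have "(LINT x|lborel. \<bar>f x - cut M (g n x) x\<bar>)
     \<le> (LINT x|lborel. \<bar>f x - cut M (f x) x\<bar> + \<bar>cut M (f x) x - cut M (g n x) x\<bar>)"
    by (rule integral_mono) (use f i1 i2 in auto)
  also have "\<dots> = (LINT x|lborel. \<bar>f x - cut M (f x) x\<bar>) + (LINT x|lborel. \<bar>cut M (f x) x - cut M (g n x) x\<bar>)"
    by (rule Bochner_Integration.integral_add) (use f i1 i2 in auto)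
  finally have "(LINT x|lborel. \<bar>f x - cut M (g n x) x\<bar>) < e" using M n by simp
  moreover have "continuous_on UNIV (\<lambda>x. cut M (g n x) x)"
    unfolding cut_def by (intro continuous_intros cc cg)
  ultimately show ?thesis using i2 by blast
qed

section \<open>Transport of densities at constant energy\<close>

text \<open>The velocity at potential \<open>a\<close> of an ion with velocity \<open>\<eta>\<close> at infinity, by conservation of energy.\<close>

definition fall :: "real \<Rightarrow> vel \<Rightarrow> vel" where
  "fall a \<eta> = (- sqrt ((fst \<eta>)\<^sup>2 + 2 * a), snd \<eta>)"

text \<open>The density at potential \<open>a\<close> of ions whose density at infinity is \<open>f\<close>.\<close>

definition accelerated :: "(vel \<Rightarrow> real) \<Rightarrow> real \<Rightarrow> vel \<Rightarrow> real" where
  "accelerated f a \<xi> = f (- sqrt ((fst \<xi>)\<^sup>2 - 2 * a), snd \<xi>) *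
     indicat_real {0<..} ((fst \<xi>)\<^sup>2 - 2 * a) * indicat_real {0<..} (- fst \<xi>)"

lemma transported_eq: "transported f \<phi> x = accelerated f (\<phi> x)"
  by (simp add: transported_def accelerated_def fun_eq_iff)

lemma measurable_pair_vel [measurable (raw)]:
  "f \<in> borel_measurable M \<Longrightarrow> g \<in> borel_measurable M \<Longrightarrow> (\<lambda>x. (f x, g x :: real \<times> real) :: vel) \<in> borel_measurable M"
  by (rule borel_measurable_Pair)

lemma measurable_fall [measurable]: "fall a \<in> borel_measurable borel"
  unfolding fall_def[abs_def] by measurable

lemma measurable_accelerated [measurable]:
  assumes [measurable]: "f \<in> borel_measurable borel"
  shows "accelerated f a \<in> borel_measurable borel"
  unfolding accelerated_def[abs_def] by measurable

lemma accelerated_support: "0 \<le> a \<Longrightarrow> \<not> fst \<xi> < - sqrt (2 * a) \<Longrightarrow> accelerated f a \<xi> = 0"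
proof (cases "fst \<xi> < 0")
  case True
  assume "0 \<le> a" "\<not> fst \<xi> < - sqrt (2 * a)"
  then have "(- fst \<xi>)\<^sup>2 \<le> (sqrt (2 * a))\<^sup>2" using True by (intro power_mono) auto
  then show ?thesis using \<open>0 \<le> a\<close> by (simp add: accelerated_def)
qed (simp add: accelerated_def)

lemma accelerated_fall:
  assumes "0 \<le> a" "fst \<eta> < 0"
  shows "accelerated f a (fall a \<eta>) = f \<eta>"
proof -
  have "0 < (fst \<eta>)\<^sup>2 + 2 * a" using assms by (simp add: add_pos_nonneg)
  then have "(sqrt ((fst \<eta>)\<^sup>2 + 2 * a))\<^sup>2 = (fst \<eta>)\<^sup>2 + 2 * a" "0 < sqrt ((fst \<eta>)\<^sup>2 + 2 * a)" by simp_all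
  then show ?thesis using assms by (simp add: accelerated_def fall_def)
qed

text \<open>The substitution \<open>\<xi>\<^sub>1 = - sqrt (\<eta>\<^sup>2 + 2 a)\<close>, whose Jacobian is the speed ratio. The half-line is exhausted by the
  intervals \<open>[- n, 0]\<close>.\<close>

lemma fall_substitution_1d:
  fixes h :: "real \<Rightarrow> real"
  assumes [measurable]: "h \<in> borel_measurable borel" and h0: "\<And>x. 0 \<le> h x" and a: "0 \<le> a"
  shows "(\<integral>\<^sup>+x. ennreal (h x * indicator {..< - sqrt (2 * a)} x) \<partial>lborel)
    = (\<integral>\<^sup>+\<eta>. ennreal (h (- sqrt (\<eta>\<^sup>2 + 2 * a)) * speed_ratio a \<eta> * indicator {..<0} \<eta>) \<partial>lborel)"
proof (cases "a = 0")
  case True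
  then show ?thesis
    by (intro nn_integral_cong) (auto simp: speed_ratio_def indicator_def)
next
  case False
  then have a: "0 < a" using a by simp
  define g where "g \<eta> = - sqrt (\<eta>\<^sup>2 + 2 * a)" for \<eta>
  have pos: "0 < \<eta>\<^sup>2 + 2 * a" for \<eta> using a by (simp add: add_nonneg_pos)
  have dg: "(g has_real_derivative speed_ratio a \<eta>) (at \<eta>)" for \<eta>
  proof -
    have "((\<lambda>\<eta>. \<eta>\<^sup>2 + 2 * a) has_real_derivative 2 * \<eta>) (at \<eta>)" by (auto intro!: derivative_eq_intros)
    from DERIV_minus[OF DERIV_chain2[OF DERIV_real_sqrt[OF pos] this]] show ?thesis
      unfolding g_def speed_ratio_def by (simp add: field_simps)
  qed
  have ck: "continuous_on S (speed_ratio a)" for S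
    unfolding speed_ratio_def[abs_def] by (intro continuous_intros ballI) (use pos in \<open>simp add: less_imp_neq[symmetric]\<close>)
  have sub: "(\<integral>\<^sup>+x. ennreal (h x * indicator {g (- real n)..g 0} x) \<partial>lborel)
      = (\<integral>\<^sup>+\<eta>. ennreal (h (g \<eta>) * speed_ratio a \<eta> * indicator {- real n..0} \<eta>) \<partial>lborel)" for n
    by (rule nn_integral_substitution[where g = g and g' = "speed_ratio a"])
       (use dg ck pos in \<open>auto simp: speed_ratio_def set_borel_measurable_def divide_nonpos_pos intro!: divide_nonneg_nonneg\<close>)
  have lhs: "(\<lambda>n. \<integral>\<^sup>+x. ennreal (h x * indicator {g (- real n)..g 0} x) \<partial>lborel)
      \<longlonglongrightarrow> (\<integral>\<^sup>+x. ennreal (h x * indicator {..g 0} x) \<partial>lborel)"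
  proof (rule nn_integral_LIMSEQ)
    have gm: "g (- real n) \<le> g (- real m)" if "m \<le> n" for m n
      using that by (simp add: g_def power_mono)
    show "incseq (\<lambda>n x. ennreal (h x * indicator {g (- real n)..g 0} x))"
    proof (intro incseq_SucI le_funI ennreal_leI mult_left_mono h0)
      fix n x show "indicat_real {g (- real n)..g 0} x \<le> indicat_real {g (- real (Suc n))..g 0} x"
        using gm[of n "Suc n"] by (auto simp: indicator_def)
    qed
    show "(\<lambda>n. ennreal (h x * indicator {g (- real n)..g 0} x)) \<longlonglongrightarrow> ennreal (h x * indicator {..g 0} x)" for x
    proof (rule tendsto_eventually)
      obtain K :: nat where K: "\<bar>x\<bar> \<le> real K" using real_arch_simple by blast
      show "\<forall>\<^sub>F n in sequentially. ennreal (h x * indicator {g (- real n)..g 0} x) = ennreal (h x * indicator {..g 0} x)"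
        using eventually_ge_at_top[of K]
      proof eventually_elim
        case (elim n)
        have "\<bar>x\<bar> \<le> sqrt ((real n)\<^sup>2 + 2 * a)"
          using elim K a by (intro real_le_rsqrt) (smt (verit) of_nat_mono power2_abs power_mono abs_ge_zero)
        then have "g (- real n) \<le> x" by (auto simp: g_def)
        then show ?case by (auto simp: indicator_def)
      qed
    qed
  qed simp
  have rhs: "(\<lambda>n. \<integral>\<^sup>+\<eta>. ennreal (h (g \<eta>) * speed_ratio a \<eta> * indicator {- real n..0} \<eta>) \<partial>lborel)
      \<longlonglongrightarrow> (\<integral>\<^sup>+\<eta>. ennreal (h (g \<eta>) * speed_ratio a \<eta> * indicator {..0} \<eta>) \<partial>lborel)"
  proof (rule nn_integral_LIMSEQ)
    have k0: "0 \<le> speed_ratio a \<eta> * indicator {- real n..0} \<eta>" for n \<eta>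
      using pos[of \<eta>] by (auto simp: speed_ratio_def indicator_def intro!: divide_nonpos_nonneg)
    show "incseq (\<lambda>n \<eta>. ennreal (h (g \<eta>) * speed_ratio a \<eta> * indicator {- real n..0} \<eta>))"
    proof (intro incseq_SucI le_funI ennreal_leI)
      fix n \<eta>
      have "speed_ratio a \<eta> * indicator {- real n..0} \<eta> \<le> speed_ratio a \<eta> * indicator {- real (Suc n)..0} \<eta>"
        using k0[of \<eta> "Suc n"] by (auto simp: indicator_def)
      then have "h (g \<eta>) * (speed_ratio a \<eta> * indicator {- real n..0} \<eta>) \<le> h (g \<eta>) * (speed_ratio a \<eta> * indicator {- real (Suc n)..0} \<eta>)"
        by (rule mult_left_mono) (rule h0)
      then show "h (g \<eta>) * speed_ratio a \<eta> * indicator {- real n..0} \<eta> \<le> h (g \<eta>) * speed_ratio a \<eta> * indicator {- real (Suc n)..0} \<eta>"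
        by (simp only: mult.assoc)
    qed
    show "(\<lambda>n. ennreal (h (g x) * speed_ratio a x * indicator {- real n..0} x)) \<longlonglongrightarrow> ennreal (h (g x) * speed_ratio a x * indicator {..0} x)" for x
    proof (rule tendsto_eventually)
      obtain K :: nat where K: "\<bar>x\<bar> \<le> real K" using real_arch_simple by blast
      show "\<forall>\<^sub>F n in sequentially. ennreal (h (g x) * speed_ratio a x * indicator {- real n..0} x) = ennreal (h (g x) * speed_ratio a x * indicator {..0} x)"
        using eventually_ge_at_top[of K]
        by eventually_elim (use K in \<open>auto simp: indicator_def\<close>)
    qed
    show "(\<lambda>\<eta>. ennreal (h (g \<eta>) * speed_ratio a \<eta> * indicator {- real n..0} \<eta>)) \<in> borel_measurable lborel" for n
      unfolding g_def by measurable
  qed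
  have "(\<integral>\<^sup>+x. ennreal (h x * indicator {..g 0} x) \<partial>lborel)
     = (\<integral>\<^sup>+\<eta>. ennreal (h (g \<eta>) * speed_ratio a \<eta> * indicator {..0} \<eta>) \<partial>lborel)"
    using LIMSEQ_unique[OF lhs[unfolded sub] rhs] .
  moreover have "(\<integral>\<^sup>+x. ennreal (h x * indicator {..g 0} x) \<partial>lborel) = (\<integral>\<^sup>+x. ennreal (h x * indicator {..<g 0} x) \<partial>lborel)"
    by (rule nn_integral_cong_AE) (use AE_lborel_singleton[of "g 0"] in \<open>eventually_elim, auto simp: indicator_def\<close>)
  moreover have "(\<integral>\<^sup>+\<eta>. ennreal (h (g \<eta>) * speed_ratio a \<eta> * indicator {..0} \<eta>) \<partial>lborel) = (\<integral>\<^sup>+\<eta>. ennreal (h (g \<eta>) * speed_ratio a \<eta> * indicator {..<0} \<eta>) \<partial>lborel)"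
    by (rule nn_integral_cong_AE) (use AE_lborel_singleton[of "0::real"] in \<open>eventually_elim, auto simp: indicator_def\<close>)
  ultimately show ?thesis by (simp add: g_def)
qed

lemma nn_integral_vel:
  fixes H :: "vel \<Rightarrow> ennreal"
  assumes "H \<in> borel_measurable borel"
  shows "(\<integral>\<^sup>+\<xi>. H \<xi> \<partial>lborel) = (\<integral>\<^sup>+y. (\<integral>\<^sup>+x. H (x, y) \<partial>lborel) \<partial>lborel)"
  using lborel_pair.nn_integral_snd[of H] assms unfolding lborel_prod by simp

lemma fall_substitution_nn:
  fixes h :: "vel \<Rightarrow> real"
  assumes [measurable]: "h \<in> borel_measurable borel" and h0: "\<And>x. 0 \<le> h x" and a: "0 \<le> a"
  shows "(\<integral>\<^sup>+\<xi>. ennreal (h \<xi> * indicator {..< - sqrt (2 * a)} (fst \<xi>)) \<partial>lborel)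
    = (\<integral>\<^sup>+\<eta>. ennreal (h (fall a \<eta>) * speed_ratio a (fst \<eta>) * indicator {..<0} (fst \<eta>)) \<partial>lborel)"
proof -
  have m1: "(\<lambda>\<xi>::vel. ennreal (h \<xi> * indicator {..< - sqrt (2 * a)} (fst \<xi>))) \<in> borel_measurable borel"
    by measurable
  have m2: "(\<lambda>\<eta>. ennreal (h (fall a \<eta>) * speed_ratio a (fst \<eta>) * indicator {..<0} (fst \<eta>))) \<in> borel_measurable borel"
    by measurable
  show ?thesis
    unfolding nn_integral_vel[OF m1] nn_integral_vel[OF m2]
  proof (rule nn_integral_cong, goal_cases)
    case (1 y)
    have "(\<lambda>x. h (x, y)) \<in> borel_measurable borel" by measurable
    from fall_substitution_1d[OF this h0 a] show ?case by (simp add: fall_def)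
  qed
qed

text \<open>Outside \<open>\<eta>\<^sub>1 < 0\<close>, where no ions come from infinity, the Jacobian is set to \<open>0\<close>.\<close>

definition fall_jacobian :: "real \<Rightarrow> vel \<Rightarrow> real" where
  "fall_jacobian a \<eta> = speed_ratio a (fst \<eta>) * indicator {..<0} (fst \<eta>)"

lemma measurable_fall_jacobian [measurable]: "fall_jacobian a \<in> borel_measurable borel"
  unfolding fall_jacobian_def[abs_def] by measurable

lemma fall_jacobian_bounds: "0 \<le> a \<Longrightarrow> 0 \<le> fall_jacobian a \<eta>" "0 \<le> a \<Longrightarrow> fall_jacobian a \<eta> \<le> 1"
proof -
  show "0 \<le> fall_jacobian a \<eta>" if "0 \<le> a"
    using that by (auto simp: fall_jacobian_def speed_ratio_def indicator_def intro!: divide_nonpos_nonneg real_sqrt_ge_zero)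
  show "fall_jacobian a \<eta> \<le> 1" if "0 \<le> a"
    using speed_ratio_bound[OF that, of "fst \<eta>"] by (auto simp: fall_jacobian_def indicator_def)
qed

text \<open>As an identity between image measures, the substitution applies to Bochner integrals, and it transfers
  integrability in both directions.\<close>

lemma distr_fall:
  assumes a: "0 \<le> a"
  shows "distr (density lborel (\<lambda>\<eta>. ennreal (fall_jacobian a \<eta>))) borel (fall a)
    = density lborel (\<lambda>\<xi>. ennreal (indicator {..< - sqrt (2 * a)} (fst \<xi>)))"
proof (rule measure_eqI)
  fix A assume "A \<in> sets (distr (density lborel (\<lambda>\<eta>. ennreal (fall_jacobian a \<eta>))) borel (fall a))"
  then have A [measurable]: "A \<in> sets borel" by simp
  have "emeasure (distr (density lborel (\<lambda>\<eta>. ennreal (fall_jacobian a \<eta>))) borel (fall a)) A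
      = (\<integral>\<^sup>+\<eta>. ennreal (fall_jacobian a \<eta>) * indicator (fall a -` A) \<eta> \<partial>lborel)"
    using measurable_sets_borel[OF measurable_fall A]
    by (subst emeasure_distr, simp, simp, subst emeasure_density) auto
  also have "\<dots> = (\<integral>\<^sup>+\<eta>. ennreal (indicat_real A (fall a \<eta>) * speed_ratio a (fst \<eta>) * indicator {..<0} (fst \<eta>)) \<partial>lborel)"
    by (intro nn_integral_cong) (auto simp: fall_jacobian_def indicator_def)
  also have "\<dots> = (\<integral>\<^sup>+\<xi>. ennreal (indicat_real A \<xi> * indicator {..< - sqrt (2 * a)} (fst \<xi>)) \<partial>lborel)"
    by (rule fall_substitution_nn[symmetric]) (use a in auto)
  also have "\<dots> = emeasure (density lborel (\<lambda>\<xi>. ennreal (indicator {..< - sqrt (2 * a)} (fst \<xi>)))) A"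
    by (subst emeasure_density) (auto intro!: nn_integral_cong simp: indicator_def)
  finally show "emeasure (distr (density lborel (\<lambda>\<eta>. ennreal (fall_jacobian a \<eta>))) borel (fall a)) A
    = emeasure (density lborel (\<lambda>\<xi>. ennreal (indicator {..< - sqrt (2 * a)} (fst \<xi>)))) A" .
qed simp

lemma
  fixes g :: "vel \<Rightarrow> real"
  assumes [measurable]: "g \<in> borel_measurable borel" and a: "0 \<le> a"
  shows fall_substitution: "(LINT \<xi>|lborel. indicat_real {..< - sqrt (2 * a)} (fst \<xi>) * g \<xi>)
      = (LINT \<eta>|lborel. fall_jacobian a \<eta> * g (fall a \<eta>))"
    and fall_substitution_integrable: "integrable lborel (\<lambda>\<xi>. indicat_real {..< - sqrt (2 * a)} (fst \<xi>) * g \<xi>)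
      \<longleftrightarrow> integrable lborel (\<lambda>\<eta>. fall_jacobian a \<eta> * g (fall a \<eta>))"
proof -
  have "(LINT \<xi>|density lborel (\<lambda>\<xi>. ennreal (indicator {..< - sqrt (2 * a)} (fst \<xi>))). g \<xi>)
     = (LINT \<eta>|density lborel (\<lambda>\<eta>. ennreal (fall_jacobian a \<eta>)). g (fall a \<eta>))"
    unfolding distr_fall[OF a, symmetric] by (rule integral_distr) auto
  then show "(LINT \<xi>|lborel. indicat_real {..< - sqrt (2 * a)} (fst \<xi>) * g \<xi>)
      = (LINT \<eta>|lborel. fall_jacobian a \<eta> * g (fall a \<eta>))"
    using fall_jacobian_bounds[OF a] by (simp add: integral_density)
  have "integrable (density lborel (\<lambda>\<xi>. ennreal (indicator {..< - sqrt (2 * a)} (fst \<xi>)))) g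
     \<longleftrightarrow> integrable (density lborel (\<lambda>\<eta>. ennreal (fall_jacobian a \<eta>))) (\<lambda>\<eta>. g (fall a \<eta>))"
    unfolding distr_fall[OF a, symmetric] by (rule integrable_distr_eq) auto
  then show "integrable lborel (\<lambda>\<xi>. indicat_real {..< - sqrt (2 * a)} (fst \<xi>) * g \<xi>)
      \<longleftrightarrow> integrable lborel (\<lambda>\<eta>. fall_jacobian a \<eta> * g (fall a \<eta>))"
    using fall_jacobian_bounds[OF a] by (simp add: integrable_density)
qed

lemma
  fixes f W :: "vel \<Rightarrow> real"
  assumes [measurable]: "f \<in> borel_measurable borel" "W \<in> borel_measurable borel" and a: "0 \<le> a"
  shows accelerated_integral: "(LINT \<xi>|lborel. accelerated f a \<xi> * W \<xi>)
      = (LINT \<eta>|lborel. fall_jacobian a \<eta> * (f \<eta> * W (fall a \<eta>)))"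
    and accelerated_integrable_iff: "integrable lborel (\<lambda>\<xi>. accelerated f a \<xi> * W \<xi>)
      \<longleftrightarrow> integrable lborel (\<lambda>\<eta>. fall_jacobian a \<eta> * (f \<eta> * W (fall a \<eta>)))"
proof -
  have 1: "accelerated f a \<xi> * W \<xi> = indicat_real {..< - sqrt (2 * a)} (fst \<xi>) * (accelerated f a \<xi> * W \<xi>)" for \<xi>
    using accelerated_support[OF a, of \<xi> f] by (auto simp: indicator_def)
  have 2: "fall_jacobian a \<eta> * (f \<eta> * W (fall a \<eta>)) = fall_jacobian a \<eta> * (accelerated f a (fall a \<eta>) * W (fall a \<eta>))" for \<eta>
    using accelerated_fall[OF a, of \<eta> f] by (auto simp: fall_jacobian_def indicator_def)
  show "(LINT \<xi>|lborel. accelerated f a \<xi> * W \<xi>)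
      = (LINT \<eta>|lborel. fall_jacobian a \<eta> * (f \<eta> * W (fall a \<eta>)))"
    unfolding 2 by (subst 1, rule fall_substitution) (use a in auto)
  show "integrable lborel (\<lambda>\<xi>. accelerated f a \<xi> * W \<xi>)
      \<longleftrightarrow> integrable lborel (\<lambda>\<eta>. fall_jacobian a \<eta> * (f \<eta> * W (fall a \<eta>)))"
    unfolding 2 by (subst 1, rule fall_substitution_integrable) (use a in auto)
qed

lemma integrable_accelerated:
  assumes f: "integrable lborel f" and a: "0 \<le> a"
  shows "integrable lborel (accelerated f a)"
proof -
  have [measurable]: "f \<in> borel_measurable borel" using f by simp
  have "integrable lborel (\<lambda>\<eta>. fall_jacobian a \<eta> * (f \<eta> * 1))"
  proof (rule Bochner_Integration.integrable_bound[OF f])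
    show "AE \<eta> in lborel. norm (fall_jacobian a \<eta> * (f \<eta> * 1)) \<le> norm (f \<eta>)"
      using fall_jacobian_bounds[OF a] by (intro AE_I2) (simp add: abs_mult mult_left_le_one_le)
  qed simp
  then show ?thesis
    using accelerated_integrable_iff[of f "\<lambda>_. 1" a] a by simp
qed

lemma accelerated_abs_integral_le:
  assumes f: "integrable lborel f" and a: "0 \<le> a"
  shows "(LINT \<xi>|lborel. \<bar>accelerated f a \<xi>\<bar>) \<le> (LINT \<eta>|lborel. \<bar>f \<eta>\<bar>)"
proof -
  have [measurable]: "f \<in> borel_measurable borel" using f by simp
  have abs: "\<bar>accelerated f a \<xi>\<bar> = accelerated (\<lambda>\<eta>. \<bar>f \<eta>\<bar>) a \<xi> * 1" for \<xi>
    by (simp add: accelerated_def abs_mult)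
  have "(LINT \<xi>|lborel. \<bar>accelerated f a \<xi>\<bar>) = (LINT \<eta>|lborel. fall_jacobian a \<eta> * (\<bar>f \<eta>\<bar> * 1))"
    unfolding abs by (rule accelerated_integral) (use a in auto)
  also have "\<dots> \<le> (LINT \<eta>|lborel. \<bar>f \<eta>\<bar>)"
    by (rule integral_mono')
       (use f fall_jacobian_bounds[OF a] in \<open>auto simp: abs_mult mult_left_le_one_le\<close>)
  finally show ?thesis .
qed

lemma accelerated_diff: "accelerated f a \<xi> - accelerated g a \<xi> = accelerated (\<lambda>\<eta>. f \<eta> - g \<eta>) a \<xi>"
  by (simp add: accelerated_def algebra_simps)

lemma fall_jacobian_tendsto: "(\<lambda>n. fall_jacobian (a n) \<eta>) \<longlonglongrightarrow> fall_jacobian l \<eta>" if "a \<longlonglongrightarrow> l" "0 \<le> l"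
proof (cases "fst \<eta> < 0")
  case True
  then have "0 < (fst \<eta>)\<^sup>2 + 2 * l" using that by (simp add: add_pos_nonneg)
  then show ?thesis unfolding fall_jacobian_def speed_ratio_def
    by (intro tendsto_intros that) auto
qed (simp add: fall_jacobian_def)

lemma AE_fst_neq: "AE \<xi>::vel in lborel. fst \<xi> \<noteq> c"
proof -
  have "AE \<xi>::vel in (lborel \<Otimes>\<^sub>M lborel). fst \<xi> \<noteq> c"
  proof (rule lborel_pair.AE_pair_measure)
    show "{x \<in> space (lborel \<Otimes>\<^sub>M lborel). fst x \<noteq> c} \<in> sets (lborel \<Otimes>\<^sub>M (lborel :: (real \<times> real) measure))" by measurable
    show "AE x in lborel. AE y in lborel. fst (x, y) \<noteq> c"
      using AE_lborel_singleton[of c] by eventually_elim simp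
  qed
  then show ?thesis unfolding lborel_prod .
qed

text \<open>Transport does not increase the mean, so its continuity in \<open>a\<close> needs to be checked for continuous
  densities only; there the densities converge pointwise and their masses converge.\<close>

lemma accelerated_continuous_L1:
  assumes f: "integrable lborel f" and a: "\<And>n. 0 \<le> a n" and l: "0 \<le> l" and lim: "a \<longlonglongrightarrow> l"
  shows "(\<lambda>n. LINT \<xi>|lborel. \<bar>accelerated f (a n) \<xi> - accelerated f l \<xi>\<bar>) \<longlonglongrightarrow> 0"
proof -
  have cont: "(\<lambda>n. LINT \<xi>|lborel. \<bar>accelerated g (a n) \<xi> - accelerated g l \<xi>\<bar>) \<longlonglongrightarrow> 0"
    if cg: "continuous_on UNIV g" and g: "integrable lborel g" for g
  proof -
    have [measurable]: "g \<in> borel_measurable borel" using g by simp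
    have i: "integrable lborel (accelerated g b)" if "0 \<le> b" for b by (rule integrable_accelerated[OF g that])
    have n: "(\<integral>\<^sup>+ \<xi>. norm (accelerated g b \<xi>) \<partial>lborel) = ennreal (LINT \<eta>|lborel. fall_jacobian b \<eta> * \<bar>g \<eta>\<bar>)" if "0 \<le> b" for b
    proof -
      have abs: "\<bar>accelerated g b \<xi>\<bar> = accelerated (\<lambda>\<eta>. \<bar>g \<eta>\<bar>) b \<xi> * 1" for \<xi>
        by (simp add: accelerated_def abs_mult)
      have "(\<integral>\<^sup>+ \<xi>. norm (accelerated g b \<xi>) \<partial>lborel) = ennreal (LINT \<xi>|lborel. \<bar>accelerated g b \<xi>\<bar>)"
        using nn_integral_eq_integral[of lborel "\<lambda>\<xi>. \<bar>accelerated g b \<xi>\<bar>"] i[OF that] by simp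
      also have "(LINT \<xi>|lborel. \<bar>accelerated g b \<xi>\<bar>) = (LINT \<eta>|lborel. fall_jacobian b \<eta> * (\<bar>g \<eta>\<bar> * 1))"
        unfolding abs by (rule accelerated_integral) (use that in auto)
      finally show ?thesis by simp
    qed
    have masses: "(\<lambda>n. LINT \<eta>|lborel. fall_jacobian (a n) \<eta> * \<bar>g \<eta>\<bar>) \<longlonglongrightarrow> (LINT \<eta>|lborel. fall_jacobian l \<eta> * \<bar>g \<eta>\<bar>)"
    proof (rule integral_dominated_convergence[where w = "\<lambda>\<eta>. \<bar>g \<eta>\<bar>"])
      show "AE \<eta> in lborel. (\<lambda>n. fall_jacobian (a n) \<eta> * \<bar>g \<eta>\<bar>) \<longlonglongrightarrow> fall_jacobian l \<eta> * \<bar>g \<eta>\<bar>"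
        by (intro AE_I2 tendsto_intros fall_jacobian_tendsto lim l)
      show "AE \<eta> in lborel. norm (fall_jacobian (a n) \<eta> * \<bar>g \<eta>\<bar>) \<le> \<bar>g \<eta>\<bar>" for n
        using fall_jacobian_bounds[OF a] by (intro AE_I2) (simp add: abs_mult mult_left_le_one_le)
    qed (use g in auto)
    have "(\<lambda>n. \<integral>\<^sup>+ \<xi>. norm (accelerated g (a n) \<xi> - accelerated g l \<xi>) \<partial>lborel) \<longlonglongrightarrow> 0"
    proof (rule Scheffe_lemma1)
      show "integrable lborel (accelerated g (a n))" "integrable lborel (accelerated g l)" for n
        using i a l by auto
      show "AE \<xi> in lborel. (\<lambda>n. accelerated g (a n) \<xi>) \<longlonglongrightarrow> accelerated g l \<xi>"
        using AE_fst_neq[of "sqrt (2 * l)"] AE_fst_neq[of "- sqrt (2 * l)"]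
      proof eventually_elim
        case (elim \<xi>)
        have ne: "(fst \<xi>)\<^sup>2 \<noteq> 2 * l"
        proof
          assume "(fst \<xi>)\<^sup>2 = 2 * l"
          then have "sqrt (2 * l) = \<bar>fst \<xi>\<bar>" by (metis real_sqrt_abs)
          then show False using elim by linarith
        qed
        have d: "(\<lambda>n. (fst \<xi>)\<^sup>2 - 2 * a n) \<longlonglongrightarrow> (fst \<xi>)\<^sup>2 - 2 * l" by (intro tendsto_intros lim)
        have "(\<lambda>n. indicat_real {0<..} ((fst \<xi>)\<^sup>2 - 2 * a n)) \<longlonglongrightarrow> indicat_real {0<..} ((fst \<xi>)\<^sup>2 - 2 * l)"
        proof (cases "0 < (fst \<xi>)\<^sup>2 - 2 * l")
          case True
          show ?thesis using order_tendstoD(1)[OF d True] True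
            by (intro tendsto_eventually) (auto elim!: eventually_mono)
        next
          case False
          then have "(fst \<xi>)\<^sup>2 - 2 * l < 0" using ne by simp
          from order_tendstoD(2)[OF d this] show ?thesis using False
            by (intro tendsto_eventually) (auto elim!: eventually_mono)
        qed
        moreover have "(\<lambda>n. g (- sqrt ((fst \<xi>)\<^sup>2 - 2 * a n), snd \<xi>)) \<longlonglongrightarrow> g (- sqrt ((fst \<xi>)\<^sup>2 - 2 * l), snd \<xi>)"
          by (rule continuous_on_tendsto_compose[OF cg]) (auto intro!: tendsto_intros lim)
        ultimately show ?case unfolding accelerated_def by (intro tendsto_intros)
      qed
      have "(\<lambda>n. \<integral>\<^sup>+ \<xi>. norm (accelerated g (a n) \<xi>) \<partial>lborel) \<longlonglongrightarrow> (\<integral>\<^sup>+ \<xi>. norm (accelerated g l \<xi>) \<partial>lborel)"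
        unfolding n[OF a] n[OF l] by (intro tendsto_ennrealI masses)
      then show "limsup (\<lambda>n. \<integral>\<^sup>+ \<xi>. norm (accelerated g (a n) \<xi>) \<partial>lborel) \<le> (\<integral>\<^sup>+ \<xi>. norm (accelerated g l \<xi>) \<partial>lborel)"
        by (simp add: lim_imp_Limsup)
    qed
    moreover have "(\<integral>\<^sup>+ \<xi>. norm (accelerated g (a n) \<xi> - accelerated g l \<xi>) \<partial>lborel)
        = ennreal (LINT \<xi>|lborel. \<bar>accelerated g (a n) \<xi> - accelerated g l \<xi>\<bar>)" for n
      using nn_integral_eq_integral[of lborel "\<lambda>\<xi>. \<bar>accelerated g (a n) \<xi> - accelerated g l \<xi>\<bar>"] i[OF a[of n]] i[OF l] by simp
    ultimately have "(\<lambda>n. ennreal (LINT \<xi>|lborel. \<bar>accelerated g (a n) \<xi> - accelerated g l \<xi>\<bar>)) \<longlonglongrightarrow> ennreal 0"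
      by simp
    then show ?thesis by (rule tendsto_ennrealD) (auto intro!: Bochner_Integration.integral_nonneg)
  qed
  show ?thesis
  proof (rule LIMSEQ_I)
    fix e :: real assume e: "0 < e"
    then obtain g where cg: "continuous_on UNIV g" and g: "integrable lborel g"
      and fg: "(LINT x|lborel. \<bar>f x - g x\<bar>) < e / 3"
      using integrable_approx_continuous[OF f, of "e/3"] by auto
    obtain N where N: "\<And>n. N \<le> n \<Longrightarrow> (LINT \<xi>|lborel. \<bar>accelerated g (a n) \<xi> - accelerated g l \<xi>\<bar>) < e / 3"
      using LIMSEQ_D[OF cont[OF cg g], of "e/3"] e by (auto simp: integral_nonneg)
    have "norm ((LINT \<xi>|lborel. \<bar>accelerated f (a n) \<xi> - accelerated f l \<xi>\<bar>) - 0) < e" if n: "N \<le> n" for n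
    proof -
      have i: "integrable lborel (accelerated u b)" if "integrable lborel u" "0 \<le> b" for u b
        by (rule integrable_accelerated[OF that])
      have near: "(LINT \<xi>|lborel. \<bar>accelerated f b \<xi> - accelerated g b \<xi>\<bar>) < e / 3" if "0 \<le> b" for b
        unfolding accelerated_diff
        using accelerated_abs_integral_le[OF Bochner_Integration.integrable_diff[OF f g] that] fg by simp
      have "(LINT \<xi>|lborel. \<bar>accelerated f (a n) \<xi> - accelerated f l \<xi>\<bar>)
        \<le> (LINT \<xi>|lborel. \<bar>accelerated f (a n) \<xi> - accelerated g (a n) \<xi>\<bar> +
             (\<bar>accelerated g (a n) \<xi> - accelerated g l \<xi>\<bar> + \<bar>accelerated f l \<xi> - accelerated g l \<xi>\<bar>))"
        by (rule integral_mono) (use i f g a l in auto)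
      also have "\<dots> = (LINT \<xi>|lborel. \<bar>accelerated f (a n) \<xi> - accelerated g (a n) \<xi>\<bar>) +
           ((LINT \<xi>|lborel. \<bar>accelerated g (a n) \<xi> - accelerated g l \<xi>\<bar>) + (LINT \<xi>|lborel. \<bar>accelerated f l \<xi> - accelerated g l \<xi>\<bar>))"
        using i[OF f a] i[OF g a] i[OF f l] i[OF g l] by simp
      also have "\<dots> < e" using near[OF a[of n]] near[OF l] N[OF n] by simp
      finally show ?thesis by (simp add: integral_nonneg)
    qed
    then show "\<exists>N. \<forall>n\<ge>N. norm ((LINT \<xi>|lborel. \<bar>accelerated f (a n) \<xi> - accelerated f l \<xi>\<bar>) - 0) < e" by blast
  qed
qed

section \<open>Slices of a locally integrable density\<close>

lemma measurable_lebesgue: "g \<in> borel_measurable borel \<Longrightarrow> g \<in> borel_measurable lebesgue"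
  by (rule measurable_completion) simp

lemma C_L1_weight:
  assumes f: "C_L1 f" and W: "\<And>\<xi>. continuous_on {0..} (\<lambda>x. W x \<xi>)"
    and Wm: "\<And>x. 0 \<le> x \<Longrightarrow> W x \<in> borel_measurable borel"
    and bd: "\<And>x \<xi>. 0 \<le> x \<Longrightarrow> \<bar>W x \<xi>\<bar> \<le> C"
  shows "continuous_on {0..} (\<lambda>x. LINT \<xi>|lebesgue. f x \<xi> * W x \<xi>)"
  unfolding continuous_on_sequentially
proof (intro allI ballI impI, elim conjE)
  fix x :: "nat \<Rightarrow> real" and a assume x: "\<forall>n. x n \<in> {0..}" and a: "a \<in> {0..}" and lim: "x \<longlonglongrightarrow> a"
  have "continuous (at a within {0..}) (\<lambda>y. LINT \<xi>|lebesgue. \<bar>f y \<xi> - f a \<xi>\<bar>)"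
    using f a unfolding C_L1_def continuous_within by simp
  from continuous_within_tendsto_compose'[OF this _ lim]
  have c: "(\<lambda>n. LINT \<xi>|lebesgue. \<bar>f (x n) \<xi> - f a \<xi>\<bar>) \<longlonglongrightarrow> 0" using x by simp
  have "(\<lambda>n. LINT \<xi>|lebesgue. f (x n) \<xi> * W (x n) \<xi>) \<longlonglongrightarrow> (LINT \<xi>|lebesgue. f a \<xi> * W a \<xi>)"
  proof (rule tendsto_integral_mult_weight[OF _ _ c, where C = C])
    show "integrable lebesgue (f (x n))" "integrable lebesgue (f a)" for n
      using f x a unfolding C_L1_def by auto
    show "W (x n) \<in> borel_measurable lebesgue" "W a \<in> borel_measurable lebesgue" for n
      using Wm x a by (auto intro!: measurable_completion)
    show "AE \<xi> in lebesgue. (\<lambda>n. W (x n) \<xi>) \<longlonglongrightarrow> W a \<xi>"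
      by (intro AE_I2 continuous_on_tendsto_compose[OF W lim]) (use x a in auto)
    show "AE \<xi> in lebesgue. \<bar>W (x n) \<xi>\<bar> \<le> C" for n
      using bd x by auto
  qed
  then show "((\<lambda>x. LINT \<xi>|lebesgue. f x \<xi> * W x \<xi>) \<circ> x) \<longlonglongrightarrow> (LINT \<xi>|lebesgue. f a \<xi> * W a \<xi>)"
    by (simp add: o_def)
qed

text \<open>For a continuous weight with compact support, the integral over \<open>(0, \<infinity>) \<times> \<real>\<^sup>3\<close> is the iterated integral of
  the slices that the continuity in mean provides at every position.\<close>

lemma
  fixes f G :: "real \<Rightarrow> vel \<Rightarrow> real"
  assumes f: "L1_loc f" and f_C: "C_L1 f"
    and cG: "continuous_on ({0..} \<times> UNIV) (\<lambda>(x, \<xi>). G x \<xi>)"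
    and out: "\<And>x \<xi>. 0 \<le> x \<Longrightarrow> \<not> (x \<le> X \<and> \<xi> \<in> cball 0 R) \<Longrightarrow> G x \<xi> = 0"
  shows slice_continuous: "continuous_on {0..} (\<lambda>x. LINT \<xi>|lebesgue. f x \<xi> * G x \<xi>)"
    and slice_integrable: "\<And>x. 0 \<le> x \<Longrightarrow> integrable lebesgue (\<lambda>\<xi>. f x \<xi> * G x \<xi>)"
    and slice_bounded: "\<exists>C. \<forall>x\<ge>0. \<forall>\<xi>. \<bar>G x \<xi>\<bar> \<le> C"
    and slice_measurable: "\<And>x. 0 \<le> x \<Longrightarrow> G x \<in> borel_measurable borel"
    and slice_Fubini: "(LINT (x, \<xi>) : {0<..} \<times> UNIV | lebesgue. f x \<xi> * G x \<xi>)
      = (LINT x|lborel. indicat_real {0..X} x * (LINT \<xi>|lebesgue. f x \<xi> * G x \<xi>))"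
proof -
  have fi: "integrable lebesgue (f x)" if "0 \<le> x" for x using f_C that by (simp add: C_L1_def)
  have "compact ((\<lambda>(x, \<xi>). G x \<xi>) ` ({0..X} \<times> cball 0 R))"
    by (rule compact_continuous_image[OF continuous_on_subset[OF cG]]) (auto intro: compact_Times)
  then have "bounded ((\<lambda>(x, \<xi>). G x \<xi>) ` ({0..X} \<times> cball 0 R))" by (rule compact_imp_bounded)
  then obtain C where C: "0 < C" "\<forall>y\<in>(\<lambda>(x, \<xi>). G x \<xi>) ` ({0..X} \<times> cball 0 R). norm y \<le> C"
    unfolding bounded_pos by blast
  have GC: "\<bar>G x \<xi>\<bar> \<le> C" if "0 \<le> x" for x \<xi>
  proof (cases "x \<le> X \<and> \<xi> \<in> cball 0 R")
    case True
    then have "(x, \<xi>) \<in> {0..X} \<times> cball 0 R" using that by simp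
    from C(2)[rule_format, OF imageI[OF this]] show ?thesis by simp
  qed (use out[OF that] C in simp)
  then show "\<exists>C. \<forall>x\<ge>0. \<forall>\<xi>. \<bar>G x \<xi>\<bar> \<le> C" by blast
  show Gm: "G x \<in> borel_measurable borel" if "0 \<le> x" for x
  proof (rule borel_measurable_continuous_onI)
    have "continuous_on UNIV (\<lambda>\<xi>. (\<lambda>(x, \<xi>). G x \<xi>) (x, \<xi>))"
      by (rule continuous_on_compose2[OF cG]) (use that in \<open>auto intro!: continuous_intros\<close>)
    then show "continuous_on UNIV (G x)" by simp
  qed
  have Gx: "continuous_on {0..} (\<lambda>x. G x \<xi>)" for \<xi>
  proof -
    have "continuous_on {0..} (\<lambda>x. (\<lambda>(x, \<xi>). G x \<xi>) (x, \<xi>))"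
      by (rule continuous_on_compose2[OF cG]) (auto intro!: continuous_intros)
    then show ?thesis by simp
  qed
  show H: "continuous_on {0..} (\<lambda>x. LINT \<xi>|lebesgue. f x \<xi> * G x \<xi>)"
    by (rule C_L1_weight[OF f_C Gx Gm GC])
  show "integrable lebesgue (\<lambda>\<xi>. f x \<xi> * G x \<xi>)" if x: "0 \<le> x" for x
  proof (rule Bochner_Integration.integrable_bound[of _ "\<lambda>\<xi>. C * f x \<xi>"])
    show "(\<lambda>\<xi>. f x \<xi> * G x \<xi>) \<in> borel_measurable lebesgue"
      using fi[OF x] measurable_lebesgue[OF Gm[OF x]] by (intro borel_measurable_times) auto
    show "AE \<xi> in lebesgue. norm (f x \<xi> * G x \<xi>) \<le> norm (C * f x \<xi>)"
      unfolding real_norm_def by (intro AE_I2 abs_mult_le_if GC x)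
  qed (use fi[OF x] in simp)
  define K where "K = {0..X} \<times> cball (0::vel) R"
  have "compact K" unfolding K_def by (intro compact_Times) auto
  then have Kb [measurable]: "K \<in> sets borel" by (simp add: borel_compact)
  define P where "P z = indicat_real K z * f (fst z) (snd z)" for z
  have "set_integrable lebesgue K (\<lambda>(x, \<xi>). f x \<xi>)"
    using f \<open>compact K\<close> unfolding L1_loc_def K_def by auto
  then have Pi: "integrable lebesgue P"
    unfolding set_integrable_def P_def by (simp add: case_prod_beta)
  then have "P \<in> borel_measurable (completion lborel)" by simp
  then obtain P' where P' [measurable]: "P' \<in> borel_measurable lborel" and PP': "AE z in lborel. P z = P' z"
    using completion_ex_borel_measurable_real by blast
  have PP'l: "AE z in lebesgue. P z = P' z" using PP' by (rule AE_completion)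
  have P'l: "P' \<in> borel_measurable lebesgue" by (rule measurable_completion) simp
  have "integrable lebesgue P'"
    using Pi by (rule integrable_cong_AE_imp) (use PP'l P'l in \<open>auto elim: eventually_mono\<close>)
  then have P'i: "integrable lborel P'" using integrable_completion[of P' lborel] P' by simp
  define Gk where "Gk z = indicat_real K z * G (fst z) (snd z)" for z
  have "continuous_on K (\<lambda>z. G (fst z) (snd z))"
    by (rule continuous_on_subset[OF cG[unfolded case_prod_beta]]) (auto simp: K_def)
  from borel_measurable_continuous_on_indicator[OF Kb this]
  have Gkm [measurable]: "Gk \<in> borel_measurable borel" unfolding Gk_def[abs_def] by simp
  have GkC: "\<bar>Gk z\<bar> \<le> C" for z using GC[of "fst z" "snd z"] C(1) by (auto simp: Gk_def K_def indicator_def)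
  define Q where "Q z = indicat_real ({0<..} \<times> UNIV) z * (P' z * Gk z)" for z :: "real \<times> vel"
  have pos_m [measurable]: "({0<..} \<times> UNIV :: (real \<times> vel) set) \<in> sets borel"
    by (intro borel_open open_Times) auto
  have Qm [measurable]: "Q \<in> borel_measurable borel" unfolding Q_def[abs_def] using P' by measurable
  have Qi: "integrable lborel Q"
  proof (rule Bochner_Integration.integrable_bound[of _ "\<lambda>z. C * P' z"])
    show "AE z in lborel. norm (Q z) \<le> norm (C * P' z)"
    proof (rule AE_I2)
      fix z
      have "\<bar>Q z\<bar> \<le> \<bar>P' z * Gk z\<bar>" by (auto simp: Q_def indicator_def)
      also have "\<dots> \<le> \<bar>C * P' z\<bar>" by (rule abs_mult_le_if[OF GkC])
      finally show "norm (Q z) \<le> norm (C * P' z)" by simp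
    qed
  qed (use P'i in auto)
  have "(LINT (x, \<xi>) : {0<..} \<times> UNIV | lebesgue. f x \<xi> * G x \<xi>)
      = (LINT z | lebesgue. indicat_real ({0<..} \<times> UNIV) z * (P z * Gk z))"
    unfolding set_lebesgue_integral_def
  proof (rule Bochner_Integration.integral_cong[OF refl])
    fix z :: "real \<times> vel"
    obtain x \<xi> where z: "z = (x, \<xi>)" by (cases z)
    show "indicat_real ({0<..} \<times> UNIV) z *\<^sub>R (case z of (x, \<xi>) \<Rightarrow> f x \<xi> * G x \<xi>)
       = indicat_real ({0<..} \<times> UNIV) z * (P z * Gk z)"
      using out[of x \<xi>] by (auto simp: z P_def Gk_def K_def indicator_def)
  qed
  also have "\<dots> = (LINT z | lebesgue. Q z)"
  proof (rule integral_cong_AE)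
    have "Gk \<in> borel_measurable lebesgue" "indicat_real ({0<..} \<times> UNIV :: (real \<times> vel) set) \<in> borel_measurable lebesgue"
      by (rule measurable_completion, simp)+
    then show "(\<lambda>z. indicat_real ({0<..} \<times> UNIV) z * (P z * Gk z)) \<in> borel_measurable lebesgue"
      using Pi by (intro borel_measurable_times) auto
    show "Q \<in> borel_measurable lebesgue" by (rule measurable_completion) simp
    show "AE z in lebesgue. indicat_real ({0<..} \<times> UNIV) z * (P z * Gk z) = Q z"
      using PP'l by eventually_elim (simp add: Q_def)
  qed
  also have "\<dots> = (LINT z | lborel. Q z)" by (rule integral_completion) simp
  also have "\<dots> = (LINT x | lborel. LINT \<xi> | lborel. Q (x, \<xi>))"
    using lborel_pair.integral_fst'[of Q] Qi unfolding lborel_prod by simp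
  also have "\<dots> = (LINT x | lborel. indicat_real {0..X} x * (LINT \<xi>|lebesgue. f x \<xi> * G x \<xi>))"
  proof (rule integral_cong_AE)
    have "Q \<in> borel_measurable (lborel \<Otimes>\<^sub>M lborel)" unfolding lborel_prod by simp
    then show "(\<lambda>x. LINT \<xi> | lborel. Q (x, \<xi>)) \<in> borel_measurable lborel"
      by (intro lborel.borel_measurable_lebesgue_integral) simp
    show "(\<lambda>x. indicat_real {0..X} x * (LINT \<xi>|lebesgue. f x \<xi> * G x \<xi>)) \<in> borel_measurable lborel"
      using borel_measurable_continuous_on_indicator[OF _ continuous_on_subset[OF H], of "{0..X}"] by simp
    have "AE z in lborel \<Otimes>\<^sub>M lborel. P z = P' z" unfolding lborel_prod by (rule PP')
    from lborel_pair.AE_pair[OF this] have "AE x in lborel. AE \<xi> in lborel. P (x, \<xi>) = P' (x, \<xi>)" .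
    then show "AE x in lborel. (LINT \<xi> | lborel. Q (x, \<xi>)) = indicat_real {0..X} x * (LINT \<xi>|lebesgue. f x \<xi> * G x \<xi>)"
      using AE_lborel_singleton[of "0::real"]
    proof eventually_elim
      case (elim x)
      show ?case
      proof (cases "0 < x \<and> x \<le> X")
        case True
        have Gx: "G x \<xi> = Gk (x, \<xi>)" for \<xi>
          using out[of x \<xi>] True by (auto simp: Gk_def K_def indicator_def)
        have Qx [measurable]: "(\<lambda>\<xi>. Q (x, \<xi>)) \<in> borel_measurable borel" by measurable
        have "(\<lambda>\<xi>. Gk (x, \<xi>)) \<in> borel_measurable borel" by measurable
        then have Gxm: "(\<lambda>\<xi>. Gk (x, \<xi>)) \<in> borel_measurable lebesgue" by (intro measurable_completion) simp
        have "(LINT \<xi> | lborel. Q (x, \<xi>)) = (LINT \<xi> | lebesgue. Q (x, \<xi>))"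
          by (rule integral_completion[symmetric]) simp
        also have "\<dots> = (LINT \<xi>|lebesgue. f x \<xi> * G x \<xi>)"
        proof (rule integral_cong_AE)
          show "(\<lambda>\<xi>. Q (x, \<xi>)) \<in> borel_measurable lebesgue" by (rule measurable_completion) simp
          show "(\<lambda>\<xi>. f x \<xi> * G x \<xi>) \<in> borel_measurable lebesgue"
            unfolding Gx using fi[of x] True Gxm by (intro borel_measurable_times) auto
          show "AE \<xi> in lebesgue. Q (x, \<xi>) = f x \<xi> * G x \<xi>"
            using AE_completion[OF elim(1)]
          proof eventually_elim
            case (elim \<xi>)
            show ?case
            proof (cases "(x, \<xi>) \<in> K")
              case True
              then have "P' (x, \<xi>) = f x \<xi>" using elim by (simp add: P_def)
              then show ?thesis using \<open>0 < x \<and> x \<le> X\<close> by (simp add: Q_def Gx)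
            next
              case False
              then have "Gk (x, \<xi>) = 0" by (simp add: Gk_def)
              then show ?thesis by (simp add: Q_def Gx)
            qed
          qed
        qed
        finally show ?thesis using True by simp
      next
        case False
        then have "x \<notin> {0..X}" "\<And>\<xi>. Q (x, \<xi>) = 0" using elim
          by (auto simp: Q_def Gk_def K_def indicator_def)
        then show ?thesis by simp
      qed
    qed
  qed
  finally show "(LINT (x, \<xi>) : {0<..} \<times> UNIV | lebesgue. f x \<xi> * G x \<xi>)
      = (LINT x|lborel. indicat_real {0..X} x * (LINT \<xi>|lebesgue. f x \<xi> * G x \<xi>))" .
qed

text \<open>The positive and the negative part of \<open>h\<close> are densities of two measures that agree on boxes, hence everywhere.\<close>

lemma AE_zero_if_box_integrals_zero:
  fixes h :: "'a::euclidean_space \<Rightarrow> real"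
  assumes [measurable]: "h \<in> borel_measurable borel"
    and i: "\<And>l u. integrable lborel (\<lambda>x. h x * indicat_real (box l u) x)"
    and z: "\<And>l u. (LINT x|lborel. h x * indicat_real (box l u) x) = 0"
  shows "AE x in lborel. h x = 0"
proof -
  define p where "p s x = ennreal (s * h x)" for s x
  have [measurable]: "p s \<in> borel_measurable borel" for s unfolding p_def by measurable
  have em: "emeasure (density lborel (p s)) (box l u) = ennreal (LINT x|lborel. max 0 (s * (h x * indicat_real (box l u) x)))" for s l u
  proof -
    have "emeasure (density lborel (p s)) (box l u) = (\<integral>\<^sup>+x. ennreal (max 0 (s * (h x * indicat_real (box l u) x))) \<partial>lborel)"
      by (subst emeasure_density) (auto intro!: nn_integral_cong simp: p_def indicator_def max_def ennreal_neg)
    also have "\<dots> = ennreal (LINT x|lborel. max 0 (s * (h x * indicat_real (box l u) x)))"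
      by (rule nn_integral_eq_integral) (use i[of l u] in auto)
    finally show ?thesis .
  qed
  have "density lborel (p 1) = density lborel (p (-1))"
  proof (rule measure_eqI_generator_eq[where E = "range (\<lambda>(l, u). box l u)" and \<Omega> = UNIV and A = "\<lambda>n. box (- real n *\<^sub>R One) (real n *\<^sub>R One)"])
    show "Int_stable (range (\<lambda>(l, u). box l u :: 'a set))"
      by (auto simp: Int_stable_def box_Int_box)
    show "emeasure (density lborel (p 1)) X = emeasure (density lborel (p (-1))) X"
      if X_in: "X \<in> range (\<lambda>(l, u). box l u :: 'a set)" for X
    proof -
      obtain l u where X: "X = box l u" using X_in by (auto simp: image_iff)
      define k where "k x = h x * indicat_real (box l u) x" for x
      have ki: "integrable lborel k" and kz: "(LINT x|lborel. k x) = 0" using i[of l u] z[of l u] by (simp_all add: k_def[abs_def])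
      have "(LINT x|lborel. k x) = (LINT x|lborel. max 0 (1 * k x) - max 0 (-1 * k x))"
        by (intro Bochner_Integration.integral_cong) auto
      also have "\<dots> = (LINT x|lborel. max 0 (1 * k x)) - (LINT x|lborel. max 0 (-1 * k x))"
        by (rule Bochner_Integration.integral_diff) (use ki in auto)
      finally show ?thesis unfolding X em using kz by (simp add: k_def)
    qed
    show "sets (density lborel (p 1)) = sigma_sets UNIV (range (\<lambda>(l, u). box l u :: 'a set))"
      "sets (density lborel (p (-1))) = sigma_sets UNIV (range (\<lambda>(l, u). box l u :: 'a set))"
      by (simp_all add: borel_eq_box)
    show "(\<Union>n::nat. box (- real n *\<^sub>R One) (real n *\<^sub>R One)) = (UNIV :: 'a set)"
      by (simp add: UN_box_eq_UNIV)
    show "emeasure (density lborel (p 1)) (box (- real n *\<^sub>R One) (real n *\<^sub>R One)) \<noteq> \<infinity>" for n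
      unfolding em by simp
  qed auto
  then have "AE x in lborel. p 1 x = p (-1) x"
    by (subst (asm) sigma_finite_measure.density_unique_iff[OF sigma_finite_lborel]) auto
  then show ?thesis
  proof eventually_elim
    case (elim x)
    show ?case
    proof (rule ccontr)
      assume "h x \<noteq> 0"
      then show False using elim by (cases "h x > 0") (auto simp: p_def ennreal_neg ennreal_eq_0_iff)
    qed
  qed
qed

section \<open>Test functions adapted to the energy\<close>

definition bump :: "real \<Rightarrow> real \<Rightarrow> real \<Rightarrow> real \<Rightarrow> real" where
  "bump n a b t = soft_step (n * (t - a)) * soft_step (n * (b - t))"

definition bump' :: "real \<Rightarrow> real \<Rightarrow> real \<Rightarrow> real \<Rightarrow> real" where
  "bump' n a b t = n * soft_step' (n * (t - a)) * soft_step (n * (b - t)) -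
     n * soft_step (n * (t - a)) * soft_step' (n * (b - t))"

lemma bump_DERIV: "(bump n a b has_real_derivative bump' n a b t) (at t)"
proof -
  have 1: "((\<lambda>t. soft_step (n * (t - a))) has_real_derivative soft_step' (n * (t - a)) * n) (at t)"
    by (rule DERIV_chain2[OF soft_step_DERIV]) (auto intro!: derivative_eq_intros)
  have 2: "((\<lambda>t. soft_step (n * (b - t))) has_real_derivative soft_step' (n * (b - t)) * (- n)) (at t)"
    by (rule DERIV_chain2[OF soft_step_DERIV]) (auto intro!: derivative_eq_intros)
  show ?thesis unfolding bump_def[abs_def] bump'_def
    using DERIV_mult[OF 1 2] by (simp add: algebra_simps)
qed

lemma continuous_on_bump': "continuous_on S (bump' n a b)"
  unfolding bump'_def[abs_def]
  by (intro continuous_intros continuous_on_compose2[OF continuous_on_soft_step[of UNIV]]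
      continuous_on_compose2[OF continuous_on_soft_step'[of UNIV]]) auto

lemma continuous_on_bump: "continuous_on S (bump n a b)"
  by (meson DERIV_isCont continuous_at_imp_continuous_on bump_DERIV)

lemma bump_nonneg: "0 \<le> bump n a b t" and bump_le_1: "bump n a b t \<le> 1"
  by (auto simp: bump_def soft_step_nonneg soft_step_le_1 intro!: mult_nonneg_nonneg mult_le_one)

lemma bump_pos: "0 < n \<Longrightarrow> a < t \<Longrightarrow> t < b \<Longrightarrow> 0 < bump n a b t"
  by (auto simp: bump_def intro!: mult_pos_pos soft_step_pos)

lemma bump_zero: "0 \<le> n \<Longrightarrow> t \<notin> {a<..<b} \<Longrightarrow> bump n a b t = 0"
  by (auto simp: bump_def not_less mult_nonneg_nonpos intro!: soft_step_zero)

lemma bump_tendsto: "(\<lambda>n. bump (real n) a b t) \<longlonglongrightarrow> indicat_real {a<..<b} t"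
proof -
  have "(\<lambda>n. bump (real n) a b t) \<longlonglongrightarrow> indicat_real {0<..} (t - a) * indicat_real {0<..} (b - t)"
    unfolding bump_def by (intro tendsto_mult soft_step_tendsto)
  moreover have "indicat_real {0<..} (t - a) * indicat_real {0<..} (b - t) = indicat_real {a<..<b} t"
    by (auto simp: indicator_def)
  ultimately show ?thesis by simp
qed

text \<open>A \<open>C\<^sup>1\<close> cut-off in the invariants of the flow: the energy at potential \<open>p\<close> and \<open>\<xi>'\<close>.\<close>

definition window :: "real \<Rightarrow> real \<Rightarrow> real \<Rightarrow> real \<times> real \<Rightarrow> real \<times> real \<Rightarrow> real \<Rightarrow> vel \<Rightarrow> real" where
  "window n a b l u p \<xi> = bump n a b ((fst \<xi>)\<^sup>2 / 2 - p) *
     (bump n (fst l) (fst u) (fst (snd \<xi>)) * bump n (snd l) (snd u) (snd (snd \<xi>)))"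

text \<open>The derivative of the cut-off with respect to the energy.\<close>

definition window' :: "real \<Rightarrow> real \<Rightarrow> real \<Rightarrow> real \<times> real \<Rightarrow> real \<times> real \<Rightarrow> real \<Rightarrow> vel \<Rightarrow> real" where
  "window' n a b l u p \<xi> = bump' n a b ((fst \<xi>)\<^sup>2 / 2 - p) *
     (bump n (fst l) (fst u) (fst (snd \<xi>)) * bump n (snd l) (snd u) (snd (snd \<xi>)))"

lemma window_DERIV_potential:
  assumes "(g has_real_derivative g') (at t)"
  shows "((\<lambda>t. window n a b l u (g t) \<xi>) has_real_derivative - window' n a b l u (g t) \<xi> * g') (at t)"
proof -
  have "((\<lambda>t. (fst \<xi>)\<^sup>2 / 2 - g t) has_real_derivative - g') (at t)"
    by (auto intro!: derivative_eq_intros assms)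
  from DERIV_cmult_right[OF DERIV_chain2[OF bump_DERIV this]] show ?thesis
    unfolding window_def window'_def by (rule DERIV_cong) simp
qed

lemma window_DERIV_speed:
  "((\<lambda>s. window n a b l u p (s, snd \<xi>)) has_real_derivative window' n a b l u p \<xi> * fst \<xi>) (at (fst \<xi>))"
proof -
  have "((\<lambda>s. s\<^sup>2 / 2 - p) has_real_derivative fst \<xi>) (at (fst \<xi>))"
    by (auto intro!: derivative_eq_intros)
  from DERIV_cmult_right[OF DERIV_chain2[OF bump_DERIV this]] show ?thesis
    unfolding window_def window'_def fst_conv snd_conv by (rule DERIV_cong) simp
qed

lemma continuous_on_window [continuous_intros]:
  "continuous_on S p \<Longrightarrow> continuous_on S v \<Longrightarrow> continuous_on S (\<lambda>z. window n a b l u (p z) (v z))"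
  unfolding window_def by (intro continuous_intros continuous_on_compose2[OF continuous_on_bump[of UNIV]]) auto

lemma C1_on_window:
  assumes p: "C1_on S p" and v: "C1_on S v"
  shows "C1_on S (\<lambda>z. window n a b l u (p z) (v z))"
proof -
  have bump: "C1_on S (\<lambda>z. bump n c d (g z))" if "C1_on S g" for c d g
    by (rule C1_on_compose[where T = UNIV, OF that C1_on_real[OF bump_DERIV continuous_on_bump']]) simp
  have square: "C1_on UNIV (\<lambda>t::real. t\<^sup>2 / 2)"
    by (rule C1_on_real[where g' = "\<lambda>t. t"]) (auto intro!: derivative_eq_intros continuous_intros)
  have lin: "C1_on S (\<lambda>z. h (v z))" if "bounded_linear h" for h :: "vel \<Rightarrow> real"
    by (rule C1_on_linear_compose[OF that v])
  show ?thesis unfolding window_def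
    by (intro C1_on_mult bump C1_on_diff p C1_on_compose[OF _ square] lin bounded_linear_fst_comp
        bounded_linear_snd_comp bounded_linear_fst bounded_linear_snd bounded_linear_ident) auto
qed

lemma measurable_window [measurable]: "window n a b l u p \<in> borel_measurable borel"
  by (intro borel_measurable_continuous_onI continuous_intros)

lemma window_bounds: "0 \<le> window n a b l u p \<xi>" "window n a b l u p \<xi> \<le> 1"
  by (auto simp: window_def bump_nonneg bump_le_1 intro!: mult_nonneg_nonneg mult_le_one)

lemma window_support:
  assumes "0 \<le> n" and "window n a b l u p \<xi> \<noteq> 0"
  shows "(fst \<xi>)\<^sup>2 / 2 - p \<in> {a<..<b}" and "fst (snd \<xi>) \<in> {fst l<..<fst u}" and "snd (snd \<xi>) \<in> {snd l<..<snd u}"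
  using assms bump_zero[OF assms(1)] unfolding window_def by (metis mult_eq_0_iff)+

lemma window_speed:
  assumes "0 \<le> n" and "window n a b l u p \<xi> \<noteq> 0" and "p \<le> p'"
  shows "\<bar>fst \<xi>\<bar> \<le> sqrt (2 * (\<bar>b\<bar> + p'))"
proof -
  have "(fst \<xi>)\<^sup>2 / 2 - p < b" using window_support(1)[OF assms(1,2)] by simp
  then have "(fst \<xi>)\<^sup>2 \<le> 2 * (b + p)" by (simp add: field_simps)
  also have "\<dots> \<le> 2 * (\<bar>b\<bar> + p')" using assms(3) by (intro mult_left_mono add_mono) auto
  finally have "(fst \<xi>)\<^sup>2 \<le> 2 * (\<bar>b\<bar> + p')" .
  then show ?thesis by (metis real_le_rsqrt power2_abs)
qed

lemma window_flux_bound: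
  assumes "0 \<le> n" and "p \<le> p'" and "0 \<le> p'"
  shows "\<bar>fst \<xi> * window n a b l u p \<xi>\<bar> \<le> sqrt (2 * (\<bar>b\<bar> + p'))"
proof (cases "window n a b l u p \<xi> = 0")
  case False
  have "\<bar>fst \<xi>\<bar> * \<bar>window n a b l u p \<xi>\<bar> \<le> sqrt (2 * (\<bar>b\<bar> + p')) * 1"
    using window_speed[OF assms(1) False assms(2)] window_bounds[of n a b l u p \<xi>] assms(3)
    by (intro mult_mono) auto
  then show ?thesis by (simp add: abs_mult)
qed (use assms in simp)

section \<open>Every solution is transported from infinity\<close>

locale given_solution = far_field +
  fixes \<phi>\<^sub>b :: real and f :: "real \<Rightarrow> vel \<Rightarrow> real" and \<phi> :: "real \<Rightarrow> real"
  assumes \<phi>\<^sub>b_pos: "0 < \<phi>\<^sub>b" and sol: "VP_solution n\<^sub>e 0 (\<lambda>_. 0) \<phi>\<^sub>b F f \<phi>"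
begin

lemma
  shows f_L1_loc: "L1_loc f" and f_C_L1: "C_L1 f" and \<phi>_C1: "C1_on {0..} \<phi>" and \<phi>_C2: "C2_on {0<..} \<phi>"
    and f_nonneg: "\<And>x. 0 \<le> x \<Longrightarrow> AE \<xi> in lebesgue. 0 \<le> f x \<xi>"
    and Dx_sign: "(\<forall>x\<ge>0. Dx \<phi> x > 0) \<or> (\<forall>x\<ge>0. Dx \<phi> x < 0)"
    and weak: "weak_Vlasov 0 (\<lambda>_. 0) f \<phi>"
    and f_limit: "((\<lambda>x. LINT \<xi>|lebesgue. \<bar>f x \<xi> - F \<xi>\<bar>) \<longlongrightarrow> 0) at_top"
    and Poisson: "\<And>x. 0 < x \<Longrightarrow> Dx (Dx \<phi>) x = (LINT \<xi>|lebesgue. f x \<xi>) - n\<^sub>e (\<phi> x)"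
    and \<phi>_0: "\<phi> 0 = \<phi>\<^sub>b" and \<phi>_limit: "(\<phi> \<longlongrightarrow> 0) at_top"
  using sol unfolding VP_solution_def by auto

lemma f_integrable: "0 \<le> x \<Longrightarrow> integrable lebesgue (f x)"
  using f_C_L1 unfolding C_L1_def by blast

lemma \<phi>_deriv: "0 \<le> x \<Longrightarrow> (\<phi> has_real_derivative Dx \<phi> x) (at x within {0..})"
  and continuous_on_Dx\<phi>: "continuous_on {0..} (Dx \<phi>)"
  using C1_on_half_line[OF \<phi>_C1] by auto

lemma continuous_on_\<phi>: "continuous_on {0..} \<phi>"
  by (rule C1_on_imp_continuous[OF \<phi>_C1])

text \<open>The potential falls from a positive value to \<open>0\<close>, which excludes the increasing alternative.\<close>

lemma Dx_\<phi>_neg: "0 \<le> x \<Longrightarrow> Dx \<phi> x < 0"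
proof -
  have False if pos: "\<And>x. 0 \<le> x \<Longrightarrow> Dx \<phi> x > 0"
  proof -
    have "- \<phi> y < - \<phi> x" if "0 \<le> x" "x < y" for x y
      by (rule strictly_decreasing_half_line[of "\<lambda>x. - \<phi> x" "\<lambda>x. - Dx \<phi> x", OF _ _ that])
         (use pos in \<open>auto intro!: DERIV_minus \<phi>_deriv\<close>)
    moreover have "((\<lambda>x. - \<phi> x) \<longlongrightarrow> 0) at_top" using tendsto_minus[OF \<phi>_limit] by simp
    ultimately have "0 < - \<phi> 0" using decreasing_to_0_pos[of "\<lambda>x. - \<phi> x" 0] by blast
    then show False using \<phi>_0 \<phi>\<^sub>b_pos by simp
  qed
  then show "Dx \<phi> x < 0" if "0 \<le> x" using Dx_sign that by blast
qed

lemma \<phi>_decreasing: "0 \<le> x \<Longrightarrow> x < y \<Longrightarrow> \<phi> y < \<phi> x"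
  by (rule strictly_decreasing_half_line[OF \<phi>_deriv Dx_\<phi>_neg])

lemma \<phi>_pos: "0 \<le> x \<Longrightarrow> 0 < \<phi> x"
  by (rule decreasing_to_0_pos[OF \<phi>_decreasing \<phi>_limit])

lemma \<phi>_le: "0 \<le> x \<Longrightarrow> \<phi> x \<le> \<phi>\<^sub>b"
  using \<phi>_decreasing[of 0 x] \<phi>_0 by (cases "x = 0") auto

text \<open>The energy \<open>\<xi>\<^sub>1\<^sup>2 / 2 - \<phi>\<close> and \<open>\<xi>'\<close> are invariants of the flow, so the Vlasov operator only
  differentiates the factors \<open>\<theta> (x)\<close> and \<open>\<kappa> (\<xi>\<^sub>1)\<close>. The condition \<open>wall\<close> is the boundary condition of the test functions
  for \<open>\<alpha> = 0\<close>: they vanish where ions leave through the wall.\<close>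

lemma weak_product:
  fixes \<theta> \<theta>' \<kappa> \<kappa>' :: "real \<Rightarrow> real" and a b n :: real and l u :: "real \<times> real"
  assumes \<theta>: "\<And>t. 0 \<le> t \<Longrightarrow> (\<theta> has_real_derivative \<theta>' t) (at t within {0..})" and c\<theta>: "continuous_on {0..} \<theta>'"
    and \<kappa>: "\<And>t. (\<kappa> has_real_derivative \<kappa>' t) (at t)" and c\<kappa>: "continuous_on UNIV \<kappa>'"
    and \<theta>0: "\<And>t. X \<le> t \<Longrightarrow> \<theta> t = 0" and \<theta>'0: "\<And>t. X < t \<Longrightarrow> \<theta>' t = 0" and n: "0 \<le> n"
    and wall: "\<theta> 0 = 0 \<or> (\<forall>s<0. \<kappa> s = 0)"
  defines "G \<equiv> \<lambda>x \<xi>. (fst \<xi> * \<theta>' x * \<kappa> (fst \<xi>) + Dx \<phi> x * \<theta> x * \<kappa>' (fst \<xi>)) * window n a b l u (\<phi> x) \<xi>"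
  shows "continuous_on {0..} (\<lambda>x. LINT \<xi>|lebesgue. f x \<xi> * G x \<xi>)"
    and "integral {0..X} (\<lambda>x. LINT \<xi>|lebesgue. f x \<xi> * G x \<xi>) = 0"
    and "\<And>x. 0 \<le> x \<Longrightarrow> integrable lebesgue (\<lambda>\<xi>. f x \<xi> * G x \<xi>)"
proof -
  define \<psi> where "\<psi> x \<xi> = \<theta> x * (\<kappa> (fst \<xi>) * window n a b l u (\<phi> x) \<xi>)" for x and \<xi> :: vel
  have c\<kappa>0: "continuous_on UNIV \<kappa>" using \<kappa> by (meson DERIV_isCont continuous_at_imp_continuous_on)
  have ct: "continuous_on {0..} \<theta>" by (rule DERIV_continuous_on[OF \<theta>]) simp
  define \<rho> where "\<rho> = sqrt (2 * (\<bar>b\<bar> + \<phi>\<^sub>b)) + (\<bar>fst l\<bar> + \<bar>fst u\<bar> + (\<bar>snd l\<bar> + \<bar>snd u\<bar>))"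
  have inball: "\<xi> \<in> cball 0 \<rho>" if "0 \<le> x" and nz: "window n a b l u (\<phi> x) \<xi> \<noteq> 0" for x \<xi>
  proof -
    have "\<bar>fst \<xi>\<bar> \<le> sqrt (2 * (\<bar>b\<bar> + \<phi>\<^sub>b))" by (rule window_speed[OF n nz \<phi>_le[OF that(1)]])
    moreover have "\<bar>fst (snd \<xi>)\<bar> \<le> \<bar>fst l\<bar> + \<bar>fst u\<bar>" "\<bar>snd (snd \<xi>)\<bar> \<le> \<bar>snd l\<bar> + \<bar>snd u\<bar>"
      using window_support(2,3)[OF n nz] by auto
    moreover have "norm \<xi> \<le> \<bar>fst \<xi>\<bar> + norm (snd \<xi>)" using norm_Pair_le[of "fst \<xi>" "snd \<xi>"] by simp
    moreover have "norm (snd \<xi>) \<le> \<bar>fst (snd \<xi>)\<bar> + \<bar>snd (snd \<xi>)\<bar>"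
      using norm_Pair_le[of "fst (snd \<xi>)" "snd (snd \<xi>)"] by simp
    ultimately show ?thesis by (simp add: \<rho>_def)
  qed
  have out: "G x \<xi> = 0" if "0 \<le> x" "\<not> (x \<le> X \<and> \<xi> \<in> cball 0 \<rho>)" for x \<xi>
    using inball[OF that(1), of \<xi>] \<theta>0[of x] \<theta>'0[of x] that(2) unfolding G_def by fastforce
  have fst_half: "(\<lambda>z::real \<times> vel. fst z) ` ({0..} \<times> UNIV) \<subseteq> {0..}" by auto
  have lin: "C1_on S (\<lambda>z::real \<times> vel. fst z)" "C1_on S (\<lambda>z::real \<times> vel. snd z)" "C1_on S (\<lambda>z::real \<times> vel. fst (snd z))" for S
    by (intro C1_on_bounded_linear bounded_linear_fst_comp bounded_linear_fst bounded_linear_snd)+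
  have "C1_on UNIV \<kappa>" by (rule C1_on_real[OF \<kappa> c\<kappa>])
  then have C1\<psi>: "C1_on ({0..} \<times> UNIV) (\<lambda>(x, \<xi>). \<psi> x \<xi>)"
    unfolding \<psi>_def case_prod_beta
    by (intro C1_on_mult C1_on_window C1_on_compose[OF lin(1) C1_on_real[OF \<theta> c\<theta>] fst_half]
        C1_on_compose[OF lin(3)] C1_on_compose[OF lin(1) \<phi>_C1 fst_half] lin(2)) auto
  have test: "\<psi> \<in> test_functions 0"
    unfolding test_functions_def
  proof (intro CollectI conjI C1\<psi>)
    have "{(x, \<xi>). 0 \<le> x \<and> \<psi> x \<xi> \<noteq> 0} \<subseteq> {0..X} \<times> cball 0 \<rho>"
    proof safe
      fix x :: real and a b c :: real assume "0 \<le> x" "\<psi> x (a, b, c) \<noteq> 0"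
      then have "\<theta> x \<noteq> 0" "(a, b, c) \<in> cball 0 \<rho>" using inball[of x "(a, b, c)"] by (auto simp: \<psi>_def)
      then show "x \<in> {0..X}" "(a, b, c) \<in> cball 0 \<rho>" using \<theta>0[of x] \<open>0 \<le> x\<close> by force+
    qed
    then have "bounded {(x, \<xi>). 0 \<le> x \<and> \<psi> x \<xi> \<noteq> 0}"
      by (rule bounded_subset[rotated]) (intro bounded_Times, auto)
    then show "compact (closure {(x, \<xi>). 0 \<le> x \<and> \<psi> x \<xi> \<noteq> 0})" by simp
    show "\<forall>\<xi>\<^sub>1>0. \<forall>\<xi>'. 0 * \<psi> 0 (\<xi>\<^sub>1, \<xi>') = \<psi> 0 (- \<xi>\<^sub>1, \<xi>')"
      using wall by (auto simp: \<psi>_def)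
  qed
  have op: "fst \<xi> * partial_x \<psi> x \<xi> + Dx \<phi> x * partial_xi1 \<psi> x \<xi> = G x \<xi>" if x: "0 < x" for x \<xi>
  proof -
    let ?w = "window n a b l u (\<phi> x) \<xi>" and ?w' = "window' n a b l u (\<phi> x) \<xi>"
    have d\<theta>: "(\<theta> has_real_derivative \<theta>' x) (at x)" using \<theta>[of x] x at_within_half_line[OF x] by simp
    have d\<phi>: "(\<phi> has_real_derivative Dx \<phi> x) (at x)" using \<phi>_deriv[of x] x at_within_half_line[OF x] by simp
    from DERIV_mult[OF d\<theta> DERIV_cmult[OF window_DERIV_potential[OF d\<phi>], of "\<kappa> (fst \<xi>)"]]
    have px: "partial_x \<psi> x \<xi> = \<theta>' x * (\<kappa> (fst \<xi>) * ?w) + \<theta> x * (\<kappa> (fst \<xi>) * (- ?w' * Dx \<phi> x))"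
      unfolding partial_x_def \<psi>_def by (intro DERIV_imp_deriv) (simp add: algebra_simps)
    from DERIV_cmult[OF DERIV_mult[OF \<kappa> window_DERIV_speed], of "\<theta> x"]
    have pxi: "partial_xi1 \<psi> x \<xi> = \<theta> x * (\<kappa>' (fst \<xi>) * ?w + \<kappa> (fst \<xi>) * (?w' * fst \<xi>))"
      unfolding partial_xi1_def \<psi>_def by (intro DERIV_imp_deriv) (simp add: algebra_simps)
    show ?thesis unfolding px pxi G_def by (simp add: algebra_simps)
  qed
  have cG: "continuous_on ({0..} \<times> UNIV) (\<lambda>(x, \<xi>). G x \<xi>)"
    unfolding G_def case_prod_beta
    by (intro continuous_intros continuous_on_compose2[OF c\<theta>] continuous_on_compose2[OF ct] continuous_on_compose2[OF c\<kappa>]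
        continuous_on_compose2[OF c\<kappa>0] continuous_on_compose2[OF continuous_on_Dx\<phi>] continuous_on_compose2[OF continuous_on_\<phi>]) auto
  show H: "continuous_on {0..} (\<lambda>x. LINT \<xi>|lebesgue. f x \<xi> * G x \<xi>)"
    by (rule slice_continuous[OF f_L1_loc f_C_L1 cG out])
  show "integrable lebesgue (\<lambda>\<xi>. f x \<xi> * G x \<xi>)" if "0 \<le> x" for x
    by (rule slice_integrable[OF f_L1_loc f_C_L1 cG out that])
  have "(LINT (x, \<xi>) : {0<..} \<times> UNIV | lebesgue. f x \<xi> * (fst \<xi> * partial_x \<psi> x \<xi> + Dx \<phi> x * partial_xi1 \<psi> x \<xi>)) = 0"
    using weak test unfolding weak_Vlasov_def by (simp add: set_lebesgue_integral_def)
  moreover have "(LINT (x, \<xi>) : {0<..} \<times> UNIV | lebesgue. f x \<xi> * (fst \<xi> * partial_x \<psi> x \<xi> + Dx \<phi> x * partial_xi1 \<psi> x \<xi>))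
     = (LINT (x, \<xi>) : {0<..} \<times> UNIV | lebesgue. f x \<xi> * G x \<xi>)"
    unfolding set_lebesgue_integral_def
  proof (rule Bochner_Integration.integral_cong[OF refl])
    fix z :: "real \<times> vel"
    show "indicat_real ({0<..} \<times> UNIV) z *\<^sub>R (case z of (x, \<xi>) \<Rightarrow> f x \<xi> * (fst \<xi> * partial_x \<psi> x \<xi> + Dx \<phi> x * partial_xi1 \<psi> x \<xi>))
      = indicat_real ({0<..} \<times> UNIV) z *\<^sub>R (case z of (x, \<xi>) \<Rightarrow> f x \<xi> * G x \<xi>)"
      using op[of "fst z" "snd z"] by (simp add: case_prod_beta indicator_def mem_Times_iff)
  qed
  moreover have "\<dots> = (LINT x|lborel. indicat_real {0..X} x * (LINT \<xi>|lebesgue. f x \<xi> * G x \<xi>))"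
    by (rule slice_Fubini[OF f_L1_loc f_C_L1 cG out])
  moreover have "\<dots> = integral {0..X} (\<lambda>x. LINT \<xi>|lebesgue. f x \<xi> * G x \<xi>)"
    using set_borel_integral_eq_integral(2)[OF borel_integrable_atLeastAtMost'[OF continuous_on_subset[OF H]], of 0 X]
    by (simp add: set_lebesgue_integral_def)
  ultimately show "integral {0..X} (\<lambda>x. LINT \<xi>|lebesgue. f x \<xi> * G x \<xi>) = 0" by simp
qed

text \<open>No ions enter at the wall. A test function that decreases along every trajectory with \<open>\<xi>\<^sub>1 > 0\<close>
  turns this into the vanishing of the integral of a nonnegative function.\<close>

lemma f_zero_outgoing:
  assumes "0 \<le> x"
  shows "AE \<xi> in lebesgue. 0 < fst \<xi> \<longrightarrow> f x \<xi> = 0"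
proof -
  have *: "AE \<xi> in lebesgue. x < real n \<and> 0 < fst \<xi> \<and> (fst \<xi>)\<^sup>2 / 2 - \<phi> x < real n \<and> \<bar>fst (snd \<xi>)\<bar> < real n \<and>
      \<bar>snd (snd \<xi>)\<bar> < real n \<longrightarrow> f x \<xi> = 0" for n :: nat
  proof (cases "x < real n")
    case True
    define \<theta> where "\<theta> t = soft_step (real n - t)" for t
    define \<theta>' where "\<theta>' t = - soft_step' (real n - t)" for t
    \<comment> \<open>The energy is at least \<open>- \<phi>\<^sub>b\<close>, so the lower end of the energy window is not attained.\<close>
    let ?w = "window 1 (- \<phi>\<^sub>b - 1) (real n) (- real n, - real n) (real n, real n)"
    define G where "G x \<xi> = (fst \<xi> * \<theta>' x * soft_step (fst \<xi>) + Dx \<phi> x * \<theta> x * soft_step' (fst \<xi>)) * ?w (\<phi> x) \<xi>"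
      for x and \<xi> :: vel
    have "(\<theta> has_real_derivative \<theta>' t) (at t)" for t
    proof -
      have "((\<lambda>t. real n - t) has_real_derivative -1) (at t)" by (auto intro!: derivative_eq_intros)
      from DERIV_chain2[OF soft_step_DERIV this] show ?thesis unfolding \<theta>_def[abs_def] \<theta>'_def by simp
    qed
    then have d\<theta>: "\<And>t. 0 \<le> t \<Longrightarrow> (\<theta> has_real_derivative \<theta>' t) (at t within {0..})"
      by (blast intro: has_field_derivative_at_within)
    have c\<theta>': "continuous_on {0..} \<theta>'"
      unfolding \<theta>'_def by (intro continuous_intros continuous_on_compose2[OF continuous_on_soft_step'[of UNIV]]) auto
    have \<theta>0: "\<theta> t = 0" if "real n \<le> t" for t using that by (simp add: \<theta>_def soft_step_zero)
    have \<theta>'0: "\<theta>' t = 0" if "real n < t" for t using that by (simp add: \<theta>'_def soft_step'_zero)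
    have wall: "\<theta> 0 = 0 \<or> (\<forall>s<0. soft_step s = 0)" by (simp add: soft_step_zero)
    note wp = weak_product[where X = "real n" and \<theta> = \<theta> and n = 1 and a = "- \<phi>\<^sub>b - 1" and b = "real n"
        and l = "(- real n, - real n)" and u = "(real n, real n)",
        OF d\<theta> c\<theta>' soft_step_DERIV continuous_on_soft_step' \<theta>0 \<theta>'0 zero_le_one wall, folded G_def]
    have cH: "continuous_on {0..} (\<lambda>x. LINT \<xi>|lebesgue. f x \<xi> * G x \<xi>)"
      and iH: "integral {0..real n} (\<lambda>x. LINT \<xi>|lebesgue. f x \<xi> * G x \<xi>) = 0"
      and fG: "\<And>x. 0 \<le> x \<Longrightarrow> integrable lebesgue (\<lambda>\<xi>. f x \<xi> * G x \<xi>)"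
      using wp by blast+
    have fac: "fst \<xi> * \<theta>' y * soft_step (fst \<xi>) \<le> 0" "Dx \<phi> y * \<theta> y * soft_step' (fst \<xi>) \<le> 0" if "0 \<le> y" for y and \<xi> :: vel
    proof -
      show "fst \<xi> * \<theta>' y * soft_step (fst \<xi>) \<le> 0"
      proof (cases "0 < fst \<xi>")
        case True
        then have "0 \<le> fst \<xi> * soft_step' (real n - y) * soft_step (fst \<xi>)"
          by (intro mult_nonneg_nonneg soft_step_nonneg soft_step'_nonneg) auto
        then show ?thesis by (simp add: \<theta>'_def)
      qed (simp add: soft_step_zero)
      have "0 \<le> (- Dx \<phi> y) * \<theta> y * soft_step' (fst \<xi>)"
        unfolding \<theta>_def using Dx_\<phi>_neg[OF that]
        by (intro mult_nonneg_nonneg soft_step_nonneg soft_step'_nonneg) auto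
      then show "Dx \<phi> y * \<theta> y * soft_step' (fst \<xi>) \<le> 0" by simp
    qed
    have Gle: "G y \<xi> \<le> 0" if "0 \<le> y" for y \<xi>
      unfolding G_def by (rule mult_nonpos_nonneg[OF add_nonpos_nonpos window_bounds(1)]) (use fac[OF that] in auto)
    have "AE \<xi> in lebesgue. 0 \<le> - (f y \<xi> * G y \<xi>)" if "0 \<le> y" for y
      using f_nonneg[OF that] by eventually_elim (use Gle[OF that] in \<open>simp add: mult_nonneg_nonpos\<close>)
    note AEneg = this
    define h where "h y = (LINT \<xi>|lebesgue. - (f y \<xi> * G y \<xi>))" for y
    have h0: "0 \<le> h y" if "0 \<le> y" for y
      unfolding h_def by (rule integral_nonneg_AE[OF AEneg[OF that]])
    have h_eq: "h y = - (LINT \<xi>|lebesgue. f y \<xi> * G y \<xi>)" for y by (simp add: h_def)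
    have "0 < real n" using True assms by linarith
    have "integral {0..real n} h = 0" unfolding h_eq using iH by simp
    moreover have "continuous_on {0..real n} h"
      unfolding h_eq by (intro continuous_intros continuous_on_subset[OF cH]) auto
    ultimately have "h x = 0"
      using integral_eq_0_iff[of 0 "real n" h] \<open>0 < real n\<close> h0 True assms by auto
    then have "AE \<xi> in lebesgue. - (f x \<xi> * G x \<xi>) = 0"
      unfolding h_def using integral_nonneg_eq_0_iff_AE[OF _ AEneg[OF assms]] fG[OF assms] by simp
    then show ?thesis
    proof eventually_elim
      case (elim \<xi>)
      show ?case
      proof
        assume a: "x < real n \<and> 0 < fst \<xi> \<and> (fst \<xi>)\<^sup>2 / 2 - \<phi> x < real n \<and> \<bar>fst (snd \<xi>)\<bar> < real n \<and> \<bar>snd (snd \<xi>)\<bar> < real n"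
        have "fst \<xi> * \<theta>' x * soft_step (fst \<xi>) < 0"
          using a soft_step'_pos[of "real n - x"] soft_step_pos[of "fst \<xi>"]
          by (simp add: \<theta>'_def mult_pos_neg mult_neg_pos)
        then have "fst \<xi> * \<theta>' x * soft_step (fst \<xi>) + Dx \<phi> x * \<theta> x * soft_step' (fst \<xi>) < 0"
          using fac(2)[OF assms, of \<xi>] by simp
        moreover have "0 < ?w (\<phi> x) \<xi>"
        proof -
          have "- \<phi>\<^sub>b - 1 < (fst \<xi>)\<^sup>2 / 2 - \<phi> x" using \<phi>_le[OF assms] zero_le_power2[of "fst \<xi>"] by linarith
          then show ?thesis unfolding window_def using a by (intro mult_pos_pos bump_pos) auto
        qed
        ultimately have "G x \<xi> < 0" unfolding G_def by (rule mult_neg_pos)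
        then show "f x \<xi> = 0" using elim by simp
      qed
    qed
  qed auto
  then have "AE \<xi> in lebesgue. \<forall>n::nat. x < real n \<and> 0 < fst \<xi> \<and> (fst \<xi>)\<^sup>2 / 2 - \<phi> x < real n \<and> \<bar>fst (snd \<xi>)\<bar> < real n \<and>
      \<bar>snd (snd \<xi>)\<bar> < real n \<longrightarrow> f x \<xi> = 0"
    by (subst AE_all_countable) simp
  then show ?thesis
  proof eventually_elim
    case (elim \<xi>)
    obtain n :: nat where "x + \<bar>(fst \<xi>)\<^sup>2 / 2 - \<phi> x\<bar> + \<bar>fst (snd \<xi>)\<bar> + \<bar>snd (snd \<xi>)\<bar> < real n"
      using reals_Archimedean2 by blast
    moreover from this have "x < real n" "(fst \<xi>)\<^sup>2 / 2 - \<phi> x < real n" "\<bar>fst (snd \<xi>)\<bar> < real n" "\<bar>snd (snd \<xi>)\<bar> < real n"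
      using assms by linarith+
    ultimately show ?case using elim by blast
  qed
qed

end

context far_field begin

lemma fall_jacobian_F: "fall_jacobian a \<eta> * (F \<eta> * c) = F \<eta> * speed_ratio a (fst \<eta>) * c"
  using F_zero[of \<eta>] by (cases "0 \<le> fst \<eta>") (auto simp: fall_jacobian_def)

lemma accelerated_mass:
  assumes a: "0 \<le> a"
  shows "(LINT \<xi>|lborel. accelerated F a \<xi>) = rho_i F a"
  using accelerated_integral[of F "\<lambda>_. 1" a] a
  by (simp only: fall_jacobian_F) (simp add: rho_i_lborel)

text \<open>The flux factor \<open>\<xi>\<^sub>1\<close> cancels the Jacobian, so the fluxes do not depend on the potential \<open>p\<close>.\<close>

lemma accelerated_flux:
  assumes a: "0 \<le> p"
  shows "(LINT \<xi>|lborel. accelerated F p \<xi> * (fst \<xi> * window n a b l u p \<xi>))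
    = (LINT \<eta>|lborel. F \<eta> * (fst \<eta> * window n a b l u 0 \<eta>))"
proof -
  have "(LINT \<xi>|lborel. accelerated F p \<xi> * (fst \<xi> * window n a b l u p \<xi>))
    = (LINT \<eta>|lborel. fall_jacobian p \<eta> * (F \<eta> * (fst (fall p \<eta>) * window n a b l u p (fall p \<eta>))))"
    by (rule accelerated_integral) (use a in measurable)
  also have "\<dots> = (LINT \<eta>|lborel. F \<eta> * (fst \<eta> * window n a b l u 0 \<eta>))"
  proof (rule Bochner_Integration.integral_cong[OF refl])
    fix \<eta> :: vel
    show "fall_jacobian p \<eta> * (F \<eta> * (fst (fall p \<eta>) * window n a b l u p (fall p \<eta>))) = F \<eta> * (fst \<eta> * window n a b l u 0 \<eta>)"
    proof (cases "0 \<le> fst \<eta>")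
      case False
      then have q: "0 < (fst \<eta>)\<^sup>2 + 2 * p" using a by (simp add: add_pos_nonneg)
      then have "(fst (fall p \<eta>))\<^sup>2 / 2 - p = (fst \<eta>)\<^sup>2 / 2 - 0" by (simp add: fall_def field_simps)
      moreover have "snd (fall p \<eta>) = snd \<eta>" by (simp add: fall_def)
      ultimately have "window n a b l u p (fall p \<eta>) = window n a b l u 0 \<eta>" by (simp only: window_def)
      moreover have "fall_jacobian p \<eta> * fst (fall p \<eta>) = fst \<eta>"
        using q False by (simp add: fall_jacobian_def fall_def speed_ratio_def)
      moreover have "fall_jacobian p \<eta> * (F \<eta> * (fst (fall p \<eta>) * z)) = F \<eta> * ((fall_jacobian p \<eta> * fst (fall p \<eta>)) * z)" for z
        by (simp only: ac_simps)
      ultimately show ?thesis by (simp only:)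
    qed (simp add: F_zero)
  qed
  finally show ?thesis .
qed

end

context given_solution begin

text \<open>With \<open>\<kappa> = 1\<close> the weak equation says that the flux \<open>M\<close> through a window is orthogonal to \<open>\<theta>'\<close> for all \<open>\<theta>\<close> with
  compact support and \<open>\<theta>(0) = 0\<close>. By the du Bois-Reymond lemma \<open>M\<close> is constant, and its value is read off at infinity.\<close>

lemma flux_constant:
  assumes n: "0 \<le> n" and x: "0 \<le> x"
  shows "(LINT \<xi>|lebesgue. f x \<xi> * (fst \<xi> * window n a b l u (\<phi> x) \<xi>)) = (LINT \<xi>|lborel. F \<xi> * (fst \<xi> * window n a b l u 0 \<xi>))"
proof -
  define W where "W p \<xi> = fst \<xi> * window n a b l u p \<xi>" for p and \<xi> :: vel
  define M where "M x = (LINT \<xi>|lebesgue. f x \<xi> * W (\<phi> x) \<xi>)" for x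
  have Wm: "W p \<in> borel_measurable borel" for p unfolding W_def by measurable
  have Wp: "continuous_on UNIV (\<lambda>p. W p \<xi>)" for \<xi> unfolding W_def by (intro continuous_intros)
  define C where "C = sqrt (2 * (\<bar>b\<bar> + \<phi>\<^sub>b))"
  have WC: "\<bar>W p \<xi>\<bar> \<le> C" if "p \<le> \<phi>\<^sub>b" for p \<xi>
    unfolding W_def C_def by (rule window_flux_bound[OF n that]) (use \<phi>\<^sub>b_pos in simp)
  have cM: "continuous_on {0..} M"
    unfolding M_def
    by (rule C_L1_weight[OF f_C_L1 continuous_on_compose2[OF Wp continuous_on_\<phi>] Wm WC]) (use \<phi>_le in auto)
  have const: "\<exists>c. \<forall>y\<in>{0..X}. M y = c" if X: "0 < X" for X
  proof (rule du_Bois_Reymond[OF X continuous_on_subset[OF cM]])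
    show "{0..X} \<subseteq> {0..}" by auto
    fix \<rho> :: "real \<Rightarrow> real"
    assume c\<rho>: "continuous_on UNIV \<rho>" and \<rho>0: "\<And>x. x \<notin> {0<..<X} \<Longrightarrow> \<rho> x = 0" and int0: "integral {0..X} \<rho> = 0"
    define \<theta> where "\<theta> t = integral {0..t} \<rho>" for t
    have d\<theta>: "(\<theta> has_real_derivative \<rho> t) (at t within {0..})" if "0 \<le> t" for t
    proof -
      have "(\<theta> has_real_derivative \<rho> t) (at t within {0..t+1})"
        unfolding \<theta>_def[abs_def]
        by (rule integral_has_real_derivative[OF continuous_on_subset[OF c\<rho>]]) (use that in auto)
      moreover have "at t within {0..t+1} = at t within {0..}"
        by (rule at_within_nhd[where S = "{..<t+1}"]) auto
      ultimately show ?thesis by simp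
    qed
    have \<theta>X: "\<theta> t = 0" if "X \<le> t" for t
    proof -
      have "integral {0..X} \<rho> + integral {X..t} \<rho> = integral {0..t} \<rho>"
        by (rule Henstock_Kurzweil_Integration.integral_combine)
           (use X that in \<open>auto intro!: integrable_continuous_real continuous_on_subset[OF c\<rho>]\<close>)
      moreover have "integral {X..t} \<rho> = integral {X..t} (\<lambda>_. 0)"
        by (rule Henstock_Kurzweil_Integration.integral_cong) (auto intro!: \<rho>0)
      ultimately show ?thesis using int0 by (simp add: \<theta>_def)
    qed
    have one: "((\<lambda>_. 1::real) has_real_derivative (\<lambda>_. 0) t) (at t)" for t :: real by simp
    have wall: "\<theta> 0 = 0 \<or> (\<forall>s<0. (1::real) = 0)" by (simp add: \<theta>_def)
    have \<rho>X: "\<rho> t = 0" if "X < t" for t by (rule \<rho>0) (use that in auto)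
    have "integral {0..X} (\<lambda>x. LINT \<xi>|lebesgue. f x \<xi> * ((fst \<xi> * \<rho> x * 1 + Dx \<phi> x * \<theta> x * 0) * window n a b l u (\<phi> x) \<xi>)) = 0"
      by (rule weak_product(2)[OF d\<theta> continuous_on_subset[OF c\<rho>] one continuous_on_const \<theta>X \<rho>X n wall]) auto
    moreover have "(LINT \<xi>|lebesgue. f x \<xi> * ((fst \<xi> * \<rho> x * 1 + Dx \<phi> x * \<theta> x * 0) * window n a b l u (\<phi> x) \<xi>)) = \<rho> x * M x" for x
    proof -
      have "(LINT \<xi>|lebesgue. f x \<xi> * ((fst \<xi> * \<rho> x * 1 + Dx \<phi> x * \<theta> x * 0) * window n a b l u (\<phi> x) \<xi>)) = (LINT \<xi>|lebesgue. \<rho> x * (f x \<xi> * W (\<phi> x) \<xi>))"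
        by (rule Bochner_Integration.integral_cong) (simp_all add: W_def algebra_simps)
      then show ?thesis by (simp add: M_def)
    qed
    ultimately show "integral {0..X} (\<lambda>x. \<rho> x * M x) = 0" by simp
  qed
  have Mn: "M (real n) = M x" for n
  proof -
    have "0 < max (real n) x + 1" using x by (simp add: max_def)
    from const[OF this] obtain c where "\<forall>y\<in>{0..max (real n) x + 1}. M y = c" by blast
    then have "M (real n) = c" "M x = c" using x by auto
    then show ?thesis by simp
  qed
  have "(\<lambda>n. LINT \<xi>|lebesgue. f (real n) \<xi> * W (\<phi> (real n)) \<xi>) \<longlonglongrightarrow> (LINT \<xi>|lebesgue. F \<xi> * W 0 \<xi>)"
  proof (rule tendsto_integral_mult_weight[where C = C])
    show "integrable lebesgue (f (real n))" for n by (rule f_integrable) simp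
    show "integrable lebesgue F" using F_integrable integrable_completion[of F lborel] by simp
    show "(\<lambda>n. LINT \<xi>|lebesgue. \<bar>f (real n) \<xi> - F \<xi>\<bar>) \<longlonglongrightarrow> 0"
      by (rule filterlim_compose[OF f_limit filterlim_real_sequentially])
    show "W (\<phi> (real n)) \<in> borel_measurable lebesgue" "W 0 \<in> borel_measurable lebesgue" for n
      using Wm measurable_lebesgue by blast+
    have "(\<lambda>n. \<phi> (real n)) \<longlonglongrightarrow> 0" by (rule filterlim_compose[OF \<phi>_limit filterlim_real_sequentially])
    then show "AE \<xi> in lebesgue. (\<lambda>n. W (\<phi> (real n)) \<xi>) \<longlonglongrightarrow> W 0 \<xi>"
      by (intro AE_I2 continuous_on_tendsto_compose[OF Wp]) auto
    show "AE \<xi> in lebesgue. \<bar>W (\<phi> (real n)) \<xi>\<bar> \<le> C" for n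
      by (intro AE_I2 WC \<phi>_le) simp
  qed
  then have "(\<lambda>n. M (real n)) \<longlonglongrightarrow> (LINT \<xi>|lebesgue. F \<xi> * W 0 \<xi>)" by (simp only: M_def)
  then have "(\<lambda>n. M x) \<longlonglongrightarrow> (LINT \<xi>|lebesgue. F \<xi> * W 0 \<xi>)" by (simp only: Mn)
  then have "M x = (LINT \<xi>|lebesgue. F \<xi> * W 0 \<xi>)" by (simp add: LIMSEQ_const_iff)
  also have "\<dots> = (LINT \<xi>|lborel. F \<xi> * W 0 \<xi>)" by (rule integral_completion) (use Wm in measurable)
  finally show ?thesis by (simp add: M_def W_def)
qed

text \<open>Both densities have the same fluxes through all windows. In the limit the windows become boxes in the energy and
  \<open>\<xi>'\<close>. Both densities vanish for \<open>\<xi>\<^sub>1 > 0\<close>, and for \<open>\<xi>\<^sub>1 < 0\<close> an interval of energies is an interval of \<open>\<xi>\<^sub>1\<close>, so the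
  difference times \<open>\<xi>\<^sub>1\<close> has vanishing integrals over all boxes in velocity space.\<close>

lemma f_eq_accelerated:
  assumes x: "0 \<le> x"
  shows "AE \<xi> in lebesgue. f x \<xi> = accelerated F (\<phi> x) \<xi>"
proof -
  let ?A = "accelerated F (\<phi> x)"
  have p0: "0 \<le> \<phi> x" using \<phi>_pos[OF x] by simp
  have Am [measurable]: "?A \<in> borel_measurable borel" by measurable
  have Ai: "integrable lebesgue ?A"
    using integrable_accelerated[OF F_integrable p0] integrable_completion[of ?A lborel] by simp
  define g where "g \<xi> = f x \<xi> - ?A \<xi>" for \<xi>
  have gi: "integrable lebesgue g" unfolding g_def by (intro Bochner_Integration.integrable_diff f_integrable x Ai)
  have "g \<in> borel_measurable (completion lborel)" using gi by simp
  then obtain g' where g' [measurable]: "g' \<in> borel_measurable lborel" and gg': "AE \<xi> in lborel. g \<xi> = g' \<xi>"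
    using completion_ex_borel_measurable_real by blast
  have out: "AE \<xi> in lborel. 0 < fst \<xi> \<longrightarrow> g \<xi> = 0"
    using f_zero_outgoing[OF x] unfolding AE_completion_iff
    by eventually_elim (simp add: g_def accelerated_def)
  define E where "E \<xi> = (fst \<xi>)\<^sup>2 / 2 - \<phi> x" for \<xi> :: vel
  \<comment> \<open>The limit of the weights \<open>\<xi>\<^sub>1 w\<close> as the windows \<open>w\<close> sharpen.\<close>
  define V where "V a b l u \<xi> = fst \<xi> * (indicat_real {a<..<b} (E \<xi>) *
      (indicat_real {fst l<..<fst u} (fst (snd \<xi>)) * indicat_real {snd l<..<snd u} (snd (snd \<xi>))))" for a b l u and \<xi> :: vel
  have [measurable]: "E \<in> borel_measurable borel" unfolding E_def by measurable
  have Vm [measurable]: "V a b l u \<in> borel_measurable borel" for a b l u unfolding V_def by measurable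
  have V0: "(LINT \<xi>|lebesgue. g \<xi> * V a b l u \<xi>) = 0" and gV: "integrable lebesgue (\<lambda>\<xi>. g \<xi> * V a b l u \<xi>)" for a b l u
  proof -
    define w where "w n \<xi> = fst \<xi> * window (real n) a b l u (\<phi> x) \<xi>" for n and \<xi> :: vel
    define C where "C = sqrt (2 * (\<bar>b\<bar> + \<phi>\<^sub>b))"
    have wC: "\<bar>w n \<xi>\<bar> \<le> C" for n \<xi>
      unfolding w_def C_def by (rule window_flux_bound[OF _ \<phi>_le[OF x]]) (use \<phi>\<^sub>b_pos in auto)
    have wV: "(\<lambda>n. w n \<xi>) \<longlonglongrightarrow> V a b l u \<xi>" for \<xi>
      unfolding w_def window_def V_def E_def by (intro tendsto_mult tendsto_const bump_tendsto)
    have VC: "\<bar>V a b l u \<xi>\<bar> \<le> C" for \<xi>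
      by (rule tendsto_upperbound[OF tendsto_rabs[OF wV]]) (use wC in auto)
    have wm: "w n \<in> borel_measurable borel" for n unfolding w_def by measurable
    have wi: "integrable lebesgue (\<lambda>\<xi>. k \<xi> * w n \<xi>)" if "integrable lebesgue k" for k n
    proof (rule Bochner_Integration.integrable_bound[of _ "\<lambda>\<xi>. C * k \<xi>"])
      show "(\<lambda>\<xi>. k \<xi> * w n \<xi>) \<in> borel_measurable lebesgue"
        using that measurable_lebesgue[OF wm] by (intro borel_measurable_times) auto
      show "AE \<xi> in lebesgue. norm (k \<xi> * w n \<xi>) \<le> norm (C * k \<xi>)"
        unfolding real_norm_def by (intro AE_I2 abs_mult_le_if wC)
    qed (use that in auto)
    show "integrable lebesgue (\<lambda>\<xi>. g \<xi> * V a b l u \<xi>)"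
    proof (rule Bochner_Integration.integrable_bound[of _ "\<lambda>\<xi>. C * g \<xi>"])
      show "(\<lambda>\<xi>. g \<xi> * V a b l u \<xi>) \<in> borel_measurable lebesgue"
        using gi measurable_lebesgue[OF Vm] by (intro borel_measurable_times) auto
      show "AE \<xi> in lebesgue. norm (g \<xi> * V a b l u \<xi>) \<le> norm (C * g \<xi>)"
        unfolding real_norm_def by (intro AE_I2 abs_mult_le_if VC)
    qed (use gi in auto)
    have z: "(LINT \<xi>|lebesgue. g \<xi> * w n \<xi>) = 0" for n
    proof -
      have "(LINT \<xi>|lebesgue. f x \<xi> * w n \<xi>) = (LINT \<xi>|lborel. ?A \<xi> * w n \<xi>)"
        unfolding w_def accelerated_flux[OF p0] by (rule flux_constant[OF of_nat_0_le_iff x])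
      also have "\<dots> = (LINT \<xi>|lebesgue. ?A \<xi> * w n \<xi>)"
        by (rule integral_completion[symmetric]) (use wm in measurable)
      finally show ?thesis
        using Bochner_Integration.integral_diff[OF wi[OF f_integrable[OF x], of n] wi[OF Ai, of n]]
        by (simp add: g_def left_diff_distrib)
    qed
    have "(\<lambda>n. LINT \<xi>|lebesgue. g \<xi> * w n \<xi>) \<longlonglongrightarrow> (LINT \<xi>|lebesgue. g \<xi> * V a b l u \<xi>)"
    proof (rule tendsto_integral_mult_weight[where C = C])
      show "AE \<xi> in lebesgue. (\<lambda>n. w n \<xi>) \<longlonglongrightarrow> V a b l u \<xi>"
        by (intro AE_I2 wV)
    qed (use gi wC measurable_lebesgue[OF wm] measurable_lebesgue[OF Vm] in auto)
    then show "(LINT \<xi>|lebesgue. g \<xi> * V a b l u \<xi>) = 0" unfolding z by (simp add: LIMSEQ_const_iff)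
  qed
  define h where "h \<xi> = g' \<xi> * fst \<xi> * indicat_real {..<0} (fst \<xi>)" for \<xi>
  have hm [measurable]: "h \<in> borel_measurable borel" unfolding h_def[abs_def] using g' by measurable
  have hbox: "\<exists>a b. AE \<xi> in lebesgue. g \<xi> * V a b (snd l) (snd u) \<xi> = h \<xi> * indicat_real (box l u) \<xi>" for l u
  proof -
    \<comment> \<open>Clipping the box at \<open>\<xi>\<^sub>1 = 0\<close> makes squaring monotone; a box inside \<open>\<xi>\<^sub>1 \<ge> 0\<close> gets the empty energy interval.\<close>
    define m where "m = min (fst u) 0"
    define a where "a = m\<^sup>2 / 2 - \<phi> x"
    define b where "b = (if fst l < 0 then (fst l)\<^sup>2 / 2 - \<phi> x else a)"
    have eqv: "E \<xi> \<in> {a<..<b} \<longleftrightarrow> fst l < fst \<xi> \<and> fst \<xi> < fst u" if neg: "fst \<xi> < 0" for \<xi> :: vel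
    proof -
      have "a < E \<xi> \<longleftrightarrow> m\<^sup>2 < (fst \<xi>)\<^sup>2" by (simp add: a_def E_def)
      also have "\<dots> \<longleftrightarrow> fst \<xi> < m" using neg
        by (metis abs_le_square_iff abs_of_neg abs_of_nonpos linorder_not_le m_def min.cobounded2 neg_le_iff_le)
      also have "\<dots> \<longleftrightarrow> fst \<xi> < fst u" using neg by (auto simp: m_def)
      finally have 1: "a < E \<xi> \<longleftrightarrow> fst \<xi> < fst u" .
      show ?thesis
      proof (cases "fst l < 0")
        case True
        have "E \<xi> < b \<longleftrightarrow> (fst \<xi>)\<^sup>2 < (fst l)\<^sup>2" using True by (simp add: b_def E_def)
        also have "\<dots> \<longleftrightarrow> fst l < fst \<xi>" using neg True
          by (metis abs_le_square_iff abs_of_neg linorder_not_le neg_le_iff_le)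
        finally show ?thesis using 1 by auto
      next
        case False
        then show ?thesis using neg by (auto simp: b_def)
      qed
    qed
    have "AE \<xi> in lebesgue. g \<xi> * V a b (snd l) (snd u) \<xi> = h \<xi> * indicat_real (box l u) \<xi>"
      unfolding AE_completion_iff using gg' out
    proof eventually_elim
      case (elim \<xi>)
      have bx: "\<xi> \<in> box l u \<longleftrightarrow> fst \<xi> \<in> {fst l<..<fst u} \<and> fst (snd \<xi>) \<in> {fst (snd l)<..<fst (snd u)} \<and> snd (snd \<xi>) \<in> {snd (snd l)<..<snd (snd u)}"
        by (auto simp: mem_box Basis_prod_def inner_prod_def)
      show ?case
      proof (cases "fst \<xi> < 0")
        case True
        then show ?thesis using eqv[OF True] elim by (auto simp: V_def h_def bx indicator_def)
      next
        case False
        then show ?thesis using elim by (cases "fst \<xi> = 0") (auto simp: V_def h_def)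
      qed
    qed
    then show ?thesis by blast
  qed
  have hb: "integrable lborel (\<lambda>\<xi>. h \<xi> * indicat_real (box l u) \<xi>) \<and> (LINT \<xi>|lborel. h \<xi> * indicat_real (box l u) \<xi>) = 0" for l u
  proof -
    obtain a b where ab: "AE \<xi> in lebesgue. g \<xi> * V a b (snd l) (snd u) \<xi> = h \<xi> * indicat_real (box l u) \<xi>"
      using hbox by blast
    have bm: "(\<lambda>\<xi>. h \<xi> * indicat_real (box l u) \<xi>) \<in> borel_measurable borel" by measurable
    have i: "integrable lebesgue (\<lambda>\<xi>. h \<xi> * indicat_real (box l u) \<xi>)"
      by (rule integrable_cong_AE_imp[OF gV measurable_lebesgue[OF bm]]) (use ab in \<open>auto elim: eventually_mono\<close>)
    have "(LINT \<xi>|lebesgue. h \<xi> * indicat_real (box l u) \<xi>) = (LINT \<xi>|lebesgue. g \<xi> * V a b (snd l) (snd u) \<xi>)"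
      by (rule integral_cong_AE) (use i gV ab in \<open>auto elim: eventually_mono\<close>)
    then show ?thesis using i V0 bm
      by (simp add: integrable_completion integral_completion)
  qed
  have "AE \<xi> in lborel. h \<xi> = 0"
    by (rule AE_zero_if_box_integrals_zero) (use hb in auto)
  then have "AE \<xi> in lborel. g \<xi> = 0"
    using gg' out AE_fst_neq[of 0]
  proof eventually_elim
    case (elim \<xi>)
    then show ?case by (cases "fst \<xi> < 0") (auto simp: h_def)
  qed
  then show ?thesis unfolding AE_completion_iff by eventually_elim (simp add: g_def)
qed

lemma f_mass: "0 \<le> x \<Longrightarrow> (LINT \<xi>|lebesgue. f x \<xi>) = rho_i F (\<phi> x)"
proof -
  assume x: "0 \<le> x"
  have p0: "0 \<le> \<phi> x" using \<phi>_pos[OF x] by simp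
  have "(LINT \<xi>|lebesgue. f x \<xi>) = (LINT \<xi>|lebesgue. accelerated F (\<phi> x) \<xi>)"
    by (rule integral_cong_AE) (use f_integrable[OF x] f_eq_accelerated[OF x] in \<open>auto intro!: measurable_lebesgue\<close>)
  also have "\<dots> = (LINT \<xi>|lborel. accelerated F (\<phi> x) \<xi>)" by (rule integral_completion) simp
  finally show ?thesis using accelerated_mass[OF p0] by simp
qed

lemma Dx\<phi>_deriv: "0 < x \<Longrightarrow> (Dx \<phi> has_real_derivative net_density (\<phi> x)) (at x)"
  using C2_on_open_half_line[OF \<phi>_C2] Poisson f_mass by simp

lemma
  assumes "0 \<le> x"
  shows V_\<phi>_pos: "0 < V (\<phi> x)" and Dx\<phi>_eq: "Dx \<phi> x = - sqrt (2 * V (\<phi> x))"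
  using first_integral[OF \<phi>_deriv continuous_on_Dx\<phi> Dx_\<phi>_neg Dx\<phi>_deriv \<phi>_limit V_DERIV continuous_on_V V_0 assms] by auto

text \<open>The potential takes every value in \<open>(0, \<phi>\<^sub>b]\<close>, and by the energy law \<open>V\<close> is positive at each of them.\<close>

lemma \<phi>\<^sub>b_in_Bset: "\<phi>\<^sub>b \<in> Bset n\<^sub>e F"
  unfolding Bset_def
proof (intro CollectI conjI ballI \<phi>\<^sub>b_pos)
  fix s assume s: "s \<in> {0<..\<phi>\<^sub>b}"
  then have "\<forall>\<^sub>F x in at_top. \<phi> x < s" using order_tendstoD(2)[OF \<phi>_limit, of s] by simp
  then obtain N where N: "\<And>x. N \<le> x \<Longrightarrow> \<phi> x < s" by (auto simp: eventually_at_top_linorder)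
  have "\<exists>x\<ge>0. x \<le> max N 0 \<and> \<phi> x = s"
    by (rule IVT2') (use N[of "max N 0"] s \<phi>_0 in \<open>auto intro: continuous_on_subset[OF continuous_on_\<phi>]\<close>)
  then show "0 < V s" using V_\<phi>_pos by blast
qed

end

section \<open>Construction of the solution\<close>

text \<open>The potential as a solution of the first-order equation to which Poisson's equation reduces.\<close>

locale sheath = far_field +
  fixes b :: real and \<phi> :: "real \<Rightarrow> real"
  assumes b: "b \<in> Bset n\<^sub>e F" and \<phi>_0: "\<phi> 0 = b"
    and \<phi>_range: "\<And>x. 0 \<le> x \<Longrightarrow> 0 < \<phi> x \<and> \<phi> x \<le> b"
    and \<phi>_ode: "\<And>x. 0 \<le> x \<Longrightarrow> (\<phi> has_real_derivative - sqrt (2 * V (\<phi> x))) (at x within {0..})"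
    and \<phi>_limit: "(\<phi> \<longlongrightarrow> 0) at_top"
begin

lemma V_pos: "0 \<le> x \<Longrightarrow> 0 < V (\<phi> x)"
  using b \<phi>_range[of x] by (auto simp: Bset_def)

lemma Dx_\<phi>: "0 \<le> x \<Longrightarrow> Dx \<phi> x = - sqrt (2 * V (\<phi> x))"
  by (rule Dx_eqI[OF _ \<phi>_ode])

lemma continuous_on_\<phi>: "continuous_on {0..} \<phi>"
  by (rule DERIV_continuous_on[OF \<phi>_ode]) simp

lemma \<phi>_slope_deriv:
  assumes "0 \<le> x"
  shows "((\<lambda>x. - sqrt (2 * V (\<phi> x))) has_real_derivative net_density (\<phi> x)) (at x within {0..})"
proof -
  have 1: "((\<lambda>x. V (\<phi> x)) has_real_derivative net_density (\<phi> x) * - sqrt (2 * V (\<phi> x))) (at x within {0..})"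
    by (rule DERIV_chain2[OF V_DERIV \<phi>_ode[OF assms]]) (use \<phi>_range[OF assms] in simp)
  have p: "0 < 2 * V (\<phi> x)" using V_pos[OF assms] by simp
  from DERIV_minus[OF DERIV_chain2[OF DERIV_real_sqrt[OF p] DERIV_cmult[OF 1, of 2]]]
  show ?thesis
    by (rule DERIV_cong) (use p in \<open>simp add: field_simps\<close>)
qed

lemma continuous_on_charge: "continuous_on {0..} (\<lambda>x. net_density (\<phi> x))"
  by (rule continuous_on_compose2[OF continuous_on_net_density continuous_on_\<phi>]) (use \<phi>_range in \<open>auto intro: less_imp_le\<close>)

lemma \<phi>_C2: "C2_on {0..} \<phi>"
  by (rule C2_on_real[OF \<phi>_ode \<phi>_slope_deriv continuous_on_charge]) auto

lemma \<phi>_C2_open: "C2_on {0<..} \<phi>"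
  by (rule C2_on_real[OF has_field_derivative_subset[OF \<phi>_ode] has_field_derivative_subset[OF \<phi>_slope_deriv]
        continuous_on_subset[OF continuous_on_charge]]) auto

lemma continuous_on_slope: "continuous_on {0..} (\<lambda>x. - sqrt (2 * V (\<phi> x)))"
  by (rule DERIV_continuous_on[OF \<phi>_slope_deriv]) simp

lemma \<phi>_C1: "C1_on {0..} \<phi>"
  by (rule C1_on_real[OF \<phi>_ode continuous_on_slope]) auto

lemma continuous_on_Dx\<phi>: "continuous_on {0..} (Dx \<phi>)"
  by (rule C1_on_half_line(2)[OF \<phi>_C1])

lemma DDx_\<phi>: "0 \<le> x \<Longrightarrow> Dx (Dx \<phi>) x = net_density (\<phi> x)"
proof -
  assume x: "0 \<le> x"
  have "(Dx \<phi> has_real_derivative net_density (\<phi> x)) (at x within {0..})"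
    using \<phi>_slope_deriv[OF x] unfolding has_field_derivative_def
    by (rule has_derivative_transform[rotated 2]) (use x Dx_\<phi> in auto)
  then show ?thesis by (rule Dx_eqI[OF x])
qed

text \<open>Freezing the potential at its wall value for \<open>x < 0\<close> gives a density that is Borel on the whole space.\<close>

abbreviation "\<phi>c x \<equiv> \<phi> (max 0 x)"

lemma continuous_on_\<phi>c: "continuous_on UNIV \<phi>c"
  by (rule continuous_on_compose2[OF continuous_on_\<phi>]) (auto intro!: continuous_intros)

lemma measurable_\<phi>c [measurable]: "\<phi>c \<in> borel_measurable borel"
  by (rule borel_measurable_continuous_onI[OF continuous_on_\<phi>c])

lemma \<phi>c_range: "0 < \<phi>c x" "\<phi>c x \<le> b"
  using \<phi>_range[of "max 0 x"] by auto

lemma accelerated_0: "accelerated F 0 = F"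
proof
  fix \<xi> show "accelerated F 0 \<xi> = F \<xi>"
    using F_zero[of \<xi>] by (cases "fst \<xi> < 0") (auto simp: accelerated_def)
qed

lemma integrable_slice: "0 \<le> x \<Longrightarrow> integrable lebesgue (accelerated F (\<phi> x))"
  using integrable_accelerated[OF F_integrable, of "\<phi> x"] integrable_completion[of "accelerated F (\<phi> x)" lborel] \<phi>_range[of x]
  by simp

lemma slice_mass: "0 \<le> x \<Longrightarrow> (LINT \<xi>|lebesgue. accelerated F (\<phi> x) \<xi>) = rho_i F (\<phi> x)"
  using accelerated_mass[of "\<phi> x"] \<phi>_range[of x] integral_completion[of "accelerated F (\<phi> x)" lborel] by simp

lemma L1_distance: "(LINT \<xi>|lebesgue. \<bar>accelerated F a \<xi> - accelerated F c \<xi>\<bar>) = (LINT \<xi>|lborel. \<bar>accelerated F a \<xi> - accelerated F c \<xi>\<bar>)"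
  by (rule integral_completion) measurable

lemma transported_C_L1: "C_L1 (transported F \<phi>)"
  unfolding C_L1_def
proof (intro conjI allI impI)
  show "integrable lebesgue (transported F \<phi> x)" if "0 \<le> x" for x
    unfolding transported_eq by (rule integrable_slice[OF that])
  fix x :: real assume x: "0 \<le> x"
  define N where "N y = (LINT \<xi>|lebesgue. \<bar>transported F \<phi> y \<xi> - transported F \<phi> x \<xi>\<bar>)" for y
  have "continuous (at x within {0..}) N"
    unfolding continuous_within_sequentially
  proof (intro allI impI, elim conjE)
    fix y :: "nat \<Rightarrow> real" assume y: "\<forall>n. y n \<in> {0..}" and lim: "y \<longlonglongrightarrow> x"
    have "(\<lambda>n. \<phi> (y n)) \<longlonglongrightarrow> \<phi> x"
      by (rule continuous_on_tendsto_compose[OF continuous_on_\<phi> lim]) (use x y in auto)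
    then have "(\<lambda>n. LINT \<xi>|lborel. \<bar>accelerated F (\<phi> (y n)) \<xi> - accelerated F (\<phi> x) \<xi>\<bar>) \<longlonglongrightarrow> 0"
      by (rule accelerated_continuous_L1[OF F_integrable, rotated 2]) (use \<phi>_range x y in \<open>auto intro: less_imp_le\<close>)
    then show "(N \<circ> y) \<longlonglongrightarrow> N x" by (simp add: N_def o_def transported_eq L1_distance)
  qed
  then show "((\<lambda>y. LINT \<xi>|lebesgue. \<bar>transported F \<phi> y \<xi> - transported F \<phi> x \<xi>\<bar>) \<longlongrightarrow> 0) (at x within {0..})"
    unfolding continuous_within N_def by simp
qed

lemma transported_limit: "((\<lambda>x. LINT \<xi>|lebesgue. \<bar>transported F \<phi> x \<xi> - F \<xi>\<bar>) \<longlongrightarrow> 0) at_top"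
proof (rule tendsto_at_topI_sequentially)
  fix y :: "nat \<Rightarrow> real" assume y: "filterlim y at_top sequentially"
  have ev: "\<forall>\<^sub>F n in sequentially. 0 \<le> y n" using y by (simp add: filterlim_at_top)
  have "(\<lambda>n. \<phi> (y n)) \<longlonglongrightarrow> 0" by (rule filterlim_compose[OF \<phi>_limit y])
  then have "(\<lambda>n. \<phi>c (y n)) \<longlonglongrightarrow> 0"
    by (rule Lim_transform_eventually) (use ev in \<open>auto elim!: eventually_mono simp: max_def\<close>)
  then have "(\<lambda>n. LINT \<xi>|lborel. \<bar>accelerated F (\<phi>c (y n)) \<xi> - accelerated F 0 \<xi>\<bar>) \<longlonglongrightarrow> 0"
    by (rule accelerated_continuous_L1[OF F_integrable, rotated 2]) (use \<phi>c_range in \<open>auto intro: less_imp_le\<close>)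
  then have "(\<lambda>n. LINT \<xi>|lebesgue. \<bar>accelerated F (\<phi>c (y n)) \<xi> - accelerated F 0 \<xi>\<bar>) \<longlonglongrightarrow> 0"
    by (simp only: L1_distance)
  then show "(\<lambda>n. LINT \<xi>|lebesgue. \<bar>transported F \<phi> (y n) \<xi> - F \<xi>\<bar>) \<longlonglongrightarrow> 0"
    by (rule Lim_transform_eventually)
       (use ev in \<open>auto elim!: eventually_mono simp: accelerated_0 transported_eq max_def\<close>)
qed

lemma accelerated_nonneg: "0 \<le> accelerated F a \<xi>"
  by (simp add: accelerated_def F_nonneg)

lemma transported_L1_loc: "L1_loc (transported F \<phi>)"
  unfolding L1_loc_def
proof (intro allI impI, elim conjE)
  fix K :: "(real \<times> vel) set" assume K: "compact K" "K \<subseteq> {0..} \<times> UNIV"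
  then have Kb [measurable]: "K \<in> sets borel" by (simp add: borel_compact)
  have "bounded (fst ` K)" by (intro compact_imp_bounded compact_continuous_image K continuous_intros)
  then obtain X where X: "0 < X" "\<forall>y\<in>fst ` K. norm y \<le> X" unfolding bounded_pos by blast
  define g where "g z = indicat_real K z * accelerated F (\<phi>c (fst z)) (snd z)" for z
  have [measurable]: "(\<lambda>z::real \<times> vel. accelerated F (\<phi>c (fst z)) (snd z)) \<in> borel_measurable borel"
    unfolding accelerated_def by measurable
  have gm [measurable]: "g \<in> borel_measurable borel" unfolding g_def[abs_def] by measurable
  have gp: "(\<lambda>z. ennreal (g z)) \<in> borel_measurable (lborel \<Otimes>\<^sub>M lborel)" unfolding lborel_prod by simp
  have "(\<integral>\<^sup>+z. ennreal (g z) \<partial>lborel) = (\<integral>\<^sup>+x. \<integral>\<^sup>+\<xi>. ennreal (g (x, \<xi>)) \<partial>lborel \<partial>lborel)"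
    using sigma_finite_measure.nn_integral_fst[OF sigma_finite_lborel gp] unfolding lborel_prod by simp
  also have "\<dots> \<le> (\<integral>\<^sup>+x. indicator {0..X} x \<partial>lborel)"
  proof (rule nn_integral_mono)
    fix x :: real
    have m: "(\<integral>\<^sup>+\<xi>. ennreal (accelerated F (\<phi>c x) \<xi>) \<partial>lborel) \<le> 1"
    proof -
      have "(\<integral>\<^sup>+\<xi>. ennreal (accelerated F (\<phi>c x) \<xi>) \<partial>lborel) = ennreal (LINT \<xi>|lborel. accelerated F (\<phi>c x) \<xi>)"
        by (rule nn_integral_eq_integral[OF integrable_accelerated[OF F_integrable]])
           (use \<phi>c_range accelerated_nonneg in \<open>auto intro: less_imp_le\<close>)
      also have "\<dots> \<le> ennreal 1"
        using accelerated_mass[of "\<phi>c x"] rho_i_le_1[of "\<phi>c x"] \<phi>c_range[of x] by (intro ennreal_leI) simp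
      finally show ?thesis by simp
    qed
    show "(\<integral>\<^sup>+\<xi>. ennreal (g (x, \<xi>)) \<partial>lborel) \<le> indicator {0..X} x"
    proof (cases "x \<in> {0..X}")
      case True
      have "(\<integral>\<^sup>+\<xi>. ennreal (g (x, \<xi>)) \<partial>lborel) \<le> (\<integral>\<^sup>+\<xi>. ennreal (accelerated F (\<phi>c x) \<xi>) \<partial>lborel)"
        by (intro nn_integral_mono ennreal_leI) (auto simp: g_def indicator_def accelerated_nonneg)
      then show ?thesis using m True by simp
    next
      case False
      then have "(x, \<xi>) \<notin> K" for \<xi> using X(2) K(2) by force
      then show ?thesis by (simp add: g_def)
    qed
  qed
  also have "\<dots> < \<infinity>" using X by simp
  finally have "integrable lborel g"
    by (intro integrableI_nonneg) (auto simp: g_def accelerated_nonneg)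
  then have "integrable lebesgue g" using integrable_completion[of g lborel] by simp
  then show "set_integrable lebesgue K (\<lambda>(x, \<xi>). transported F \<phi> x \<xi>)"
    unfolding set_integrable_def
    by (rule Bochner_Integration.integrable_cong[THEN iffD1, rotated 2])
       (use K(2) in \<open>auto simp: g_def indicator_def transported_eq max_def\<close>)
qed

text \<open>In the coordinates \<open>(x, \<eta>)\<close>, where \<open>\<eta>\<close> is the velocity at infinity, the Vlasov operator is the
  derivative of the test function along the trajectory of \<open>\<eta>\<close>; up to sign, its integral is the value of the test
  function where that trajectory meets the wall, which vanishes.\<close>

lemma transported_weak: "weak_Vlasov 0 (\<lambda>_. 0) (transported F \<phi>) \<phi>"
  unfolding weak_Vlasov_def
proof
  fix \<psi> assume "\<psi> \<in> test_functions 0"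
  then have C1: "C1_on ({0..} \<times> UNIV) (\<lambda>(x, \<xi>). \<psi> x \<xi>)"
    and cpt: "compact (closure {(x, \<xi>). 0 \<le> x \<and> \<psi> x \<xi> \<noteq> 0})"
    and wall: "\<And>\<xi>\<^sub>1 \<xi>'. 0 < \<xi>\<^sub>1 \<Longrightarrow> \<psi> 0 (- \<xi>\<^sub>1, \<xi>') = 0"
    unfolding test_functions_def by auto
  let ?S = "{0::real..} \<times> (UNIV :: vel set)" and ?\<psi> = "\<lambda>z. \<psi> (fst z) (snd z)"
  obtain D where D: "\<And>z. z \<in> ?S \<Longrightarrow> (?\<psi> has_derivative blinfun_apply (D z)) (at z within ?S)"
    and cD: "continuous_on ?S D"
    using C1 unfolding C1_on_def case_prod_beta by blast
  define px where "px x \<xi> = blinfun_apply (D (x, \<xi>)) (1, 0)" for x \<xi>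
  define pxi where "pxi x \<xi> = blinfun_apply (D (x, \<xi>)) (0, (1, 0))" for x \<xi>
  define G where "G x \<xi> = fst \<xi> * px x \<xi> + Dx \<phi> x * pxi x \<xi>" for x \<xi>
  have cG: "continuous_on ?S (\<lambda>(x, \<xi>). G x \<xi>)"
    unfolding G_def px_def pxi_def case_prod_beta
    by (intro continuous_intros continuous_on_compose2[OF cD] continuous_on_compose2[OF continuous_on_Dx\<phi>]) auto
  define K where "K = closure {(x, \<xi>). 0 \<le> x \<and> \<psi> x \<xi> \<noteq> 0}"
  have "bounded K" using cpt unfolding K_def by (rule compact_imp_bounded)
  then obtain B where B: "0 < B" "\<forall>z\<in>K. norm z \<le> B" unfolding bounded_pos by blast
  \<comment> \<open>One unit beyond the support, so that \<open>\<psi>\<close> vanishes at \<open>x = X\<close>.\<close>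
  define X where "X = B + 1"
  have X: "0 < X" using B by (simp add: X_def)
  have K_in: "0 \<le> x \<Longrightarrow> \<psi> x \<xi> \<noteq> 0 \<Longrightarrow> (x, \<xi>) \<in> K" for x \<xi>
    unfolding K_def by (rule closure_subset[THEN subsetD]) simp
  have K_box: "x \<le> B \<and> \<xi> \<in> cball 0 B" if "(x, \<xi>) \<in> K" for x \<xi>
    using B(2)[rule_format, OF that] norm_fst_le[of x \<xi>] norm_snd_le[of \<xi> x] by auto
  have interior: "at (x, \<xi>) within ?S = at (x, \<xi>)" if "0 < x" for x \<xi>
  proof (rule at_within_interior)
    show "(x, \<xi>) \<in> interior ?S"
      by (rule interiorI[of "{0<..} \<times> (UNIV :: vel set)"]) (use that in \<open>auto intro: open_Times\<close>)
  qed
  have Dat: "(?\<psi> has_derivative blinfun_apply (D (x, \<xi>))) (at (x, \<xi>))" if "0 < x" for x \<xi>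
    using D[of "(x, \<xi>)"] that interior[OF that] by simp
  have D0: "D (x, \<xi>) = 0" if "0 < x" "(x, \<xi>) \<notin> K" for x \<xi>
  proof -
    define U where "U = ({0<..} \<times> UNIV) - K"
    have "open U" unfolding U_def K_def by (intro open_Diff open_Times) auto
    moreover have "(x, \<xi>) \<in> U" using that by (simp add: U_def)
    moreover have "0 = ?\<psi> z" if "z \<in> U" for z
      using K_in[of "fst z" "snd z"] that unfolding U_def by force
    ultimately have "(?\<psi> has_derivative (\<lambda>_. 0)) (at (x, \<xi>))"
      by (intro has_derivative_transform_within_open[OF has_derivative_const[of 0]]) auto
    from has_derivative_unique[OF Dat[OF that(1)] this] show ?thesis
      by (intro blinfun_eqI) simp
  qed
  have G0': "G x \<xi> = 0" if "0 < x" "\<not> (x \<le> X \<and> \<xi> \<in> cball 0 B)" for x \<xi>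
  proof -
    have "(x, \<xi>) \<notin> K" using K_box[of x \<xi>] that(2) by (auto simp: X_def)
    then have "D (x, \<xi>) = 0" by (rule D0[OF that(1)])
    then show ?thesis by (simp add: G_def px_def pxi_def)
  qed
  have Gx: "continuous_on {0..} (\<lambda>x. G x \<xi>)" for \<xi>
  proof -
    have "continuous_on {0..} (\<lambda>x. (\<lambda>(x, \<xi>). G x \<xi>) (x, \<xi>))"
      by (rule continuous_on_compose2[OF cG]) (auto intro!: continuous_intros)
    then show ?thesis by simp
  qed
  have G0: "G x \<xi> = 0" if "0 \<le> x" "\<not> (x \<le> X \<and> \<xi> \<in> cball 0 B)" for x \<xi>
  proof (cases "x = 0")
    case True
    have "\<xi> \<notin> cball 0 B" using that True X by simp
    then have z: "G y \<xi> = 0" if "y \<in> {0<..}" for y using G0'[of y \<xi>] that by simp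
    show ?thesis unfolding True
      by (rule continuous_constant_on_closure[where S = "{0<..}" and f = "\<lambda>y. G y \<xi>"]) (use z Gx in auto)
  qed (use G0' that in simp)
  note slices = transported_L1_loc transported_C_L1 cG G0
  obtain C where GC: "\<And>x \<xi>. 0 \<le> x \<Longrightarrow> \<bar>G x \<xi>\<bar> \<le> C" using slice_bounded[OF slices] by blast
  have C0: "0 \<le> C" using GC[of 0 undefined] by simp
  have Gm: "G x \<in> borel_measurable borel" if "0 \<le> x" for x by (rule slice_measurable[OF slices that])
  have partials: "partial_x \<psi> x \<xi> = px x \<xi>" "partial_xi1 \<psi> x \<xi> = pxi x \<xi>" if "0 < x" for x \<xi>
  proof -
    have "((\<lambda>y::real. (y, \<xi>)) has_derivative (\<lambda>h. (h, 0))) (at x)" by (auto intro!: derivative_eq_intros)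
    from has_derivative_compose[OF this, of ?\<psi> "blinfun_apply (D (x, \<xi>))"] Dat[OF that]
    have "((\<lambda>y. \<psi> y \<xi>) has_derivative (\<lambda>h. blinfun_apply (D (x, \<xi>)) (h, 0))) (at x)" by simp
    moreover have "blinfun_apply (D (x, \<xi>)) (h, 0) = px x \<xi> * h" for h
      using blinfun.scaleR_right[of "D (x, \<xi>)" h "(1, 0)"] by (simp add: px_def mult.commute)
    ultimately show "partial_x \<psi> x \<xi> = px x \<xi>"
      unfolding partial_x_def by (intro DERIV_imp_deriv) (simp add: has_field_derivative_def)
    have "((\<lambda>s::real. (x, (s, snd \<xi>))) has_derivative (\<lambda>h. (0, (h, 0)))) (at (fst \<xi>))"
      by (auto intro!: derivative_eq_intros)
    from has_derivative_compose[OF this, of ?\<psi> "blinfun_apply (D (x, \<xi>))"] Dat[OF that, of \<xi>]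
    have "((\<lambda>s. \<psi> x (s, snd \<xi>)) has_derivative (\<lambda>h. blinfun_apply (D (x, \<xi>)) (0, (h, 0)))) (at (fst \<xi>))" by simp
    moreover have "blinfun_apply (D (x, \<xi>)) (0, (h, 0)) = pxi x \<xi> * h" for h
      using blinfun.scaleR_right[of "D (x, \<xi>)" h "(0, (1, 0))"] by (simp add: pxi_def mult.commute)
    ultimately show "partial_xi1 \<psi> x \<xi> = pxi x \<xi>"
      unfolding partial_xi1_def by (intro DERIV_imp_deriv) (simp add: has_field_derivative_def)
  qed
  have "(LINT (x, \<xi>) : {0<..} \<times> UNIV | lebesgue. transported F \<phi> x \<xi> * (fst \<xi> * partial_x \<psi> x \<xi> + Dx \<phi> x * partial_xi1 \<psi> x \<xi>))
      = (LINT (x, \<xi>) : {0<..} \<times> UNIV | lebesgue. transported F \<phi> x \<xi> * G x \<xi>)"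
    unfolding set_lebesgue_integral_def
  proof (rule Bochner_Integration.integral_cong[OF refl])
    fix z :: "real \<times> vel"
    show "indicat_real ({0<..} \<times> UNIV) z *\<^sub>R (case z of (x, \<xi>) \<Rightarrow> transported F \<phi> x \<xi> * (fst \<xi> * partial_x \<psi> x \<xi> + Dx \<phi> x * partial_xi1 \<psi> x \<xi>))
      = indicat_real ({0<..} \<times> UNIV) z *\<^sub>R (case z of (x, \<xi>) \<Rightarrow> transported F \<phi> x \<xi> * G x \<xi>)"
      using partials[of "fst z" "snd z"] by (simp add: case_prod_beta indicator_def mem_Times_iff G_def)
  qed
  also have "\<dots> = (LINT x|lborel. indicat_real {0..X} x * (LINT \<xi>|lebesgue. transported F \<phi> x \<xi> * G x \<xi>))"
    by (rule slice_Fubini[OF slices])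
  also have "\<dots> = 0"
  proof -
    define Gk where "Gk z = indicat_real ({0..X} \<times> UNIV) z * G (fst z) (snd z)" for z
    have sX: "({0..X} \<times> UNIV :: (real \<times> vel) set) \<in> sets borel" by (intro borel_closed closed_Times) auto
    have cX: "continuous_on ({0..X} \<times> UNIV) (\<lambda>z. G (fst z) (snd z))"
      by (rule continuous_on_subset[OF cG[unfolded case_prod_beta]]) auto
    have Gkm [measurable]: "Gk \<in> borel_measurable borel"
      using borel_measurable_continuous_on_indicator[OF sX cX] unfolding Gk_def[abs_def] by simp
    define Q where "Q x \<eta> = F \<eta> * (fall_jacobian (\<phi>c x) \<eta> * Gk (x, fall (\<phi>c x) \<eta>))" for x \<eta>
    have Qm: "(\<lambda>(x, \<eta>). Q x \<eta>) \<in> borel_measurable borel"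
      unfolding Q_def fall_jacobian_def speed_ratio_def fall_def case_prod_beta
      by (intro borel_measurable_times measurable_compose[OF _ F_borel] measurable_compose[OF _ Gkm]) measurable
    have Qi: "integrable (lborel \<Otimes>\<^sub>M lborel) (\<lambda>(x, \<eta>). Q x \<eta>)"
      unfolding lborel_prod
    proof (rule Bochner_Integration.integrable_bound[of _ "\<lambda>z. indicat_real {0..X} (fst z) * (C * F (snd z))"])
      have "integrable (lborel \<Otimes>\<^sub>M lborel) (\<lambda>z. indicat_real {0..X} (fst z) * (C * F (snd z)))"
      proof (rule lborel_pair.Fubini_integrable)
        show "(\<lambda>z. indicat_real {0..X} (fst z) * (C * F (snd z))) \<in> borel_measurable (lborel \<Otimes>\<^sub>M lborel)"
          unfolding lborel_prod by (intro borel_measurable_times measurable_compose[OF _ F_borel]) measurable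
        have "(LINT y|lborel. norm (indicat_real {0..X} (fst (x, y)) * (C * F (snd (x, y))))) = indicat_real {0..X} x * C" for x
          using F_integral F_nonneg C0 by (simp add: abs_mult)
        moreover have "integrable lborel (\<lambda>x. indicat_real {0..X} x * C)" by (intro integrable_mult_left integrable_real_indicator) (use X in auto)
        ultimately show "integrable lborel (\<lambda>x. LINT y|lborel. norm (indicat_real {0..X} (fst (x, y)) * (C * F (snd (x, y)))))"
          by simp
      qed (use F_integrable in simp)
      then show "integrable lborel (\<lambda>z. indicat_real {0..X} (fst z) * (C * F (snd z)))" unfolding lborel_prod .
      show "AE z in lborel. norm (case z of (x, \<eta>) \<Rightarrow> Q x \<eta>) \<le> norm (indicat_real {0..X} (fst z) * (C * F (snd z)))"
      proof (intro AE_I2)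
        fix z :: "real \<times> vel"
        obtain x \<eta> where z: "z = (x, \<eta>)" by (cases z)
        have fd: "\<bar>fall_jacobian (\<phi>c x) \<eta>\<bar> \<le> 1" using fall_jacobian_bounds[of "\<phi>c x" \<eta>] \<phi>c_range[of x] by simp
        show "norm (case z of (x, \<eta>) \<Rightarrow> Q x \<eta>) \<le> norm (indicat_real {0..X} (fst z) * (C * F (snd z)))"
        proof (cases "x \<in> {0..X}")
          case True
          then have "\<bar>fall_jacobian (\<phi>c x) \<eta> * Gk (x, fall (\<phi>c x) \<eta>)\<bar> \<le> 1 * C"
            unfolding abs_mult using fd GC[of x "fall (\<phi>c x) \<eta>"] by (intro mult_mono) (auto simp: Gk_def)
          then show ?thesis using True abs_mult_le_if[of "fall_jacobian (\<phi>c x) \<eta> * Gk (x, fall (\<phi>c x) \<eta>)" C "F \<eta>"]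
            by (simp add: z Q_def)
        qed (simp add: z Q_def Gk_def)
      qed
    qed (use Qm in simp)
    have "(LINT x|lborel. indicat_real {0..X} x * (LINT \<xi>|lebesgue. transported F \<phi> x \<xi> * G x \<xi>)) = (LINT x|lborel. LINT \<eta>|lborel. Q x \<eta>)"
    proof (rule Bochner_Integration.integral_cong[OF refl])
      fix x :: real
      show "indicat_real {0..X} x * (LINT \<xi>|lebesgue. transported F \<phi> x \<xi> * G x \<xi>) = (LINT \<eta>|lborel. Q x \<eta>)"
      proof (cases "x \<in> {0..X}")
        case True
        then have x: "0 \<le> x" by simp
        note [measurable] = Gm[OF x]
        have "(LINT \<xi>|lebesgue. transported F \<phi> x \<xi> * G x \<xi>) = (LINT \<xi>|lborel. accelerated F (\<phi> x) \<xi> * G x \<xi>)"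
          unfolding transported_eq by (rule integral_completion) measurable
        also have "\<dots> = (LINT \<eta>|lborel. fall_jacobian (\<phi> x) \<eta> * (F \<eta> * G x (fall (\<phi> x) \<eta>)))"
          by (rule accelerated_integral) (use \<phi>_range[OF x] in auto)
        also have "\<dots> = (LINT \<eta>|lborel. Q x \<eta>)"
          using True by (intro Bochner_Integration.integral_cong) (auto simp: Q_def Gk_def max_def)
        finally show ?thesis using True by simp
      qed (simp add: Q_def Gk_def)
    qed
    also have "\<dots> = (LINT \<eta>|lborel. LINT x|lborel. Q x \<eta>)"
      by (rule lborel_pair.Fubini_integral[OF Qi, symmetric])
    also have "\<dots> = (LINT \<eta>::vel|lborel. 0)"
    proof (rule Bochner_Integration.integral_cong[OF refl])
      fix \<eta> :: vel
      show "(LINT x|lborel. Q x \<eta>) = 0"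
      proof (cases "fst \<eta> < 0")
        case False
        then show ?thesis by (simp add: Q_def F_zero)
      next
        case neg: True
        define r where "r x = sqrt ((fst \<eta>)\<^sup>2 + 2 * \<phi> x)" for x
        have rad: "0 < (fst \<eta>)\<^sup>2 + 2 * \<phi> x" if "0 \<le> x" for x using \<phi>_range[OF that] by (simp add: add_nonneg_pos)
        have r: "0 < r x" if "0 \<le> x" for x using rad[OF that] by (simp add: r_def)
        \<comment> \<open>The derivative of \<open>\<eta>\<^sub>1 \<psi>\<close> along the trajectory of \<open>\<eta>\<close>; the velocity there is \<open>\<xi>\<^sub>1 = - r x\<close>.\<close>
        define j where "j x = fst \<eta> * blinfun_apply (D (x, fall (\<phi> x) \<eta>)) (1, (- Dx \<phi> x / r x, 0))" for x
        have path: "((\<lambda>x. (x, fall (\<phi> x) \<eta>)) has_derivative (\<lambda>h. (h, (- Dx \<phi> x / r x * h, 0)))) (at x within {0..X})"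
          if x: "0 \<le> x" for x
        proof -
          have d\<phi>: "(\<phi> has_real_derivative Dx \<phi> x) (at x within {0..X})"
            unfolding Dx_\<phi>[OF x] by (rule has_field_derivative_subset[OF \<phi>_ode[OF x]]) auto
          have "((\<lambda>x. (fst \<eta>)\<^sup>2 + 2 * \<phi> x) has_real_derivative 2 * Dx \<phi> x) (at x within {0..X})"
            by (auto intro!: derivative_eq_intros d\<phi>)
          from DERIV_minus[OF DERIV_chain2[OF DERIV_real_sqrt[OF rad[OF x]] this]]
          have "((\<lambda>x. - sqrt ((fst \<eta>)\<^sup>2 + 2 * \<phi> x)) has_real_derivative - Dx \<phi> x / r x) (at x within {0..X})"
            by (rule DERIV_cong) (simp add: r_def field_simps)
          then have "((\<lambda>x. - sqrt ((fst \<eta>)\<^sup>2 + 2 * \<phi> x)) has_derivative (\<lambda>h. - Dx \<phi> x / r x * h)) (at x within {0..X})"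
            unfolding has_field_derivative_def .
          then show ?thesis unfolding fall_def
            by (intro has_derivative_Pair has_derivative_ident has_derivative_const)
        qed
        have j: "((\<lambda>x. fst \<eta> * \<psi> x (fall (\<phi> x) \<eta>)) has_vector_derivative j x) (at x within {0..X})" if "x \<in> {0..X}" for x
        proof -
          have x: "0 \<le> x" using that by simp
          have "(?\<psi> has_derivative blinfun_apply (D (x, fall (\<phi> x) \<eta>))) (at (x, fall (\<phi> x) \<eta>) within (\<lambda>x. (x, fall (\<phi> x) \<eta>)) ` {0..X})"
            by (rule has_derivative_subset[OF D]) (use x in auto)
          from has_derivative_in_compose[OF path[OF x] this]
          have "((\<lambda>x. \<psi> x (fall (\<phi> x) \<eta>)) has_derivative (\<lambda>h. blinfun_apply (D (x, fall (\<phi> x) \<eta>)) (h, (- Dx \<phi> x / r x * h, 0)))) (at x within {0..X})"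
            by simp
          from has_derivative_mult_right[OF this, of "fst \<eta>"]
          show ?thesis unfolding has_vector_derivative_def
          proof (rule has_derivative_eq_rhs)
            show "(\<lambda>h. fst \<eta> * blinfun_apply (D (x, fall (\<phi> x) \<eta>)) (h, (- Dx \<phi> x / r x * h, 0))) = (\<lambda>h. h *\<^sub>R j x)"
            proof
              fix h :: real
              have "(h, (- Dx \<phi> x / r x * h, 0)) = h *\<^sub>R (1, (- Dx \<phi> x / r x, 0 :: real \<times> real))" by simp
              then show "fst \<eta> * blinfun_apply (D (x, fall (\<phi> x) \<eta>)) (h, (- Dx \<phi> x / r x * h, 0)) = h *\<^sub>R j x"
                by (simp only: blinfun.scaleR_right j_def) simp
            qed
          qed
        qed
        have Qj: "Q x \<eta> = indicat_real {0..X} x * (F \<eta> * j x)" for x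
        proof (cases "x \<in> {0..X}")
          case True
          then have x: "0 \<le> x" by simp
          let ?d = "D (x, fall (\<phi> x) \<eta>)"
          have "blinfun_apply ?d (1, (- Dx \<phi> x / r x, 0)) = blinfun_apply ?d ((1, 0) + (- Dx \<phi> x / r x) *\<^sub>R (0, (1, 0)))" by simp
          also have "\<dots> = px x (fall (\<phi> x) \<eta>) + (- Dx \<phi> x / r x) * pxi x (fall (\<phi> x) \<eta>)"
            unfolding blinfun.add_right blinfun.scaleR_right by (simp add: px_def pxi_def)
          finally have "j x = fst \<eta> * (px x (fall (\<phi> x) \<eta>) + (- Dx \<phi> x / r x) * pxi x (fall (\<phi> x) \<eta>))" by (simp add: j_def)
          moreover have "fall_jacobian (\<phi> x) \<eta> = - fst \<eta> / r x" using neg by (simp add: fall_jacobian_def speed_ratio_def r_def)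
          moreover have "fst (fall (\<phi> x) \<eta>) = - r x" by (simp add: fall_def r_def)
          moreover have "(- fst \<eta> / r x) * ((- r x) * p + d * q) = fst \<eta> * (p + (- d / r x) * q)" for p d q
            using r[OF x] by (simp add: field_simps)
          ultimately have "fall_jacobian (\<phi> x) \<eta> * G x (fall (\<phi> x) \<eta>) = j x"
            by (simp only: G_def)
          then show ?thesis using True by (simp add: Q_def Gk_def max_def)
        qed (simp add: Q_def Gk_def)
        have cfall: "continuous_on {0..X} (\<lambda>x. (x, fall (\<phi> x) \<eta>))"
          unfolding continuous_on_eq_continuous_within by (intro ballI has_derivative_continuous[OF path]) simp
        have cj: "continuous_on {0..X} j"
          unfolding j_def
          by (intro continuous_intros continuous_on_compose2[OF cD cfall] continuous_on_subset[OF continuous_on_Dx\<phi>])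
             (use r rad in \<open>auto simp: r_def intro!: continuous_intros continuous_on_subset[OF continuous_on_\<phi>] less_imp_neq[symmetric]\<close>)
        have "(j has_integral fst \<eta> * \<psi> X (fall (\<phi> X) \<eta>) - fst \<eta> * \<psi> 0 (fall (\<phi> 0) \<eta>)) {0..X}"
          by (rule fundamental_theorem_of_calculus) (use X j in auto)
        moreover have "\<psi> X (fall (\<phi> X) \<eta>) = 0"
          using K_in[of X "fall (\<phi> X) \<eta>"] K_box[of X "fall (\<phi> X) \<eta>"] X by (auto simp: X_def)
        moreover have "\<psi> 0 (fall (\<phi> 0) \<eta>) = 0"
          using wall[of "r 0" "snd \<eta>"] r[of 0] by (simp add: fall_def r_def)
        ultimately have j0: "integral {0..X} j = 0" by (simp add: integral_unique)
        have "(LINT x|lborel. Q x \<eta>) = (LINT x|lborel. F \<eta> * (indicat_real {0..X} x * j x))"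
          unfolding Qj by (simp add: mult.left_commute)
        also have "\<dots> = F \<eta> * (LINT x|lborel. indicat_real {0..X} x * j x)" by simp
        also have "(LINT x|lborel. indicat_real {0..X} x * j x) = integral {0..X} j"
          using set_borel_integral_eq_integral(2)[OF borel_integrable_atLeastAtMost'[OF cj]]
          by (simp add: set_lebesgue_integral_def)
        finally show ?thesis using j0 by simp
      qed
    qed
    finally show ?thesis by simp
  qed
  finally show "(LINT (x, \<xi>) : {0<..} \<times> UNIV | lebesgue. transported F \<phi> x \<xi> * (fst \<xi> * partial_x \<psi> x \<xi> + Dx \<phi> x * partial_xi1 \<psi> x \<xi>)) +
     (LINT \<xi> : {\<xi>. fst \<xi> > 0} | lebesgue. 0 * (fst \<xi> * \<psi> 0 \<xi>)) = 0"
    by (simp add: set_lebesgue_integral_def)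
qed

lemma transported_solution: "VP_solution n\<^sub>e 0 (\<lambda>_. 0) b F (transported F \<phi>) \<phi>"
  unfolding VP_solution_def
proof (intro conjI allI impI)
  show "L1_loc (transported F \<phi>)" "C_L1 (transported F \<phi>)" "C1_on {0..} \<phi>" "C2_on {0<..} \<phi>"
    by (rule transported_L1_loc transported_C_L1 \<phi>_C1 \<phi>_C2_open)+
  show "AE \<xi> in lebesgue. 0 \<le> transported F \<phi> x \<xi>" for x
    by (simp add: transported_eq accelerated_nonneg)
  have "Dx \<phi> x < 0" if "0 \<le> x" for x using Dx_\<phi>[OF that] V_pos[OF that] by simp
  then show "(\<forall>x\<ge>0. Dx \<phi> x > 0) \<or> (\<forall>x\<ge>0. Dx \<phi> x < 0)" by blast
  show "weak_Vlasov 0 (\<lambda>_. 0) (transported F \<phi>) \<phi>" by (rule transported_weak)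
  show "((\<lambda>x. LINT \<xi>|lebesgue. \<bar>transported F \<phi> x \<xi> - F \<xi>\<bar>) \<longlongrightarrow> 0) at_top" by (rule transported_limit)
  show "Dx (Dx \<phi>) x = (LINT \<xi>|lebesgue. transported F \<phi> x \<xi>) - n\<^sub>e (\<phi> x)" if "0 < x" for x
    using DDx_\<phi>[of x] slice_mass[of x] that by (simp add: transported_eq)
  show "\<phi> 0 = b" by (rule \<phi>_0)
  show "(\<phi> \<longlongrightarrow> 0) at_top" by (rule \<phi>_limit)
qed

text \<open>The derivatives are \<open>- sqrt (2 V(\<phi>))\<close> and \<open>V'(\<phi>)\<close>, and both are at most a multiple of \<open>\<phi>\<close>.\<close>

lemma decay:
  assumes "Bohm_integral F < 1"
  shows "\<exists>c>0. \<exists>C>0. \<forall>l\<le>2. \<forall>x\<ge>0. \<bar>(Dx ^^ l) \<phi> x\<bar> \<le> C * exp (- c * x)"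
proof -
  have b0: "0 < b" using b by (simp add: Bset_def)
  obtain k where k: "0 < k" "\<And>s. s \<in> {0..b} \<Longrightarrow> k * s\<^sup>2 \<le> V s" using V_ge_quadratic[OF assms b] by blast
  obtain K where K: "0 < K" "\<And>s. s \<in> {0..b} \<Longrightarrow> V s \<le> K * s\<^sup>2" using V_le_quadratic by blast
  obtain L where L: "0 < L" "\<And>s. s \<in> {0..b} \<Longrightarrow> \<bar>net_density s\<bar> \<le> L * s" using net_density_linear_bound[OF assms] by blast
  define c where "c = sqrt (2 * k)"
  define A where "A = 1 + sqrt (2 * K) + L"
  have c: "0 < c" using k by (simp add: c_def)
  have A: "1 \<le> A" "sqrt (2 * K) \<le> A" "L \<le> A" using K L by (auto simp: A_def)
  have in_b: "\<phi> x \<in> {0..b}" if "0 \<le> x" for x using \<phi>_range[OF that] by simp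
  have e: "\<phi> x \<le> b * exp (- c * x)" if "0 \<le> x" for x
    using exponential_decay[of \<phi> V k x, OF \<phi>_ode] \<phi>_range k in_b that by (simp add: \<phi>_0 c_def less_imp_le)
  have "\<bar>(Dx ^^ l) \<phi> x\<bar> \<le> A * \<phi> x" if l: "l \<le> 2" and x: "0 \<le> x" for l :: nat and x
  proof -
    have p: "0 < \<phi> x" using \<phi>_range[OF x] by simp
    have mono: "m * \<phi> x \<le> A * \<phi> x" if "m \<le> A" for m using p that by simp
    consider "l = 0" | "l = 1" | "l = 2" using l by linarith
    then show ?thesis
    proof cases
      case 1 then show ?thesis using mono[OF A(1)] p by simp
    next
      case 2
      have "sqrt (2 * V (\<phi> x)) \<le> sqrt (2 * (K * (\<phi> x)\<^sup>2))" using K(2)[OF in_b[OF x]] by simp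
      also have "\<dots> = sqrt (2 * K) * \<phi> x" using p by (simp add: real_sqrt_mult)
      finally show ?thesis using mono[OF A(2)] 2 Dx_\<phi>[OF x] V_pos[OF x] by simp
    next
      case 3
      then have "(Dx ^^ l) \<phi> x = net_density (\<phi> x)" using DDx_\<phi>[OF x] by (simp add: numeral_2_eq_2)
      then show ?thesis using L(2)[OF in_b[OF x]] mono[OF A(3)] by simp
    qed
  qed
  moreover have "A * \<phi> x \<le> (A * b) * exp (- c * x)" if "0 \<le> x" for x
    using mult_left_mono[OF e[OF that], of A] A by simp
  ultimately have "\<bar>(Dx ^^ l) \<phi> x\<bar> \<le> (A * b) * exp (- c * x)" if "l \<le> 2" "0 \<le> x" for l :: nat and x
    using that order_trans by blast
  moreover have "0 < A * b" using A b0 by simp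
  ultimately show ?thesis using c by blast
qed

end

context far_field begin

lemma sheath_unique_existence:
  assumes b: "b \<in> Bset n\<^sub>e F"
  shows "\<exists>\<phi>. sheath n\<^sub>e F b \<phi> \<and> (\<forall>\<eta>. sheath n\<^sub>e F b \<eta> \<longrightarrow> (\<forall>x\<ge>0. \<eta> x = \<phi> x))"
proof -
  have b0: "0 < b" using b by (simp add: Bset_def)
  \<comment> \<open>The quadrature starts beyond \<open>b\<close>, which makes the wall an interior point of its domain.\<close>
  obtain b' where b': "b < b'" "b' \<in> Bset n\<^sub>e F" using Bset_extend[OF b] by blast
  obtain C where C: "0 < C" "\<And>s. s \<in> {0..b'} \<Longrightarrow> V s \<le> C * s\<^sup>2" using V_le_quadratic by blast
  interpret quadrature V b b' C
    by unfold_locales (use b0 b' C continuous_on_V in \<open>auto simp: Bset_def\<close>)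
  have "sheath n\<^sub>e F b \<Phi>"
    by unfold_locales (use assms \<Phi>_0 \<Phi>_range \<Phi>_DERIV \<Phi>_tendsto_0 in \<open>auto intro: has_field_derivative_at_within\<close>)
  moreover have "\<eta> x = \<Phi> x" if "sheath n\<^sub>e F b \<eta>" "0 \<le> x" for \<eta> x
  proof -
    interpret e: sheath n\<^sub>e F b \<eta> by (rule that(1))
    show ?thesis by (rule solution_unique[OF e.\<phi>_ode e.\<phi>_range e.\<phi>_0 that(2)])
  qed
  ultimately show ?thesis by blast
qed

end

context given_solution begin

lemma sheath_solution: "sheath n\<^sub>e F \<phi>\<^sub>b \<phi>"
proof unfold_locales
  show "(\<phi> has_real_derivative - sqrt (2 * V (\<phi> x))) (at x within {0..})" if "0 \<le> x" for x
    using \<phi>_deriv[OF that] Dx\<phi>_eq[OF that] by simp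
qed (use \<phi>\<^sub>b_in_Bset \<phi>_0 \<phi>_pos \<phi>_le \<phi>_limit in auto)

end

section \<open>Classical solutions\<close>

lemma C1_on_Pair:
  fixes f :: "'a::real_normed_vector \<Rightarrow> 'b::real_normed_vector" and g :: "'a \<Rightarrow> 'c::real_normed_vector"
  assumes "C1_on S f" and "C1_on S g"
  shows "C1_on S (\<lambda>x. (f x, g x))"
proof -
  have "C1_on S (\<lambda>x. (f x, 0) + (0, g x))"
    by (intro C1_on_add C1_on_linear_compose[OF _ assms(1)] C1_on_linear_compose[OF _ assms(2)]
        bounded_linear_Pair bounded_linear_ident bounded_linear_zero)
  then show ?thesis by simp
qed

text \<open>On the open half-space the function is constant; continuity of the derivative includes the boundary.\<close>

lemma derivative_zero_closed_half_space:
  fixes g :: "vel \<Rightarrow> 'b::real_normed_vector"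
  assumes d: "\<And>z. (g has_derivative blinfun_apply (g' z)) (at z)" and c: "continuous_on UNIV g'"
    and zero: "\<And>z. 0 < fst z \<Longrightarrow> g z = 0" and z: "0 \<le> fst z"
  shows "g' z = 0"
proof -
  have pos: "g' w = 0" if "0 < fst w" for w
  proof -
    have "open {w::vel. 0 < fst w}" by (intro open_Collect_less continuous_intros)
    then have "(g has_derivative (\<lambda>_. 0)) (at w)"
      by (intro has_derivative_transform_within_open[OF has_derivative_const[of 0]]) (use that zero in auto)
    from has_derivative_unique[OF d this] show ?thesis by (intro blinfun_eqI) simp
  qed
  have "(\<lambda>n. g' (fst z + 1 / real (Suc n), snd z)) \<longlonglongrightarrow> g' z"
  proof (rule continuous_on_tendsto_compose[OF c])
    have "(\<lambda>n. fst z + 1 / real (Suc n)) \<longlonglongrightarrow> fst z + 0"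
      by (intro tendsto_add tendsto_const LIMSEQ_Suc lim_1_over_n)
    then have "(\<lambda>n. (fst z + 1 / real (Suc n), snd z)) \<longlonglongrightarrow> (fst z, snd z)"
      by (intro tendsto_Pair tendsto_const) simp
    then show "(\<lambda>n. (fst z + 1 / real (Suc n), snd z)) \<longlonglongrightarrow> z" by simp
  qed auto
  moreover have "g' (fst z + 1 / real (Suc n), snd z) = 0" for n
  proof (rule pos)
    have "0 < 1 / real (Suc n)" by simp
    then show "0 < fst (fst z + 1 / real (Suc n), snd z)" using z by (simp only: fst_conv)
  qed
  ultimately have "(\<lambda>n. 0) \<longlonglongrightarrow> g' z" by simp
  then show ?thesis by (simp add: LIMSEQ_const_iff)
qed

lemma continuous_on_radial_integral:
  fixes q :: "vel \<Rightarrow> real"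
  assumes "continuous_on UNIV q"
  shows "continuous_on UNIV (\<lambda>z. integral {0..1} (\<lambda>t. t ^ m * q (t * fst z, snd z)))"
proof -
  have "continuous_on (UNIV \<times> cbox 0 1) (\<lambda>(z, t). t ^ m * q (t * fst z, snd z))"
    unfolding case_prod_beta
    by (intro continuous_intros continuous_on_compose2[OF assms]) auto
  from integral_continuous_on_param[OF this] show ?thesis by (simp add: cbox_interval)
qed

text \<open>A \<open>C\<^sup>2\<close> function that vanishes for \<open>\<eta> \<ge> 0\<close> is a \<open>C\<^sup>1\<close> function of \<open>\<eta>\<^sup>2\<close> for \<open>\<eta> \<le> 0\<close>: with
  Taylor's formula \<open>F = \<eta>\<^sup>2 R\<close> and \<open>\<partial>F = \<eta> Q\<close>, where \<open>Q\<close> and \<open>R\<close> are continuous and vanish at \<open>\<eta> = 0\<close>,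
  the chain rule gives the derivative \<open>Q / 2\<close> with respect to \<open>\<eta>\<^sup>2\<close>.\<close>

lemma C1_in_squared_speed:
  fixes F :: "vel \<Rightarrow> real"
  assumes C2: "C2_on UNIV F" and zero: "\<And>z. 0 \<le> fst z \<Longrightarrow> F z = 0"
  defines "h \<equiv> \<lambda>z. F (- sqrt (max 0 (fst z)), snd z)"
  obtains A L where "continuous_on UNIV A" and "continuous_on UNIV L"
    and "\<And>z. (h has_derivative (\<lambda>v. A z * fst v + blinfun_apply (L z) (0::real, snd v))) (at z)"
    and "\<And>z. fst z \<le> 0 \<Longrightarrow> A z = 0"
proof -
  obtain F' where F': "\<And>z. (F has_derivative blinfun_apply (F' z)) (at z)" and C1: "C1_on UNIV F'"
    using C2 unfolding C2_on_def by auto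
  obtain F'' where F'': "\<And>z. (F' has_derivative blinfun_apply (F'' z)) (at z)" and cF'': "continuous_on UNIV F''"
    using C1 unfolding C1_on_def by auto
  have cF': "continuous_on UNIV F'" by (rule C1_on_imp_continuous[OF C1])
  have F'0: "F' z = 0" if "0 \<le> fst z" for z
    by (rule derivative_zero_closed_half_space[OF F' cF' zero that]) simp
  have F''0: "F'' z = 0" if "0 \<le> fst z" for z
    by (rule derivative_zero_closed_half_space[OF F'' cF'' F'0 that]) simp
  define k where "k z = blinfun_apply (F' z) (1, 0)" for z
  define q where "q z = blinfun_apply (blinfun_apply (F'' z) (1, 0)) (1, 0)" for z
  have ck: "continuous_on UNIV k" unfolding k_def by (intro continuous_intros cF')
  have cq: "continuous_on UNIV q" unfolding q_def by (intro continuous_intros cF'')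
  define Q where "Q z = integral {0..1} (\<lambda>t. t ^ 0 * q (t * fst z, snd z))" for z
  have cQ: "continuous_on UNIV Q" unfolding Q_def by (rule continuous_on_radial_integral[OF cq])
  define R where "R z = integral {0..1} (\<lambda>t. t ^ 1 * Q (t * fst z, snd z))" for z
  have cR: "continuous_on UNIV R" unfolding R_def by (rule continuous_on_radial_integral[OF cQ])
  have Q0: "Q z = 0" if "fst z = 0" for z using that F''0 by (simp add: Q_def q_def)
  have R0: "R z = 0" if "fst z = 0" for z using that Q0 by (simp add: R_def)
  have line: "((\<lambda>t. (t * a, y)) has_derivative (\<lambda>h. (h * a, 0))) (at t within T)" for a t :: real and T and y :: "real \<times> real"
    by (intro has_derivative_Pair has_derivative_mult_left has_derivative_ident has_derivative_const)
  have kQ: "k z = fst z * Q z" for z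
  proof -
    let ?g = "\<lambda>t. k (t * fst z, snd z)"
    have "(?g has_vector_derivative fst z * q (t * fst z, snd z)) (at t within {0..1})" for t
    proof -
      have "((\<lambda>t. F' (t * fst z, snd z)) has_derivative (\<lambda>h. blinfun_apply (F'' (t * fst z, snd z)) (h * fst z, 0))) (at t within {0..1})"
        by (rule has_derivative_compose[OF line F''])
      from bounded_linear.has_derivative[OF blinfun.bounded_linear_left this, of "(1, 0)"]
      have "(?g has_derivative (\<lambda>h. blinfun_apply (blinfun_apply (F'' (t * fst z, snd z)) (h * fst z, 0)) (1, 0))) (at t within {0..1})"
        by (simp add: k_def)
      then show ?thesis unfolding has_vector_derivative_def
      proof (rule has_derivative_eq_rhs)
        show "(\<lambda>h. blinfun_apply (blinfun_apply (F'' (t * fst z, snd z)) (h * fst z, 0)) (1, 0)) = (\<lambda>h. h *\<^sub>R (fst z * q (t * fst z, snd z)))"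
        proof
          fix h :: real
          have "(h * fst z, 0) = (h * fst z) *\<^sub>R (1, 0 :: real \<times> real)" by simp
          then show "blinfun_apply (blinfun_apply (F'' (t * fst z, snd z)) (h * fst z, 0)) (1, 0) = h *\<^sub>R (fst z * q (t * fst z, snd z))"
            by (simp only: blinfun.scaleR_right blinfun.scaleR_left q_def) simp
        qed
      qed
    qed
    then have "((\<lambda>t. fst z * q (t * fst z, snd z)) has_integral ?g 1 - ?g 0) {0..1}"
      by (intro fundamental_theorem_of_calculus) auto
    then have "integral {0..1} (\<lambda>t. fst z * q (t * fst z, snd z)) = k z - k (0, snd z)"
      by (intro integral_unique) simp
    moreover have "k (0, snd z) = 0" using F'0 by (simp add: k_def)
    ultimately show ?thesis by (simp add: Q_def)
  qed
  have FR: "F z = (fst z)\<^sup>2 * R z" for z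
  proof -
    let ?g = "\<lambda>t. F (t * fst z, snd z)"
    have "(?g has_vector_derivative (fst z)\<^sup>2 * (t * Q (t * fst z, snd z))) (at t within {0..1})" for t
    proof -
      have "(?g has_derivative (\<lambda>h. blinfun_apply (F' (t * fst z, snd z)) (h * fst z, 0))) (at t within {0..1})"
        by (rule has_derivative_compose[OF line F'])
      then show ?thesis unfolding has_vector_derivative_def
      proof (rule has_derivative_eq_rhs)
        show "(\<lambda>h. blinfun_apply (F' (t * fst z, snd z)) (h * fst z, 0)) = (\<lambda>h. h *\<^sub>R ((fst z)\<^sup>2 * (t * Q (t * fst z, snd z))))"
        proof
          fix h :: real
          have "(h * fst z, 0) = (h * fst z) *\<^sub>R (1, 0 :: real \<times> real)" by simp
          then have "blinfun_apply (F' (t * fst z, snd z)) (h * fst z, 0) = h * fst z * k (t * fst z, snd z)"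
            by (simp only: blinfun.scaleR_right k_def) simp
          then show "blinfun_apply (F' (t * fst z, snd z)) (h * fst z, 0) = h *\<^sub>R ((fst z)\<^sup>2 * (t * Q (t * fst z, snd z)))"
            by (simp add: kQ power2_eq_square)
        qed
      qed
    qed
    then have "((\<lambda>t. (fst z)\<^sup>2 * (t * Q (t * fst z, snd z))) has_integral ?g 1 - ?g 0) {0..1}"
      by (intro fundamental_theorem_of_calculus) auto
    then have "integral {0..1} (\<lambda>t. (fst z)\<^sup>2 * (t * Q (t * fst z, snd z))) = F z - F (0, snd z)"
      by (intro integral_unique) simp
    then show ?thesis using zero[of "(0, snd z)"] by (simp add: R_def)
  qed
  define e where "e z = (- sqrt (max 0 (fst z)), snd z)" for z :: vel
  have ce: "continuous_on UNIV e" unfolding e_def by (intro continuous_intros)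
  define A where "A z = Q (e z) / 2" for z
  define L where "L z = F' (e z)" for z
  have cA: "continuous_on UNIV A" unfolding A_def by (intro continuous_intros continuous_on_compose2[OF cQ ce]) auto
  have cL: "continuous_on UNIV L" unfolding L_def by (rule continuous_on_compose2[OF cF' ce]) auto
  have A0: "A z = 0" if "fst z \<le> 0" for z using that by (auto simp: A_def e_def intro!: Q0)
  have L0: "L z = 0" if "fst z \<le> 0" for z using that by (auto simp: L_def e_def intro!: F'0)
  \<comment> \<open>At \<open>fst z = 0\<close> the difference quotients of \<open>h\<close> are bounded by \<open>R\<close>, which is continuous and vanishes there.\<close>
  have h_R: "h z = max 0 (fst z) * R (e z)" for z
    by (simp add: h_def FR[of "(- sqrt (max 0 (fst z)), snd z)"] e_def)
  have "(h has_derivative (\<lambda>v. A z * fst v + blinfun_apply (L z) (0::real, snd v))) (at z)" for z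
  proof -
    consider "0 < fst z" | "fst z < 0" | "fst z = 0" by linarith
    then show ?thesis
    proof cases
      case 1
      have "((\<lambda>z. sqrt (fst z)) has_derivative (\<lambda>v. fst v * (inverse (sqrt (fst z)) / 2))) (at z)"
        by (rule has_derivative_real_sqrt[where g = fst and x = z, OF 1]) (intro has_derivative_fst has_derivative_ident)
      then have "((\<lambda>z. (- sqrt (fst z), snd z)) has_derivative (\<lambda>v. (- (fst v * (inverse (sqrt (fst z)) / 2)), snd v))) (at z)"
        by (intro has_derivative_Pair has_derivative_minus has_derivative_snd has_derivative_ident)
      from has_derivative_compose[OF this F']
      have "((\<lambda>z. F (- sqrt (fst z), snd z)) has_derivative (\<lambda>v. blinfun_apply (F' (- sqrt (fst z), snd z)) (- (fst v * (inverse (sqrt (fst z)) / 2)), snd v))) (at z)" .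
      then have "(h has_derivative (\<lambda>v. blinfun_apply (F' (- sqrt (fst z), snd z)) (- (fst v * (inverse (sqrt (fst z)) / 2)), snd v))) (at z)"
      proof (rule has_derivative_transform_within_open)
        show "open {z::vel. 0 < fst z}" by (intro open_Collect_less continuous_intros)
      qed (use 1 in \<open>auto simp: h_def\<close>)
      then show ?thesis
      proof (rule has_derivative_eq_rhs)
        show "(\<lambda>v. blinfun_apply (F' (- sqrt (fst z), snd z)) (- (fst v * (inverse (sqrt (fst z)) / 2)), snd v))
          = (\<lambda>v. A z * fst v + blinfun_apply (L z) (0, snd v))"
        proof
          fix v :: vel
          let ?D = "F' (- sqrt (fst z), snd z)" and ?c = "- (fst v * (inverse (sqrt (fst z)) / 2))"
          have "blinfun_apply ?D (?c, snd v) = blinfun_apply ?D (?c *\<^sub>R (1, 0) + (0, snd v))" by simp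
          also have "\<dots> = ?c * k (- sqrt (fst z), snd z) + blinfun_apply ?D (0, snd v)"
            unfolding blinfun.add_right blinfun.scaleR_right by (simp add: k_def)
          also have "?c * k (- sqrt (fst z), snd z) = A z * fst v"
            using 1 by (simp add: kQ A_def e_def field_simps)
          also have "blinfun_apply ?D (0, snd v) = blinfun_apply (L z) (0, snd v)" using 1 by (simp add: L_def e_def)
          finally show "blinfun_apply ?D (?c, snd v) = A z * fst v + blinfun_apply (L z) (0, snd v)" .
        qed
      qed
    next
      case 2
      have "open {z::vel. fst z < 0}" by (intro open_Collect_less continuous_intros)
      then have "(h has_derivative (\<lambda>_. 0)) (at z)"
        by (intro has_derivative_transform_within_open[OF has_derivative_const[of 0]])
           (use 2 in \<open>auto simp: h_def zero\<close>)
      then show ?thesis using 2 A0[of z] L0[of z] by simp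
    next
      case 3
      have "(h has_derivative (\<lambda>_. 0)) (at z)"
        unfolding has_derivative_at
      proof
        have lim: "(\<lambda>v. R (e (z + v))) \<midarrow>0\<rightarrow> R (e (z + 0))"
        proof -
          have "continuous_on UNIV (\<lambda>v. R (e (z + v)))"
            by (rule continuous_on_compose2[OF cR continuous_on_compose2[OF ce]]) (auto intro!: continuous_intros)
          then show ?thesis unfolding continuous_on_def by (rule bspec[OF _ UNIV_I])
        qed
        have Rz: "R (e (z + 0)) = 0" using 3 by (auto simp: e_def intro!: R0)
        show "(\<lambda>v. norm (h (z + v) - h z - 0) / norm v) \<midarrow>0\<rightarrow> 0"
        proof (rule Lim_null_comparison)
          show "\<forall>\<^sub>F v in at 0. norm (norm (h (z + v) - h z - 0) / norm v) \<le> \<bar>R (e (z + v))\<bar>"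
          proof (intro always_eventually allI)
            fix v :: vel
            have hz: "h z = 0" using 3 by (simp add: h_R)
            have "\<bar>h (z + v)\<bar> = max 0 (fst v) * \<bar>R (e (z + v))\<bar>" using 3 by (simp add: h_R abs_mult)
            also have "\<dots> \<le> norm v * \<bar>R (e (z + v))\<bar>"
              using norm_fst_le[of "fst v" "snd v"] by (intro mult_right_mono) auto
            finally show "norm (norm (h (z + v) - h z - 0) / norm v) \<le> \<bar>R (e (z + v))\<bar>"
              using hz by (cases "v = 0") (auto simp: divide_le_eq mult.commute)
          qed
          show "(\<lambda>v. \<bar>R (e (z + v))\<bar>) \<midarrow>0\<rightarrow> 0" using tendsto_rabs[OF lim] Rz by simp
        qed
      qed simp
      then show ?thesis using 3 A0[of z] L0[of z] by simp
    qed
  qed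
  then show thesis using that[of A L] cA cL A0 by blast
qed

context sheath begin

lemma transported_classical:
  assumes C2: "C2_on UNIV F"
  shows "VP_classical_solution n\<^sub>e 0 (\<lambda>_. 0) b F (transported F \<phi>) \<phi>"
proof -
  define h where "h z = F (- sqrt (max 0 (fst z)), snd z)" for z
  obtain A L where cA: "continuous_on UNIV A" and cL: "continuous_on UNIV L"
    and dh: "\<And>z. (h has_derivative (\<lambda>v. A z * fst v + blinfun_apply (L z) (0::real, snd v))) (at z)"
    and A0: "\<And>z. fst z \<le> 0 \<Longrightarrow> A z = 0"
    using C1_in_squared_speed[OF C2 F_zero] unfolding h_def[abs_def] by blast
  \<comment> \<open>Cutting the square off at \<open>\<xi>\<^sub>1 = 0\<close> puts all \<open>\<xi>\<^sub>1 \<ge> 0\<close> at negative energy, where the density vanishes. This makes the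
  transported density one composition of \<open>C\<^sup>1\<close> maps.\<close>
  define m where "m t = (max 0 (- t))\<^sup>2" for t :: real
  have dm: "(m has_real_derivative - (2 * max 0 (- t))) (at t)" for t
  proof -
    have "((\<lambda>t::real. - t) has_real_derivative -1) (at t)" by (auto intro!: derivative_eq_intros)
    from DERIV_chain2[OF has_derivative_max_sq this] show ?thesis unfolding m_def[abs_def] by simp
  qed
  have th: "transported F \<phi> x \<xi> = h (m (fst \<xi>) - 2 * \<phi> x, snd \<xi>)" if x: "0 \<le> x" for x \<xi>
  proof (cases "fst \<xi> < 0")
    case True
    then have mx: "m (fst \<xi>) = (fst \<xi>)\<^sup>2" by (simp add: m_def)
    show ?thesis
    proof (cases "2 * \<phi> x < (fst \<xi>)\<^sup>2")
      case E: True
      then show ?thesis using True by (simp add: transported_def h_def mx)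
    next
      case False
      then show ?thesis using F_zero[of "(0, snd \<xi>)"] by (simp add: transported_def h_def mx)
    qed
  next
    case False
    then have "m (fst \<xi>) - 2 * \<phi> x \<le> 0" using \<phi>_range[OF x] by (simp add: m_def)
    then show ?thesis using False F_zero[of "(0, snd \<xi>)"] by (simp add: transported_def h_def)
  qed
  define iv :: "vel \<Rightarrow>\<^sub>L vel" where "iv = Blinfun (\<lambda>v. (0, snd v))"
  define iw :: "vel \<Rightarrow>\<^sub>L real" where "iw = Blinfun fst"
  have iv: "blinfun_apply iv = (\<lambda>v. (0, snd v))" and iw: "blinfun_apply iw = fst"
    unfolding iv_def iw_def
    by (auto intro!: bounded_linear_Blinfun_apply bounded_linear_Pair bounded_linear_zero bounded_linear_snd bounded_linear_fst)
  have C1h: "C1_on UNIV h"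
  proof (rule C1_onI)
    show "(h has_derivative blinfun_apply (A z *\<^sub>R iw + (L z o\<^sub>L iv))) (at z within UNIV)" for z
      by (rule has_derivative_eq_rhs[OF dh]) (auto simp: blinfun.add_left blinfun.scaleR_left iv iw)
    show "continuous_on UNIV (\<lambda>z. A z *\<^sub>R iw + (L z o\<^sub>L iv))"
      by (intro continuous_intros cA bounded_bilinear.continuous_on[OF bounded_bilinear_blinfun_compose] cL)
  qed
  have C1m: "C1_on UNIV m"
    by (rule C1_on_real[OF dm]) (auto intro!: continuous_intros)
  have C1\<phi>: "C1_on ({0..} \<times> UNIV) (\<lambda>z::real \<times> vel. \<phi> (fst z))"
    by (rule C1_on_compose[OF C1_on_bounded_linear[OF bounded_linear_fst] \<phi>_C1]) auto
  have "C1_on ({0..} \<times> UNIV) (\<lambda>z::real \<times> vel. h (m (fst (snd z)) - (2::real) * \<phi> (fst z), snd (snd z)))"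
  proof (rule C1_on_compose[OF _ C1h])
    show "C1_on ({0..} \<times> UNIV) (\<lambda>z::real \<times> vel. (m (fst (snd z)) - (2::real) * \<phi> (fst z), snd (snd z)))"
      by (intro C1_on_Pair C1_on_diff C1_on_mult C1_on_const C1\<phi> C1_on_compose[OF _ C1m] C1_on_bounded_linear
          bounded_linear_fst_comp bounded_linear_snd_comp bounded_linear_snd bounded_linear_ident) auto
  qed simp
  then have C1t: "C1_on ({0..} \<times> UNIV) (\<lambda>(x, \<xi>). transported F \<phi> x \<xi>)"
    by (rule C1_on_cong) (auto simp: th)
  have pde: "fst \<xi> * partial_x (transported F \<phi>) x \<xi> + Dx \<phi> x * partial_xi1 (transported F \<phi>) x \<xi> = 0"
    if x: "0 < x" for x \<xi>
  proof -
    let ?s = "(m (fst \<xi>) - 2 * \<phi> x, snd \<xi>)"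
    have d\<phi>: "(\<phi> has_real_derivative Dx \<phi> x) (at x)"
      using \<phi>_ode[of x] Dx_\<phi>[of x] x at_within_half_line[OF x] by simp
    have chain: "((\<lambda>t. h (g t, snd \<xi>)) has_real_derivative A ?s * g') (at t)"
      if g: "(g has_real_derivative g') (at t)" and gt: "g t = m (fst \<xi>) - 2 * \<phi> x" for g g' t
    proof -
      have "((\<lambda>t. (g t, snd \<xi>)) has_derivative (\<lambda>v. (g' * v, 0))) (at t)"
        using g unfolding has_field_derivative_def by (intro has_derivative_Pair has_derivative_const)
      from has_derivative_compose[OF this dh]
      have "((\<lambda>t. h (g t, snd \<xi>)) has_derivative (\<lambda>v. A ?s * (g' * v) + blinfun_apply (L ?s) (0, 0))) (at t)"
        by (simp add: gt)
      moreover have "blinfun_apply (L ?s) (0, 0) = 0" by (simp flip: zero_prod_def)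
      ultimately show ?thesis unfolding has_field_derivative_def
        by (elim has_derivative_eq_rhs) (simp add: fun_eq_iff mult.assoc)
    qed
    have "((\<lambda>y. m (fst \<xi>) - 2 * \<phi> y) has_real_derivative - (2 * Dx \<phi> x)) (at x)"
      by (auto intro!: derivative_eq_intros d\<phi>)
    from chain[OF this] have "((\<lambda>y. h (m (fst \<xi>) - 2 * \<phi> y, snd \<xi>)) has_real_derivative A ?s * - (2 * Dx \<phi> x)) (at x)" by simp
    then have "((\<lambda>y. transported F \<phi> y \<xi>) has_real_derivative A ?s * - (2 * Dx \<phi> x)) (at x)"
      by (rule has_field_derivative_transform_within_open[of _ _ _ "{0<..}"]) (use x in \<open>auto simp: th\<close>)
    then have px: "partial_x (transported F \<phi>) x \<xi> = A ?s * - (2 * Dx \<phi> x)"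
      unfolding partial_x_def by (rule DERIV_imp_deriv)
    have "((\<lambda>s. m s - 2 * \<phi> x) has_real_derivative - (2 * max 0 (- fst \<xi>))) (at (fst \<xi>))"
      by (auto intro!: derivative_eq_intros dm)
    from chain[OF this] have "((\<lambda>s. h (m s - 2 * \<phi> x, snd \<xi>)) has_real_derivative A ?s * - (2 * max 0 (- fst \<xi>))) (at (fst \<xi>))" by simp
    then have pxi: "partial_xi1 (transported F \<phi>) x \<xi> = A ?s * - (2 * max 0 (- fst \<xi>))"
      unfolding partial_xi1_def using x by (simp add: th DERIV_imp_deriv)
    show ?thesis
    proof (cases "fst \<xi> \<le> 0")
      case True
      then show ?thesis unfolding px pxi by (simp add: max_def)
    next
      case False
      then have "A ?s = 0" using \<phi>_range[of x] x by (intro A0) (simp add: m_def)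
      then show ?thesis unfolding px pxi by simp
    qed
  qed
  have lim: "((\<lambda>x. transported F \<phi> x \<xi>) \<longlongrightarrow> F \<xi>) at_top" for \<xi>
  proof -
    have "((\<lambda>x. (m (fst \<xi>) - 2 * \<phi> x, snd \<xi>)) \<longlongrightarrow> (m (fst \<xi>) - 2 * 0, snd \<xi>)) at_top"
      by (intro tendsto_intros \<phi>_limit)
    from continuous_on_tendsto_compose[OF C1_on_imp_continuous[OF C1h] this]
    have 1: "((\<lambda>x. h (m (fst \<xi>) - 2 * \<phi> x, snd \<xi>)) \<longlongrightarrow> h (m (fst \<xi>), snd \<xi>)) at_top" by simp
    have 2: "h (m (fst \<xi>), snd \<xi>) = F \<xi>"
      using F_zero[of \<xi>] F_zero[of "(0, snd \<xi>)"] by (cases "fst \<xi> < 0") (auto simp: h_def m_def)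
    have 3: "\<forall>\<^sub>F x in at_top. h (m (fst \<xi>) - 2 * \<phi> x, snd \<xi>) = transported F \<phi> x \<xi>"
      by (rule eventually_mono[OF eventually_ge_at_top[of "0::real"]]) (simp add: th)
    show ?thesis by (rule Lim_transform_eventually[OF 1[unfolded 2] 3])
  qed
  show ?thesis
    unfolding VP_classical_solution_def
  proof (intro conjI allI impI)
    show "integrable lebesgue (transported F \<phi> x)" if "0 < x" for x
      unfolding transported_eq using integrable_slice[of x] that by simp
    show "Dx (Dx \<phi>) x = (LINT \<xi>|lebesgue. transported F \<phi> x \<xi>) - n\<^sub>e (\<phi> x)" if "0 < x" for x
      using DDx_\<phi>[of x] slice_mass[of x] that by (simp add: transported_eq)
    show "transported F \<phi> 0 (\<xi>\<^sub>1, \<xi>') = 0 + 0 * transported F \<phi> 0 (- \<xi>\<^sub>1, \<xi>')" if "0 < \<xi>\<^sub>1" for \<xi>\<^sub>1 \<xi>'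
      using that by (simp add: transported_def)
  qed (use C1t \<phi>_C2 pde \<phi>_0 lim \<phi>_limit in auto)
qed

end

section \<open>Unique solvability\<close>

context far_field begin

lemma unique_solution_iff_Bset:
  assumes "0 < \<phi>\<^sub>b"
  shows "VP_unique_solution n\<^sub>e 0 (\<lambda>_. 0) \<phi>\<^sub>b F \<longleftrightarrow> \<phi>\<^sub>b \<in> Bset n\<^sub>e F"
proof
  assume "VP_unique_solution n\<^sub>e 0 (\<lambda>_. 0) \<phi>\<^sub>b F"
  then obtain f \<phi> where "VP_solution n\<^sub>e 0 (\<lambda>_. 0) \<phi>\<^sub>b F f \<phi>" unfolding VP_unique_solution_def by blast
  then interpret given_solution n\<^sub>e F \<phi>\<^sub>b f \<phi> by unfold_locales (use assms in auto)
  show "\<phi>\<^sub>b \<in> Bset n\<^sub>e F" by (rule \<phi>\<^sub>b_in_Bset)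
next
  assume "\<phi>\<^sub>b \<in> Bset n\<^sub>e F"
  then obtain \<phi> where \<phi>: "sheath n\<^sub>e F \<phi>\<^sub>b \<phi>" and uniq: "\<And>\<eta> x. sheath n\<^sub>e F \<phi>\<^sub>b \<eta> \<Longrightarrow> 0 \<le> x \<Longrightarrow> \<eta> x = \<phi> x"
    using sheath_unique_existence by blast
  show "VP_unique_solution n\<^sub>e 0 (\<lambda>_. 0) \<phi>\<^sub>b F"
    unfolding VP_unique_solution_def
  proof (intro exI conjI allI impI)
    show "VP_solution n\<^sub>e 0 (\<lambda>_. 0) \<phi>\<^sub>b F (transported F \<phi>) \<phi>" by (rule sheath.transported_solution[OF \<phi>])
    fix g \<eta> x assume s: "VP_solution n\<^sub>e 0 (\<lambda>_. 0) \<phi>\<^sub>b F g \<eta>" and x: "0 \<le> (x::real)"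
    interpret s: given_solution n\<^sub>e F \<phi>\<^sub>b g \<eta> by unfold_locales (use assms s in auto)
    show eq: "\<eta> x = \<phi> x" by (rule uniq[OF s.sheath_solution x])
    show "AE \<xi> in lebesgue. g x \<xi> = transported F \<phi> x \<xi>"
      using s.f_eq_accelerated[OF x] unfolding transported_eq eq .
  qed
qed

lemma solution_facts:
  assumes "0 < \<phi>\<^sub>b" and "VP_solution n\<^sub>e 0 (\<lambda>_. 0) \<phi>\<^sub>b F f \<phi>"
  shows "\<phi>\<^sub>b \<in> Bset n\<^sub>e F" and "sheath n\<^sub>e F \<phi>\<^sub>b \<phi>"
    and "\<And>x. 0 \<le> x \<Longrightarrow> AE \<xi> in lebesgue. f x \<xi> = transported F \<phi> x \<xi>"
proof -
  interpret given_solution n\<^sub>e F \<phi>\<^sub>b f \<phi> by unfold_locales (use assms in auto)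
  show "\<phi>\<^sub>b \<in> Bset n\<^sub>e F" "sheath n\<^sub>e F \<phi>\<^sub>b \<phi>" by (rule \<phi>\<^sub>b_in_Bset sheath_solution)+
  show "AE \<xi> in lebesgue. f x \<xi> = transported F \<phi> x \<xi>" if "0 \<le> x" for x
    using f_eq_accelerated[OF that] by (simp add: transported_eq)
qed

end

section \<open>Independence of the representative of the density at infinity\<close>

text \<open>The functions differ only on a null set \<open>N\<close>, and acceleration does not increase the mean of the indicator of \<open>N\<close>.\<close>

lemma accelerated_AE_cong:
  assumes fg: "AE \<xi> in lebesgue. f \<xi> = g \<xi>" and a: "0 \<le> a"
  shows "AE \<xi> in lebesgue. accelerated f a \<xi> = accelerated g a \<xi>"
proof -
  have "AE \<xi> in lborel. f \<xi> = g \<xi>" using fg by (simp only: AE_completion_iff)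
  then obtain N where N2: "{\<xi> \<in> space lborel. f \<xi> \<noteq> g \<xi>} \<subseteq> N"
    and N0: "emeasure lborel N = 0" and Ns: "N \<in> sets lborel" by (rule AE_E)
  then have N: "N \<in> null_sets lborel" "{\<xi> \<in> space lborel. f \<xi> \<noteq> g \<xi>} \<subseteq> N" by auto
  have Nm [measurable]: "N \<in> sets borel" using N(1) by (auto simp: null_sets_def)
  have Ni: "integrable lborel (indicat_real N)"
    using N(1) by (intro integrable_real_indicator) (auto simp: null_sets_def)
  have "AE \<eta> in lborel. indicat_real N \<eta> = 0"
    using AE_not_in[OF N(1)] by eventually_elim simp
  then have z: "(LINT \<eta>|lborel. fall_jacobian a \<eta> * (indicat_real N \<eta> * 1)) = 0"
    by (intro integral_eq_zero_AE) (auto elim: eventually_mono)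
  have "(LINT \<xi>|lborel. accelerated (indicat_real N) a \<xi>) = 0"
    using accelerated_integral[of "indicat_real N" "\<lambda>_. 1" a] a z by simp
  moreover have "integrable lborel (accelerated (indicat_real N) a)" by (rule integrable_accelerated[OF Ni a])
  ultimately have "AE \<xi> in lborel. accelerated (indicat_real N) a \<xi> = 0"
    by (subst (asm) integral_nonneg_eq_0_iff_AE) (auto simp: accelerated_def)
  then have "AE \<xi> in lborel. accelerated f a \<xi> = accelerated g a \<xi>"
  proof eventually_elim
    case (elim \<xi>)
    then show ?case using N(2) by (auto simp: accelerated_def indicator_def split: if_splits)
  qed
  then show ?thesis by (rule AE_completion)
qed

lemma
  assumes fg: "AE \<xi> in lebesgue. f \<xi> = g \<xi>" and f: "integrable lebesgue f" and g: "integrable lebesgue g"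
  shows rho_i_AE_cong: "rho_i f = rho_i g"
    and Bset_AE_cong: "Bset n\<^sub>e f = Bset n\<^sub>e g"
    and supB_AE_cong: "supB n\<^sub>e f = supB n\<^sub>e g"
    and Bohm_integral_AE_cong: "Bohm_integral f = Bohm_integral g"
    and VP_solution_AE_cong: "VP_solution n\<^sub>e \<alpha> f\<^sub>b \<phi>\<^sub>b f u \<phi> \<longleftrightarrow> VP_solution n\<^sub>e \<alpha> f\<^sub>b \<phi>\<^sub>b g u \<phi>"
proof -
  show r: "rho_i f = rho_i g"
  proof
    fix s
    have k: "(\<lambda>\<xi>::vel. - fst \<xi> / sqrt ((fst \<xi>)\<^sup>2 + 2 * s)) \<in> borel_measurable lebesgue"
      by (rule measurable_completion) measurable
    show "rho_i f s = rho_i g s"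
      unfolding rho_i_def
    proof (rule integral_cong_AE)
      show "(\<lambda>\<xi>. f \<xi> * (- fst \<xi> / sqrt ((fst \<xi>)\<^sup>2 + 2 * s))) \<in> borel_measurable lebesgue"
        "(\<lambda>\<xi>. g \<xi> * (- fst \<xi> / sqrt ((fst \<xi>)\<^sup>2 + 2 * s))) \<in> borel_measurable lebesgue"
        by (intro borel_measurable_times k borel_measurable_integrable f g)+
    qed (use fg in \<open>auto elim: eventually_mono\<close>)
  qed
  show B: "Bset n\<^sub>e f = Bset n\<^sub>e g" unfolding Bset_def Vpot_def r ..
  show "supB n\<^sub>e f = supB n\<^sub>e g" unfolding supB_def B ..
  show "Bohm_integral f = Bohm_integral g"
    unfolding Bohm_integral_def by (rule nn_integral_cong_AE) (use fg in \<open>auto elim: eventually_mono\<close>)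
  have d: "(LINT \<xi>|lebesgue. \<bar>u x \<xi> - f \<xi>\<bar>) = (LINT \<xi>|lebesgue. \<bar>u x \<xi> - g \<xi>\<bar>)" if "integrable lebesgue (u x)" for x
    by (rule integral_cong_AE) (use that f g fg in \<open>auto elim: eventually_mono\<close>)
  have "((\<lambda>x. LINT \<xi>|lebesgue. \<bar>u x \<xi> - f \<xi>\<bar>) \<longlongrightarrow> 0) at_top \<longleftrightarrow> ((\<lambda>x. LINT \<xi>|lebesgue. \<bar>u x \<xi> - g \<xi>\<bar>) \<longlongrightarrow> 0) at_top"
    if "C_L1 u"
    by (rule tendsto_cong, rule eventually_mono[OF eventually_ge_at_top[of "0::real"]])
       (use that in \<open>auto intro!: d simp: C_L1_def\<close>)
  then show "VP_solution n\<^sub>e \<alpha> f\<^sub>b \<phi>\<^sub>b f u \<phi> \<longleftrightarrow> VP_solution n\<^sub>e \<alpha> f\<^sub>b \<phi>\<^sub>b g u \<phi>"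
    unfolding VP_solution_def by blast
qed

lemma far_field_representative:
  assumes n: "C2_on UNIV n\<^sub>e" "n\<^sub>e 0 = 1" "deriv n\<^sub>e 0 = -1"
    and f: "integrable lebesgue f" "AE \<xi> in lebesgue. 0 \<le> f \<xi>" "(LINT \<xi>|lebesgue. f \<xi>) = 1"
      "AE \<xi> in lebesgue. 0 < fst \<xi> \<longrightarrow> f \<xi> = 0"
  obtains F where "far_field n\<^sub>e F" and "AE \<xi> in lebesgue. f \<xi> = F \<xi>" and "integrable lebesgue F"
proof -
  have "f \<in> borel_measurable (completion lborel)" using f(1) by simp
  then obtain g where g [measurable]: "g \<in> borel_measurable lborel" and fg: "AE \<xi> in lborel. f \<xi> = g \<xi>"
    using completion_ex_borel_measurable_real by blast
  define F where "F \<xi> = (if fst \<xi> < 0 then max 0 (g \<xi>) else 0)" for \<xi>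
  have Fm [measurable]: "F \<in> borel_measurable borel"
    unfolding F_def[abs_def] using g by measurable
  have fF: "AE \<xi> in lebesgue. f \<xi> = F \<xi>"
    using f(2) f(4) AE_completion[OF fg] AE_completion[OF AE_fst_neq[of 0]]
    by eventually_elim (auto simp: F_def max_def)
  have Fl: "F \<in> borel_measurable lebesgue" by (rule measurable_completion) simp
  have Fi: "integrable lebesgue F"
    by (rule integrable_cong_AE_imp[OF f(1) Fl]) (use fF in \<open>auto elim: eventually_mono\<close>)
  have "(LINT \<xi>|lebesgue. F \<xi>) = (LINT \<xi>|lebesgue. f \<xi>)"
    by (rule integral_cong_AE) (use f(1) Fi fF in \<open>auto elim: eventually_mono\<close>)
  then have "far_field n\<^sub>e F"
    using n f(3) Fi by unfold_locales (auto simp: F_def integrable_completion integral_completion)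
  then show thesis using that fF Fi by blast
qed

lemma open_null_set_empty:
  fixes S :: "vel set"
  assumes "open S" and "AE \<xi> in lebesgue. \<xi> \<notin> S"
  shows "S = {}"
proof (rule ccontr)
  assume "S \<noteq> {}"
  then have "\<not> negligible S" by (rule open_not_negligible[OF assms(1)])
  moreover have "negligible S"
    using assms by (simp add: negligible_iff_null_sets AE_iff_null_sets borel_open)
  ultimately show False by blast
qed

text \<open>A continuous representative satisfies the sign and support conditions everywhere, because a nonempty open
  set is not a null set.\<close>

lemma far_field_continuous:
  assumes n: "C2_on UNIV n\<^sub>e" "n\<^sub>e 0 = 1" "deriv n\<^sub>e 0 = -1"
    and f: "integrable lebesgue f" "AE \<xi> in lebesgue. 0 \<le> f \<xi>" "(LINT \<xi>|lebesgue. f \<xi>) = 1"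
      "AE \<xi> in lebesgue. 0 < fst \<xi> \<longrightarrow> f \<xi> = 0" and c: "continuous_on UNIV f"
  shows "far_field n\<^sub>e f"
proof -
  have fm [measurable]: "f \<in> borel_measurable borel" by (rule borel_measurable_continuous_onI[OF c])
  have "{\<xi>. f \<xi> < 0} = {}"
    by (rule open_null_set_empty) (use f(2) c in \<open>auto intro: open_Collect_less continuous_intros elim: eventually_mono\<close>)
  then have nn: "0 \<le> f \<xi>" for \<xi> by (metis (no_types, lifting) empty_iff mem_Collect_eq not_le)
  have "{\<xi>. 0 < fst \<xi>} \<inter> {\<xi>. f \<xi> \<noteq> 0} = {}"
    by (rule open_null_set_empty)
       (use f(4) c in \<open>auto intro!: open_Int open_Collect_less open_Collect_neq continuous_intros elim: eventually_mono\<close>)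
  then have pos: "f \<xi> = 0" if "0 < fst \<xi>" for \<xi> using that by blast
  have zero: "f \<xi> = 0" if "0 \<le> fst \<xi>" for \<xi>
  proof -
    have "f (t, snd \<xi>) = 0" if "t \<in> {0..}" for t
      by (rule continuous_constant_on_closure[where S = "{0<..}" and f = "\<lambda>t. f (t, snd \<xi>)"])
         (use pos that in \<open>auto intro!: continuous_on_compose2[OF c] continuous_intros\<close>)
    from this[of "fst \<xi>"] that show ?thesis by simp
  qed
  show ?thesis
    using n f nn zero by unfold_locales (auto simp: integrable_completion integral_completion)
qed

section \<open>The Bohm criterion and the existence of sheaths\<close>

theorem theorem2p2:
  fixes n\<^sub>e :: "real \<Rightarrow> real" and f_inf :: "vel \<Rightarrow> real" and \<phi>\<^sub>b :: real
  assumes "C2_on UNIV n\<^sub>e" and "n\<^sub>e 0 = 1" and "deriv n\<^sub>e 0 = -1"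
    and "\<phi>\<^sub>b > 0"
    and "integrable lebesgue f_inf"
    and "AE \<xi> in lebesgue. f_inf \<xi> \<ge> 0"
    and "(LINT \<xi>|lebesgue. f_inf \<xi>) = 1"
    and "AE \<xi> in lebesgue. fst \<xi> > 0 \<longrightarrow> f_inf \<xi> = 0"
  shows
    "(Bohm_integral f_inf < 1 \<longrightarrow>
        Bset n\<^sub>e f_inf \<noteq> {} \<and>
        (VP_unique_solution n\<^sub>e 0 (\<lambda>_. 0) \<phi>\<^sub>b f_inf \<longleftrightarrow> ereal \<phi>\<^sub>b < supB n\<^sub>e f_inf) \<and>
        (ereal \<phi>\<^sub>b < supB n\<^sub>e f_inf \<longrightarrow>
          (\<forall>f \<phi>. VP_solution n\<^sub>e 0 (\<lambda>_. 0) \<phi>\<^sub>b f_inf f \<phi> \<longrightarrow>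
             (\<forall>x\<ge>0. AE \<xi> in lebesgue. f x \<xi> = transported f_inf \<phi> x \<xi>) \<and>
             (\<exists>c>0. \<exists>C>0. \<forall>l\<le>2. \<forall>x\<ge>0. \<bar>(Dx ^^ l) \<phi> x\<bar> \<le> C * exp (- c * x)) \<and>
             (C2_on UNIV f_inf \<longrightarrow>
               (\<exists>g. (\<forall>x\<ge>0. AE \<xi> in lebesgue. f x \<xi> = g x \<xi>) \<and>
                  VP_classical_solution n\<^sub>e 0 (\<lambda>_. 0) \<phi>\<^sub>b f_inf g \<phi>)))))
     \<and>
     (Bohm_integral f_inf = 1 \<and> Bset n\<^sub>e f_inf \<noteq> {} \<longrightarrow>
        (VP_unique_solution n\<^sub>e 0 (\<lambda>_. 0) \<phi>\<^sub>b f_inf \<longleftrightarrow> ereal \<phi>\<^sub>b < supB n\<^sub>e f_inf) \<and>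
        (ereal \<phi>\<^sub>b < supB n\<^sub>e f_inf \<longrightarrow>
          (\<forall>f \<phi>. VP_solution n\<^sub>e 0 (\<lambda>_. 0) \<phi>\<^sub>b f_inf f \<phi> \<longrightarrow>
             (\<forall>x\<ge>0. AE \<xi> in lebesgue. f x \<xi> = transported f_inf \<phi> x \<xi>) \<and>
             (C2_on UNIV f_inf \<longrightarrow>
               (\<exists>g. (\<forall>x\<ge>0. AE \<xi> in lebesgue. f x \<xi> = g x \<xi>) \<and>
                  VP_classical_solution n\<^sub>e 0 (\<lambda>_. 0) \<phi>\<^sub>b f_inf g \<phi>)))))
     \<and>
     (Bohm_integral f_inf = 1 \<and> Bset n\<^sub>e f_inf = {} \<longrightarrow>
        (\<nexists>f \<phi>. VP_solution n\<^sub>e 0 (\<lambda>_. 0) \<phi>\<^sub>b f_inf f \<phi>))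
     \<and>
     (Bohm_integral f_inf > 1 \<longrightarrow>
        (\<nexists>f \<phi>. VP_solution n\<^sub>e 0 (\<lambda>_. 0) \<phi>\<^sub>b f_inf f \<phi>))"
proof -
  obtain F where F: "far_field n\<^sub>e F" and ae: "AE \<xi> in lebesgue. f_inf \<xi> = F \<xi>" and Fi: "integrable lebesgue F"
    using far_field_representative[OF assms(1-3,5-8)] .
  interpret far_field n\<^sub>e F by (rule F)
  have B: "Bset n\<^sub>e f_inf = Bset n\<^sub>e F" and S: "supB n\<^sub>e f_inf = supB n\<^sub>e F" and I: "Bohm_integral f_inf = Bohm_integral F"
    using Bset_AE_cong[OF ae assms(5) Fi] supB_AE_cong[OF ae assms(5) Fi] Bohm_integral_AE_cong[OF ae assms(5) Fi] by auto
  have sol: "VP_solution n\<^sub>e 0 (\<lambda>_. 0) \<phi>\<^sub>b f_inf f \<phi> \<longleftrightarrow> VP_solution n\<^sub>e 0 (\<lambda>_. 0) \<phi>\<^sub>b F f \<phi>" for f \<phi>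
    by (rule VP_solution_AE_cong[OF ae assms(5) Fi])
  have uniq: "VP_unique_solution n\<^sub>e 0 (\<lambda>_. 0) \<phi>\<^sub>b f_inf \<longleftrightarrow> ereal \<phi>\<^sub>b < supB n\<^sub>e f_inf"
    using unique_solution_iff_Bset[OF assms(4)] Bset_iff_less_supB[OF assms(4)]
    unfolding VP_unique_solution_def sol S by simp
  have tr: "\<forall>x\<ge>0. AE \<xi> in lebesgue. f x \<xi> = transported f_inf \<phi> x \<xi>"
    if s: "VP_solution n\<^sub>e 0 (\<lambda>_. 0) \<phi>\<^sub>b f_inf f \<phi>" for f \<phi>
  proof (intro allI impI)
    fix x :: real assume x: "0 \<le> x"
    note facts = solution_facts[OF assms(4) s[unfolded sol]]
    have "0 \<le> \<phi> x" using sheath.\<phi>_range[OF facts(2) x] by simp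
    from accelerated_AE_cong[OF ae this] facts(3)[OF x]
    show "AE \<xi> in lebesgue. f x \<xi> = transported f_inf \<phi> x \<xi>"
      by eventually_elim (simp add: transported_eq)
  qed
  have decay: "\<exists>c>0. \<exists>C>0. \<forall>l\<le>2. \<forall>x\<ge>0. \<bar>(Dx ^^ l) \<phi> x\<bar> \<le> C * exp (- c * x)"
    if s: "VP_solution n\<^sub>e 0 (\<lambda>_. 0) \<phi>\<^sub>b f_inf f \<phi>" and "Bohm_integral f_inf < 1" for f \<phi>
    using sheath.decay[OF solution_facts(2)[OF assms(4) s[unfolded sol]]] that(2) I by simp
  have cl: "\<exists>g. (\<forall>x\<ge>0. AE \<xi> in lebesgue. f x \<xi> = g x \<xi>) \<and> VP_classical_solution n\<^sub>e 0 (\<lambda>_. 0) \<phi>\<^sub>b f_inf g \<phi>"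
    if s: "VP_solution n\<^sub>e 0 (\<lambda>_. 0) \<phi>\<^sub>b f_inf f \<phi>" and C2: "C2_on UNIV f_inf" for f \<phi>
  proof -
    have "continuous_on UNIV f_inf"
      using C2 unfolding C2_on_def continuous_on_eq_continuous_within using has_derivative_continuous by blast
    then have "far_field n\<^sub>e f_inf" by (rule far_field_continuous[OF assms(1-3,5-8)])
    from sheath.transported_classical[OF far_field.solution_facts(2)[OF this assms(4) s] C2] tr[OF s]
    show ?thesis by blast
  qed
  have none: "\<nexists>f \<phi>. VP_solution n\<^sub>e 0 (\<lambda>_. 0) \<phi>\<^sub>b f_inf f \<phi>" if "Bset n\<^sub>e f_inf = {}"
    using that solution_facts(1)[OF assms(4)] unfolding sol B by blast
  have i: "Bset n\<^sub>e f_inf \<noteq> {}" if "Bohm_integral f_inf < 1"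
    using Bset_nonempty_if_Bohm_small that unfolding B I by blast
  have iv: "Bset n\<^sub>e f_inf = {}" if "Bohm_integral f_inf > 1"
    using Bset_empty_if_Bohm_large that unfolding B I by blast
  show ?thesis
    using uniq tr decay cl none i iv by (intro conjI impI allI) auto
qed

end
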